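(* Let $X$ be a standard absolutely continuous Markov process on $E$ which has the Inversion Property with continuous characteristics $(I,h,v)$. Then: (i) the process $X^h$ has the Inversion Property with characteristics $(I,h^{-1},v)$; (ii) the process $I(X)$ has the Inversion Property with characteristics $(I,h^{-1},v^{-1})$.
   Context: State space: $S\subset\mathbb R^n$ is an unbounded locally compact set with $0\in S$, and $E=S\cup\{\infty\}$ is its Alexandroff one-point compactification, with its Borel $\sigma$-field. Write $\mathring S$ for the interior of $S$ and $\mathring E=\mathring S\setminus\{0\}$ ("the interior of $E$"). Process: $X=((X_t)_{t\ge0},(\mathbb P_x)_{x\in E})$ is a standard Markov process on $E$ (in the sense of Blumenthal and Getoor): strong Markov, right-continuous with left limits, quasi-left-continuous on $[0,\zeta)$, where $\zeta=\inf\{s>0: X_s\notin\mathring S\setminus\{0\}\}$ is the lifetime. $X$ is absorbed at $\partial S\cup\{0,\infty\}$: it is sent to $0$ when it leaves $\mathring S\setminus\{0\}$ through $\partial S\cup\{0\}$ and to $\infty$ otherwise. $X$ is irreducible: from any point of $\mathring S\setminus\{0\}$ it reaches any nonempty open subset of $E$ with positive probability. "Absolutely continuous" means that the semigroup has the form $p_t(x,dy)=p_t(x,y)\,dy$ with respect to Lebesgue measure on $E$. Excessive functions and Doob transform: for a Markov process $Z$ on $E$, a Borel function $h\ge 0$ is $Z$-excessive if $\mathbb E_xh(Z_t)\le h(x)$ for all $x,t$ and $\lim_{t\to0+}\mathbb E_xh(Z_t)=h(x)$ for all $x$. With $E_h=\{0<h<\infty\}$, the Doob $h$-transform $Z^h$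 is the (sub-)Markov process with semigroup $\frac{h(y)}{h(x)}Q^h_t(x,dy)$ for $x\in E_h$ and $0$ for $x\notin E_h$, where $Q^h_t$ is the semigroup of $Z$ killed on exiting $E_h$. Inversion Property: a process $Z$ on $E$ has the Inversion Property (IP) with characteristics $(I,h,v)$ if $I\neq\mathrm{Id}$ is an involution of $E$, $h\ge0$ is a $Z$-excessive function on $E$ with $0<h<\infty$ on $\mathring E$, $v$ is a positive continuous function and, for every $x\in E$, the process $(I(Z_{\gamma_t}),t\ge0)$ with $Z_0=x$ has the same law as $(Z^h_t,t\ge0)$ with $Z^h_0=I(x)$. Here $\gamma_t$ is the inverse of $A_t=\int_0^tv^{-1}(Z_s)\,ds$ and $Z^h$ is killed when it exits $\mathring E$. The characteristics are called continuous if $I$ and $h$ are continuous on $\mathring E$.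
   Formalization: Points outside the interior of E count as dead: expectations in "excessive" are taken before the lifetime, the limit as t→0 is asked only at interior points (at dead points it fails for 1/h, e.g. Brownian motion in R^3), and v is positive and continuous on the interior of E. *)

theory Defs
  imports "HOL-Probability.Probability"
begin

section \<open>State space\<close>

text \<open>
  The compactification \<open>E = S \<union> {\<infinity>}\<close> lives on the type \<^typ>\<open>'a option\<close>: the point \<open>\<infinity>\<close> is
  \<^term>\<open>None\<close>, and a point \<open>x\<close> of \<open>S\<close> is \<^term>\<open>Some x\<close>.
\<close>

definition E_top :: "'a::euclidean_space set \<Rightarrow> 'a option topology" where
  "E_top S = Alexandroff_compactification (top_of_set S)"

abbreviation E_space :: "'a::euclidean_space set \<Rightarrow> 'a option set" where
  "E_space S \<equiv> topspace (E_top S)"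

definition E_borel :: "'a::euclidean_space set \<Rightarrow> 'a option measure" where
  "E_borel S = sigma (E_space S) {U. openin (E_top S) U}"

definition E_int :: "'a::euclidean_space set \<Rightarrow> 'a option set" where
  "E_int S = Some ` (interior S - {0})"

definition E_lebesgue :: "'a::euclidean_space set \<Rightarrow> 'a option measure" where
  "E_lebesgue S = distr (restrict_space lborel S) (E_borel S) Some"

locale state_space =
  fixes S :: "'a::euclidean_space set"
  assumes unbounded_S: "\<not> bounded S"
    and locally_compact_S: "locally compact S"
    and zero_in_S: "0 \<in> S"

section \<open>Killed processes and their semigroups\<close>

text \<open>
  A process on \<open>E\<close> is given by a family \<open>P\<close> of laws, indexed by the starting point, and a path map
  \<open>Z\<close>; only times \<open>t \<ge> 0\<close> matter. Its lifetime is the exit time from \<^const>\<open>E_int\<close>. All points of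
  \<open>E\<close> outside \<^const>\<open>E_int\<close> thus play the role of the cemetery, and functions are only integrated
  before the lifetime. In particular a process killed at its exit from \<^const>\<open>E_int\<close> needs no extra
  cemetery state.
\<close>

definition exit_time :: "'s set \<Rightarrow> (real \<Rightarrow> 'w \<Rightarrow> 's) \<Rightarrow> 'w \<Rightarrow> ennreal" where
  "exit_time U Z w = Inf {ennreal s | s. 0 < s \<and> Z s w \<notin> U}"

abbreviation lifetime :: "'a::euclidean_space set \<Rightarrow> (real \<Rightarrow> 'w \<Rightarrow> 'a option) \<Rightarrow> 'w \<Rightarrow> ennreal" where
  "lifetime S \<equiv> exit_time (E_int S)"

text \<open>
  The semigroup \<open>B \<mapsto> P_x(Z_t \<in> B, t < T)\<close> of the process killed at its exit time \<open>T\<close> from \<open>U\<close>.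
\<close>

definition killed_kernel ::
  "'a::euclidean_space set \<Rightarrow> ('a option \<Rightarrow> 'w measure) \<Rightarrow> (real \<Rightarrow> 'w \<Rightarrow> 'a option)
     \<Rightarrow> 'a option set \<Rightarrow> real \<Rightarrow> 'a option \<Rightarrow> 'a option measure" where
  "killed_kernel S P Z U t x =
     distr (restrict_space (P x) {w \<in> space (P x). ennreal t < exit_time U Z w}) (E_borel S) (Z t)"

text \<open>
  At a point outside \<^const>\<open>E_int\<close> the process is dead from the start, and \<open>t \<rightarrow> 0\<close> gives \<open>0\<close> whatever
  \<open>h\<close> is there; convergence is therefore only asked at the points of \<^const>\<open>E_int\<close>.
\<close>

definition excessive ::
  "'a::euclidean_space set \<Rightarrow> ('a option \<Rightarrow> 'w measure) \<Rightarrow> (real \<Rightarrow> 'w \<Rightarrow> 'a option)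
     \<Rightarrow> ('a option \<Rightarrow> ennreal) \<Rightarrow> bool" where
  "excessive S P Z h \<longleftrightarrow>
     h \<in> borel_measurable (E_borel S) \<and>
     (\<forall>x \<in> E_space S. \<forall>t \<ge> 0. (\<integral>\<^sup>+ y. h y \<partial>killed_kernel S P Z (E_int S) t x) \<le> h x) \<and>
     (\<forall>x \<in> E_int S.
        ((\<lambda>t. \<integral>\<^sup>+ y. h y \<partial>killed_kernel S P Z (E_int S) t x) \<longlongrightarrow> h x) (at_right 0))"

definition doob_set :: "'a::euclidean_space set \<Rightarrow> ('a option \<Rightarrow> ennreal) \<Rightarrow> 'a option set" where
  "doob_set S h = {x \<in> E_space S. 0 < h x \<and> h x < \<infinity>}"

text \<open>
  The semigroup of the Doob transform, which is killed on exiting both \<open>{0 < h < \<infinity>}\<close> and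
  \<^const>\<open>E_int\<close>.
\<close>

definition doob_kernel ::
  "'a::euclidean_space set \<Rightarrow> ('a option \<Rightarrow> 'w measure) \<Rightarrow> (real \<Rightarrow> 'w \<Rightarrow> 'a option)
     \<Rightarrow> ('a option \<Rightarrow> ennreal) \<Rightarrow> real \<Rightarrow> 'a option \<Rightarrow> 'a option measure" where
  "doob_kernel S P Z h t x =
     (if x \<in> doob_set S h
      then density (killed_kernel S P Z (doob_set S h \<inter> E_int S) t x) (\<lambda>y. h y / h x)
      else null_measure (E_borel S))"

text \<open>
  \<open>fdd K x s [(t1,B1),\<dots>,(tk,Bk)]\<close> is the probability that a sub-Markov process with semigroup \<open>K\<close>
  which is at \<open>x\<close> at time \<open>s\<close> is alive and in \<open>Bi\<close> at each of the times \<open>s \<le> t1 < \<dots> < tk\<close>.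
\<close>

fun fdd :: "(real \<Rightarrow> 's \<Rightarrow> 's measure) \<Rightarrow> 's \<Rightarrow> real \<Rightarrow> (real \<times> 's set) list \<Rightarrow> ennreal" where
  "fdd K x s [] = 1"
| "fdd K x s ((t, B) # l) = (\<integral>\<^sup>+ y. indicator B y * fdd K y t l \<partial>K (t - s) x)"

text \<open>
  Under the probability \<open>M\<close>, the process \<open>Z\<close> with lifetime \<open>L\<close> has the law of the sub-Markov process
  with semigroup \<open>K\<close> started at \<open>x\<close>.
\<close>

definition has_law ::
  "'a::euclidean_space set \<Rightarrow> 'w measure \<Rightarrow> (real \<Rightarrow> 'w \<Rightarrow> 'a option) \<Rightarrow> ('w \<Rightarrow> ennreal)
     \<Rightarrow> (real \<Rightarrow> 'a option \<Rightarrow> 'a option measure) \<Rightarrow> 'a option \<Rightarrow> bool" where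
  "has_law S M Z L K x \<longleftrightarrow>
     (\<forall>l. sorted_wrt (<) (map fst l) \<and> (\<forall>(t, B) \<in> set l. 0 \<le> t \<and> B \<in> sets (E_borel S)) \<longrightarrow>
        emeasure M {w \<in> space M. \<forall>(t, B) \<in> set l. ennreal t < L w \<and> Z t w \<in> B} = fdd K x 0 l)"

text \<open>
  \<open>(Q, Y)\<close> is a right-continuous version of the Doob transform of \<open>(P, Z)\<close>. Right-continuity is only
  needed while \<open>Y\<close> is alive.
\<close>

definition doob_transform ::
  "'a::euclidean_space set \<Rightarrow> ('a option \<Rightarrow> 'w measure) \<Rightarrow> (real \<Rightarrow> 'w \<Rightarrow> 'a option)
     \<Rightarrow> ('a option \<Rightarrow> ennreal) \<Rightarrow> ('a option \<Rightarrow> 'v measure) \<Rightarrow> (real \<Rightarrow> 'v \<Rightarrow> 'a option) \<Rightarrow> bool" where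
  "doob_transform S P Z h Q Y \<longleftrightarrow>
     (\<forall>x \<in> E_space S.
        prob_space (Q x) \<and>
        (\<forall>t \<ge> 0. Y t \<in> measurable (Q x) (E_borel S)) \<and>
        (\<forall>w \<in> space (Q x). \<forall>t \<ge> 0.
           (Y t w \<in> E_int S \<longrightarrow> limitin (E_top S) (\<lambda>s. Y s w) (Y t w) (at_right t)) \<and>
           (Y t w \<notin> E_int S \<longrightarrow> (\<forall>s \<ge> t. Y s w \<notin> E_int S))) \<and>
        has_law S (Q x) Y (lifetime S Y) (doob_kernel S P Z h) x)"

section \<open>Inversion property\<close>

text \<open>The clock \<open>A_t = \<integral>_0^t 1/v(Z_s) ds\<close> only runs during the lifetime.\<close>

definition clock ::
  "'a::euclidean_space set \<Rightarrow> ('a option \<Rightarrow> real) \<Rightarrow> (real \<Rightarrow> 'w \<Rightarrow> 'a option)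
     \<Rightarrow> ennreal \<Rightarrow> 'w \<Rightarrow> ennreal" where
  "clock S v Z t w =
     (\<integral>\<^sup>+ s. indicator {s. 0 \<le> s \<and> ennreal s < min t (lifetime S Z w)} s
              * ennreal (inverse (v (Z s w))) \<partial>lborel)"

definition time_change ::
  "'a::euclidean_space set \<Rightarrow> ('a option \<Rightarrow> real) \<Rightarrow> (real \<Rightarrow> 'w \<Rightarrow> 'a option)
     \<Rightarrow> real \<Rightarrow> 'w \<Rightarrow> real" where
  "time_change S v Z t w = Inf {s. 0 \<le> s \<and> ennreal t < clock S v Z (ennreal s) w}"

definition has_IP ::
  "'a::euclidean_space set \<Rightarrow> ('a option \<Rightarrow> 'w measure) \<Rightarrow> (real \<Rightarrow> 'w \<Rightarrow> 'a option)
     \<Rightarrow> ('a option \<Rightarrow> 'a option) \<Rightarrow> ('a option \<Rightarrow> ennreal) \<Rightarrow> ('a option \<Rightarrow> real) \<Rightarrow> bool" where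
  "has_IP S P Z I h v \<longleftrightarrow>
     (\<forall>x \<in> E_space S. I x \<in> E_space S \<and> I (I x) = x) \<and>
     (\<exists>x \<in> E_space S. I x \<noteq> x) \<and>
     excessive S P Z h \<and>
     (\<forall>x \<in> E_int S. 0 < h x \<and> h x < \<infinity>) \<and>
     (\<forall>x \<in> E_int S. 0 < v x) \<and>
     continuous_map (subtopology (E_top S) (E_int S)) euclideanreal v \<and>
     (\<forall>x \<in> E_space S.
        has_law S (P x) (\<lambda>t w. I (Z (time_change S v Z t w) w)) (clock S v Z \<infinity>)
          (doob_kernel S P Z h) (I x))"

definition continuous_characteristics ::
  "'a::euclidean_space set \<Rightarrow> ('a option \<Rightarrow> 'a option) \<Rightarrow> ('a option \<Rightarrow> ennreal) \<Rightarrow> bool" where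
  "continuous_characteristics S I h \<longleftrightarrow>
     continuous_map (subtopology (E_top S) (E_int S)) (E_top S) I \<and>
     continuous_map (subtopology (E_top S) (E_int S)) euclidean h"

section \<open>Standard processes\<close>

text \<open>
  The filtration is indexed by \<open>[0, \<infinity>]\<close>, with the whole \<open>\<sigma>\<close>-algebra at \<open>\<infinity>\<close>, so that stopping times may
  be infinite. In \<open>augmented\<close>, the condition \<open>AE x in \<mu>. emeasure (P x) N = 0\<close> says that \<open>N\<close> is null
  under the law with initial distribution \<open>\<mu>\<close>.

  In \<open>exit_rule\<close> the limits are limits in the Euclidean space, because a point of the frontier of \<open>S\<close>
  need not belong to \<open>S\<close>. If the process leaves by a jump from the interior, the destination of the
  jump cannot be read off the path: then \<open>0\<close> means that the jump led to the frontier or to \<open>0\<close>, and \<open>\<infinity>\<close>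
  that it did not.
\<close>

locale standard_process = state_space S + filtration "space M" F
  for S :: "'a::euclidean_space set" and M :: "'w measure" and F :: "ennreal \<Rightarrow> 'w measure" +
  fixes \<theta> :: "real \<Rightarrow> 'w \<Rightarrow> 'w"
    and P :: "'a option \<Rightarrow> 'w measure"
    and X :: "real \<Rightarrow> 'w \<Rightarrow> 'a option"
  assumes F_sub: "\<And>t. sets (F t) \<subseteq> sets M"
    and F_top: "sets (F \<infinity>) = sets M"
    and F_right_continuous: "\<And>t. t < \<infinity> \<Longrightarrow> sets (F t) = (\<Inter>s \<in> {t<..}. sets (F s))"
    and augmented: "\<And>t A. \<lbrakk>A \<subseteq> space M;
          \<And>\<mu>. \<lbrakk>prob_space \<mu>; sets \<mu> = sets (E_borel S)\<rbrakk> \<Longrightarrow>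
            \<exists>B \<in> sets (F t). \<exists>N \<in> sets M. (A - B) \<union> (B - A) \<subseteq> N \<and>
              (AE x in \<mu>. emeasure (P x) N = 0)\<rbrakk>
        \<Longrightarrow> A \<in> sets (F t)"
    and prob_P: "\<And>x. x \<in> E_space S \<Longrightarrow> prob_space (P x)"
    and sets_P: "\<And>x. x \<in> E_space S \<Longrightarrow> sets (P x) = sets M"
    and adapted: "\<And>t. 0 \<le> t \<Longrightarrow> X t \<in> measurable (F (ennreal t)) (E_borel S)"
    and measurable_P: "\<And>t B. \<lbrakk>0 \<le> t; B \<in> sets (E_borel S)\<rbrakk> \<Longrightarrow>
          (\<lambda>x. emeasure (P x) {w \<in> space M. X t w \<in> B}) \<in> borel_measurable (E_borel S)"
    and shift: "\<And>s t w. \<lbrakk>0 \<le> s; 0 \<le> t; w \<in> space M\<rbrakk> \<Longrightarrow>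
          \<theta> t w \<in> space M \<and> X s (\<theta> t w) = X (s + t) w"
    and normal: "\<And>x. x \<in> E_space S \<Longrightarrow> AE w in P x. X 0 w = x"
    and right_continuous: "\<And>t w. \<lbrakk>0 \<le> t; w \<in> space M\<rbrakk> \<Longrightarrow>
          limitin (E_top S) (\<lambda>s. X s w) (X t w) (at_right t)"
    and left_limits: "\<And>t w. \<lbrakk>0 < t; w \<in> space M; ennreal t < lifetime S X w\<rbrakk> \<Longrightarrow>
          \<exists>y. limitin (E_top S) (\<lambda>s. X s w) y (at_left t)"
    and strong_Markov_measurable: "\<And>T B. \<lbrakk>stopping_time F T; B \<in> sets (E_borel S)\<rbrakk> \<Longrightarrow>
          {w \<in> space M. T w < \<infinity> \<and> X (enn2real (T w)) w \<in> B} \<in> sets (pre_sigma T)"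
    and strong_Markov: "\<And>T x t B \<Lambda>.
          \<lbrakk>stopping_time F T; x \<in> E_space S; 0 \<le> t; B \<in> sets (E_borel S); \<Lambda> \<in> sets (pre_sigma T)\<rbrakk> \<Longrightarrow>
          emeasure (P x) {w \<in> \<Lambda>. T w < \<infinity> \<and> X (enn2real (T w) + t) w \<in> B} =
          (\<integral>\<^sup>+ w. indicator {w \<in> \<Lambda>. T w < \<infinity>} w
             * emeasure (P (X (enn2real (T w)) w)) {w' \<in> space M. X t w' \<in> B} \<partial>P x)"
    and quasi_left_continuous: "\<And>T x.
          \<lbrakk>\<And>n::nat. stopping_time F (T n); \<And>w. w \<in> space M \<Longrightarrow> incseq (\<lambda>n. T n w); x \<in> E_space S\<rbrakk> \<Longrightarrow>
          AE w in P x. (SUP n. T n w) < lifetime S X w \<longrightarrow>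
            limitin (E_top S) (\<lambda>n. X (enn2real (T n w)) w) (X (enn2real (SUP n. T n w)) w) sequentially"
    and absorbed: "\<And>s t w. \<lbrakk>0 \<le> s; s \<le> t; w \<in> space M; X s w \<notin> E_int S\<rbrakk> \<Longrightarrow> X t w = X s w"
    and exit_rule: "\<And>x. x \<in> E_space S \<Longrightarrow>
          AE w in P x. \<forall>z > 0. X 0 w \<in> E_int S \<and> lifetime S X w = ennreal z \<longrightarrow>
            X z w \<in> {Some 0, None} \<and>
            ((\<exists>b \<in> frontier S \<union> {0}. ((\<lambda>s. the (X s w)) \<longlongrightarrow> b) (at_left z)) \<longrightarrow> X z w = Some 0) \<and>
            (filterlim (\<lambda>s. the (X s w)) at_infinity (at_left z) \<longrightarrow> X z w = None)"
    and irreducible: "\<And>x V. \<lbrakk>x \<in> E_int S; openin (E_top S) V; V \<noteq> {}\<rbrakk> \<Longrightarrow>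
          emeasure (P x) {w \<in> space M. \<exists>t \<ge> 0. X t w \<in> V} > 0"

text \<open>
  Since \<open>X\<close> may be absorbed at the single points \<open>0\<close> and \<open>\<infinity>\<close>, absolute continuity can only concern the
  semigroup before the lifetime.
\<close>

definition absolutely_continuous_process ::
  "'a::euclidean_space set \<Rightarrow> ('a option \<Rightarrow> 'w measure) \<Rightarrow> (real \<Rightarrow> 'w \<Rightarrow> 'a option) \<Rightarrow> bool" where
  "absolutely_continuous_process S P X \<longleftrightarrow>
     (\<exists>p :: real \<Rightarrow> 'a option \<Rightarrow> 'a option \<Rightarrow> ennreal. \<forall>t > 0. \<forall>x \<in> E_space S.
        p t x \<in> borel_measurable (E_borel S) \<and>
        killed_kernel S P X (E_int S) t x = density (E_lebesgue S) (p t x))"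

end

theory Submission
  imports Defs
begin

text \<open>
  Applying the inversion property twice, at \<open>x\<close> and at \<open>I x\<close>, relates \<open>X\<close> to the time change of \<open>X\<close> with
  density \<open>1 / (v (v \<circ> I))\<close> and to its transform by \<open>h (h \<circ> I)\<close>. Everything follows from the two identities
  \<open>v (v \<circ> I) = 1\<close> and \<open>h (h \<circ> I) = const\<close> on the interior of \<open>E\<close>.

  For the first one, let \<open>B\<close> be a small ball around \<open>x\<close> and \<open>G_B f (x)\<close> the expected integral of \<open>f\<close> along
  the path up to the exit from \<open>B\<close>. A change of variables along the path and the inversion property
  give \<open>G_B f (x) = G_B (f b) (x)\<close> with \<open>b(y) = v(y) v(I y) h(y) h(I y) / (h(x) h(I x))\<close>. The function
  \<open>f(y) = P_y(X_\<tau> \<notin> B, X_\<tau> alive)\<close> has \<open>0 < G_B f (x) \<le> \<tau>\<close> for a suitable \<open>\<tau>\<close>, so \<open>b(x) \<noteq> 1\<close> is impossible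
  by continuity.

  For the second one, the probability of hitting an open set is invariant under time changes, while
  the transform by \<open>h\<close> multiplies it by about \<open>h(z) / h(x)\<close> if the set is a small neighbourhood of \<open>z\<close>.
  Two applications give \<open>p \<approx> p h(z) h(I z) / (h(x) h(I x))\<close>, where \<open>p > 0\<close> by irreducibility.

  Since the first identity makes the time-changed inversion of paths an involution, and the law of the
  inverted path is determined by the finite-dimensional distributions, (i) and (ii) follow.
\<close>

section \<open>Right-continuous killed paths\<close>

text \<open>The two identities need different arguments because of what cancels at the starting
  point. At \<open>x\<close> the factor in the Green identity is \<open>v(x) v(I x)\<close>, the
  values of \<open>h\<close> having dropped out; continuity at \<open>x\<close> thus settles
  \<open>v\<close> but says nothing about how \<open>h (h \<circ> I)\<close> varies between points.
  Comparing two points takes a functional that reaches from one to the other, hence hitting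
  probabilities. The test function cannot be the constant 1, since the mean exit time from a ball
  might be infinite; the times in \<open>B\<close> that are followed by a visit outside
  \<open>B\<close> a fixed time later have bounded total length. A recurring obstacle is that
  \<open>has_law\<close> only gives probabilities of being alive in given sets at finitely many
  times, whereas exits, hitting and clocks involve whole paths. Paths are therefore moved to the
  Euclidean space with \<open>0\<close> as dead value, death is recovered by complementation, and
  right-continuity reduces path functionals to countably many times. Moreover the clock might
  explode before the lifetime, which would destroy the involution; quasi-left-continuity excludes
  this almost surely.\<close>

definition dyadic_up :: "nat \<Rightarrow> real \<Rightarrow> real" where
  "dyadic_up n s = (of_int \<lfloor>2 ^ n * s\<rfloor> + 1) / 2 ^ n"

text \<open>Strict because of the summand 1 in the definition: also a dyadic \<open>s\<close> is
  approached from the right, as convergence in \<open>at_right s\<close> requires.\<close>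

lemma dyadic_up_gt: "s < dyadic_up n s"
  unfolding dyadic_up_def by (simp add: field_simps) linarith

lemma dyadic_up_le: "dyadic_up n s \<le> s + (1/2) ^ n"
proof -
  have "of_int \<lfloor>2 ^ n * s\<rfloor> + 1 \<le> 2 ^ n * s + 1" by linarith
  then have "dyadic_up n s \<le> (2 ^ n * s + 1) / 2 ^ n"
    unfolding dyadic_up_def by (intro divide_right_mono) auto
  then show ?thesis by (simp add: add_divide_distrib power_one_over)
qed

lemma dyadic_up_at_right: "filterlim (\<lambda>n. dyadic_up n s) (at_right s) sequentially"
proof -
  have 1: "(\<lambda>n. s + (1/2) ^ n) \<longlonglongrightarrow> s"
    using tendsto_add[OF tendsto_const[of s] LIMSEQ_power_zero[of "1/2::real"]] by simp
  have "(\<lambda>n. dyadic_up n s) \<longlonglongrightarrow> s"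
  proof (rule tendsto_sandwich[OF _ _ tendsto_const 1])
    show "\<forall>\<^sub>F n in sequentially. s \<le> dyadic_up n s"
      using dyadic_up_gt[of s] by (simp add: less_imp_le)
    show "\<forall>\<^sub>F n in sequentially. dyadic_up n s \<le> s + (1/2) ^ n"
      using dyadic_up_le by simp
  qed
  then show ?thesis
    using dyadic_up_gt[of s] by (simp add: filterlim_at less_imp_neq[symmetric])
qed

definition dyadics :: "real set" where
  "dyadics = range (\<lambda>(k::int, n::nat). (of_int k + 1) / 2 ^ n)"

lemma countable_dyadics: "countable dyadics"
  unfolding dyadics_def by auto

lemma dyadic_up_in_dyadics: "dyadic_up n s \<in> dyadics"
  unfolding dyadics_def dyadic_up_def by (auto intro!: image_eqI[where x="(\<lfloor>2 ^ n * s\<rfloor>, n)"])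

lemma dyadic_up_measurable [measurable]: "dyadic_up n \<in> measurable borel (count_space dyadics)"
proof -
  have 1: "dyadic_up n \<in> borel_measurable borel" unfolding dyadic_up_def by measurable
  have "dyadic_up n -` {a} \<inter> space borel \<in> sets borel" if "a \<in> dyadics" for a
    using 1 by (rule measurable_sets) auto
  then show ?thesis
    by (subst measurable_count_space_eq_countable) (auto simp: countable_dyadics dyadic_up_in_dyadics)
qed

text \<open>\<open>0\<close> is the dead value. With \<open>0\<close> outside \<open>G\<close>, a
  path is dead exactly while it is outside \<open>G\<close>, and then for good.\<close>

definition rc_path :: "'a::euclidean_space set \<Rightarrow> (real \<Rightarrow> 'a) \<Rightarrow> bool" where
  "rc_path G y \<longleftrightarrow> (\<forall>t\<ge>0. y t \<in> G \<and> (y \<longlongrightarrow> y t) (at_right t) \<or> (\<forall>s\<ge>t. y s = 0))"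

lemma rc_path_tendsto:
  assumes "rc_path G y" "0 \<le> t"
  shows "(y \<longlongrightarrow> y t) (at_right t)"
proof (cases "y t \<in> G \<and> (y \<longlongrightarrow> y t) (at_right t)")
  case False
  then have "\<forall>s\<ge>t. y s = 0" using assms unfolding rc_path_def by blast
  then have "\<forall>\<^sub>F s in at_right t. y s = y t"
    by (auto simp: eventually_at_filter)
  then show ?thesis by (rule tendsto_eventually)
qed simp

lemma rc_path_dyadic_tendsto:
  assumes "rc_path G y" "0 \<le> t"
  shows "(\<lambda>n. y (dyadic_up n t)) \<longlonglongrightarrow> y t"
  using filterlim_compose[OF rc_path_tendsto[OF assms] dyadic_up_at_right] .

text \<open>At the times \<open>dyadic_up n t\<close> the process is a countable gluing of
  measurable maps, hence jointly measurable; right-continuity makes it converge to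
  \<open>y t\<close>. The value \<open>0\<close> at negative times makes the map total on the
  line.\<close>

lemma rc_process_jointly_measurable:
  fixes y :: "real \<Rightarrow> 'w \<Rightarrow> 'a::euclidean_space"
  assumes "\<And>t. 0 \<le> t \<Longrightarrow> y t \<in> borel_measurable M"
    and "\<And>w. w \<in> space M \<Longrightarrow> rc_path G (\<lambda>t. y t w)"
  shows "(\<lambda>(w, t). if 0 \<le> t then y t w else 0) \<in> borel_measurable (M \<Otimes>\<^sub>M borel)"
proof -
  define z where "z = (\<lambda>t w. if 0 \<le> t then y t w else 0)"
  have z: "z t \<in> borel_measurable M" for t unfolding z_def using assms(1) by (cases "0 \<le> t") auto
  have "(\<lambda>x. if 0 \<le> snd x then z (dyadic_up n (snd x)) (fst x) else 0) \<in> borel_measurable (M \<Otimes>\<^sub>M borel)" for n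
  proof -
    have "(\<lambda>x. z (dyadic_up n (snd x)) (fst x)) \<in> borel_measurable (M \<Otimes>\<^sub>M borel)"
      by (rule measurable_compose_countable'[where f="\<lambda>q x. z q (fst x)" and I=dyadics])
         (use z countable_dyadics in auto)
    then show ?thesis by measurable
  qed
  moreover have "(\<lambda>n. if 0 \<le> snd x then z (dyadic_up n (snd x)) (fst x) else 0) \<longlonglongrightarrow> (case x of (w, t) \<Rightarrow> if 0 \<le> t then y t w else 0)"
    if "x \<in> space (M \<Otimes>\<^sub>M borel)" for x
  proof (cases "0 \<le> snd x")
    case True
    have "0 \<le> dyadic_up n (snd x)" for n using True dyadic_up_gt[of "snd x" n] by linarith
    moreover have "(\<lambda>n. y (dyadic_up n (snd x)) (fst x)) \<longlonglongrightarrow> y (snd x) (fst x)"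
      using that True by (intro rc_path_dyadic_tendsto[where G=G] assms(2)) (auto simp: space_pair_measure)
    ultimately show ?thesis using True by (simp add: z_def case_prod_beta)
  qed (auto simp: case_prod_beta)
  ultimately show ?thesis by (rule borel_measurable_LIMSEQ_metric)
qed

lemma rc_path_measurable:
  assumes "rc_path G y"
  shows "(\<lambda>t. if 0 \<le> t then y t else 0) \<in> borel_measurable borel"
proof -
  \<comment> \<open>A single path is a process on a one-point space.\<close>
  have "(\<lambda>(w, t). if 0 \<le> t then y t else 0) \<in> borel_measurable (count_space (UNIV::unit set) \<Otimes>\<^sub>M borel)"
    using rc_process_jointly_measurable[of "\<lambda>t (w::unit). y t" "count_space UNIV" G] assms by simp
  from measurable_compose[OF measurable_Pair1'[of "()"] this] show ?thesis by simp
qed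

section \<open>Clocks and time changes\<close>

text \<open>The clock is kept as a measure on the time axis, its value at \<open>t\<close> being the
  mass of \<open>{..<t}\<close>; continuity of measures from below and from above then gives the
  one-sided continuity of the clock.\<close>

definition occupation :: "('a \<Rightarrow> ennreal) \<Rightarrow> (real \<Rightarrow> 'a) \<Rightarrow> real measure" where
  "occupation c y = density lborel (\<lambda>s. indicator {0..} s * c (y s))"

definition path_clock :: "('a \<Rightarrow> ennreal) \<Rightarrow> (real \<Rightarrow> 'a) \<Rightarrow> real \<Rightarrow> ennreal" where
  "path_clock c y t = emeasure (occupation c y) {..<t}"

definition total_clock :: "('a \<Rightarrow> ennreal) \<Rightarrow> (real \<Rightarrow> 'a) \<Rightarrow> ennreal" where
  "total_clock c y = emeasure (occupation c y) UNIV"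

definition inverse_clock :: "('a \<Rightarrow> ennreal) \<Rightarrow> (real \<Rightarrow> 'a) \<Rightarrow> real \<Rightarrow> real" where
  "inverse_clock c y t = Inf {s. 0 \<le> s \<and> ennreal t < path_clock c y s}"

text \<open>Once the total clock is used up, \<open>inverse_clock\<close> is the infimum of an empty
  set and carries no meaning; the path is then dead, i.e. at \<open>0\<close>.\<close>

definition time_changed :: "('a \<Rightarrow> ennreal) \<Rightarrow> ('a \<Rightarrow> 'a) \<Rightarrow> (real \<Rightarrow> 'a) \<Rightarrow> real \<Rightarrow> 'a::zero" where
  "time_changed c J y t = (if ennreal t < total_clock c y then J (y (inverse_clock c y t)) else 0)"

lemma sets_occupation [simp, measurable_cong]: "sets (occupation c y) = sets borel"
  and space_occupation [simp]: "space (occupation c y) = UNIV"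
  by (auto simp: occupation_def)

lemma path_clock_mono: "s \<le> t \<Longrightarrow> path_clock c y s \<le> path_clock c y t"
  unfolding path_clock_def by (intro emeasure_mono) auto

lemma path_clock_le_total: "path_clock c y s \<le> total_clock c y"
  unfolding path_clock_def total_clock_def by (intro emeasure_mono) auto

text \<open>Left-continuity of the clock: \<open>{..<t}\<close> is the increasing union of the sets
  \<open>{..<t - 1 / Suc n}\<close>.\<close>

lemma less_path_clock_left:
  assumes "u < path_clock c y t"
  shows "\<exists>s<t. u < path_clock c y s"
proof -
  have "(SUP n. emeasure (occupation c y) {..<t - 1 / Suc n}) = emeasure (occupation c y) (\<Union>n. {..<t - 1 / real (Suc n)})"
  proof (intro SUP_emeasure_incseq)
    have "t - 1 / real (Suc m) \<le> t - 1 / real (Suc n)" if "m \<le> n" for m n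
      using that by (simp add: frac_le)
    then show "incseq (\<lambda>n. {..<t - 1 / real (Suc n)})"
      by (intro monoI) (simp add: lessThan_subset_iff)
  qed auto
  also have "(\<Union>n. {..<t - 1 / real (Suc n)}) = {..<t}"
  proof (intro set_eqI iffI)
    fix s assume "s \<in> {..<t}"
    then obtain n where "1 / real (Suc n) < t - s" using nat_approx_posE[of "t - s"] by auto
    then show "s \<in> (\<Union>n. {..<t - 1 / real (Suc n)})" by (auto intro!: exI[of _ n])
  next
    fix s assume "s \<in> (\<Union>n. {..<t - 1 / real (Suc n)})"
    then obtain n where n: "s < t - 1 / real (Suc n)" by auto
    have "0 < 1 / real (Suc n)" by simp
    with n have "s < t" by linarith
    then show "s \<in> {..<t}" by simp
  qed
  finally have "u < (SUP n. emeasure (occupation c y) {..<t - 1 / Suc n})"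
    using assms by (simp add: path_clock_def)
  then obtain n where n: "u < path_clock c y (t - 1 / Suc n)"
    unfolding less_SUP_iff path_clock_def by auto
  have "0 < 1 / real (Suc n)" by simp
  then have "t - 1 / Suc n < t" by linarith
  with n show ?thesis by blast
qed

lemma less_total_clock:
  assumes "u < total_clock c y"
  shows "\<exists>s. u < path_clock c y s"
proof -
  have "(SUP n. emeasure (occupation c y) {..<real n}) = emeasure (occupation c y) (\<Union>n. {..<real n})"
    by (intro SUP_emeasure_incseq) (auto simp: incseq_def intro: order_less_le_trans)
  also have "(\<Union>n. {..<real n}) = UNIV"
    using reals_Archimedean2 by auto
  finally have "u < (SUP n. emeasure (occupation c y) {..<real n})"
    using assms by (simp add: total_clock_def)
  then show ?thesis
    unfolding less_SUP_iff path_clock_def by auto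
qed

text \<open>Later \<open>c\<close> is \<open>1/v\<close> extended by \<open>0\<close>, so that dead
  time adds nothing to the clock.\<close>

locale killed_domain =
  fixes G :: "'a::euclidean_space set" and c :: "'a \<Rightarrow> ennreal"
  assumes open_G: "open G" and zero_notin_G: "0 \<notin> G"
    and c_measurable [measurable]: "c \<in> borel_measurable borel"
    and c_outside: "x \<notin> G \<Longrightarrow> c x = 0"
    and c_pos: "x \<in> G \<Longrightarrow> 0 < c x" and c_finite: "x \<in> G \<Longrightarrow> c x < \<infinity>"
    and c_continuous: "continuous_on G c"

section \<open>Clock and inverse clock of a single path\<close>

locale killed_path = killed_domain G c for G :: "'a::euclidean_space set" and c +
  fixes y :: "real \<Rightarrow> 'a"
  assumes rc: "rc_path G y"
begin

lemma dead_later: "0 \<le> t \<Longrightarrow> y t \<notin> G \<Longrightarrow> t \<le> s \<Longrightarrow> y s = 0"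
  using rc unfolding rc_path_def by blast

lemma alive_before: "0 \<le> s \<Longrightarrow> s \<le> t \<Longrightarrow> y t \<in> G \<Longrightarrow> y s \<in> G"
  using dead_later[of s t] zero_notin_G by force

lemma right_cont: "0 \<le> t \<Longrightarrow> (y \<longlongrightarrow> y t) (at_right t)"
  using rc by (rule rc_path_tendsto)

lemma right_nhd:
  assumes "0 \<le> t" "y t \<in> U" "open U"
  shows "\<exists>e>0. \<forall>s. t \<le> s \<and> s < t + e \<longrightarrow> y s \<in> U"
proof -
  have "\<forall>\<^sub>F s in at_right t. y s \<in> U"
    using right_cont[OF assms(1)] assms(2,3) by (simp add: tendsto_def)
  then obtain b where b: "b > t" "\<And>s. t < s \<Longrightarrow> s < b \<Longrightarrow> y s \<in> U"
    by (auto simp: eventually_at_right_field)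
  show ?thesis
  proof (intro exI[of _ "b - t"] conjI allI impI)
    fix s assume "t \<le> s \<and> s < t + (b - t)"
    then show "y s \<in> U" using b(2)[of s] assms(2) by (cases "s = t") auto
  qed (use b(1) in simp)
qed

lemma integrand_measurable [measurable]: "(\<lambda>s. indicator {0..} s * c (y s)) \<in> borel_measurable borel"
proof -
  have "(\<lambda>s. indicator {0..} s * c (if 0 \<le> s then y s else 0)) \<in> borel_measurable borel"
    using rc_path_measurable[OF rc] by measurable
  also have "(\<lambda>s. indicator {0..} s * c (if 0 \<le> s then y s else 0)) = (\<lambda>s. indicator {0..} s * c (y s))"
    by (auto simp: indicator_def)
  finally show ?thesis .
qed

lemma emeasure_occupation:
  "A \<in> sets borel \<Longrightarrow> emeasure (occupation c y) A = (\<integral>\<^sup>+s. indicator {0..} s * c (y s) * indicator A s \<partial>lborel)"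
  unfolding occupation_def by (subst emeasure_density) auto

text \<open>By right-continuity the path remains in the open set \<open>G\<close>, where
  \<open>c\<close> is positive, on a time interval of positive length after
  \<open>s\<close>.\<close>

lemma occupation_interval_pos:
  assumes "0 \<le> s" "s < t" "y s \<in> G"
  shows "0 < emeasure (occupation c y) {s..<t}"
proof (rule ccontr)
  assume "\<not> ?thesis"
  then have "(\<integral>\<^sup>+r. indicator {0..} r * c (y r) * indicator {s..<t} r \<partial>lborel) = 0"
    by (simp add: emeasure_occupation)
  then have ae: "AE r in lborel. indicator {0..} r * c (y r) * indicator {s..<t} r = 0"
    by (subst (asm) nn_integral_0_iff_AE) auto
  obtain e where e: "e > 0" "\<And>r. s \<le> r \<Longrightarrow> r < s + e \<Longrightarrow> y r \<in> G"
    using right_nhd[OF assms(1,3) open_G] by blast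
  have "AE r in lborel. r \<notin> {s..<min t (s+e)}"
  proof (rule AE_mp[OF ae], rule AE_I2, rule impI)
    fix r assume *: "indicator {0..} r * c (y r) * indicator {s..<t} r = 0"
    show "r \<notin> {s..<min t (s+e)}"
    proof
      assume "r \<in> {s..<min t (s+e)}"
      then have "s \<le> r" "r < t" "r < s + e" by auto
      then have "0 < c (y r)" using e c_pos by blast
      with * \<open>s \<le> r\<close> \<open>r < t\<close> assms(1) show False by auto
    qed
  qed
  then have "{s..<min t (s+e)} \<in> null_sets lborel"
    by (subst (asm) AE_iff_null_sets[symmetric]) auto
  then have "emeasure lborel {s..<min t (s+e)} = 0" by (rule null_setsD1)
  then show False using assms e by simp
qed

lemma path_clock_split:
  assumes "s \<le> t"
  shows "path_clock c y t = path_clock c y s + emeasure (occupation c y) {s..<t}"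
proof -
  have "{..<t} = {..<s} \<union> {s..<t}" using assms by auto
  moreover have "emeasure (occupation c y) {..<s} + emeasure (occupation c y) {s..<t} = emeasure (occupation c y) ({..<s} \<union> {s..<t})"
    by (rule plus_emeasure) auto
  ultimately show ?thesis unfolding path_clock_def by simp
qed

lemma path_clock_strict_mono:
  assumes "0 \<le> s" "s < t" "y s \<in> G" "path_clock c y s < \<infinity>"
  shows "path_clock c y s < path_clock c y t"
proof -
  have "path_clock c y s + 0 < path_clock c y s + emeasure (occupation c y) {s..<t}"
    using occupation_interval_pos[OF assms(1-3)] assms(4) by (simp add: ennreal_add_left_cancel_less)
  then show ?thesis using path_clock_split[of s t] assms(2) by simp
qed

lemma path_clock_nonpos: "t \<le> 0 \<Longrightarrow> path_clock c y t = 0"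
  unfolding path_clock_def by (subst emeasure_occupation) (auto intro!: nn_integral_zero' AE_I2 simp: indicator_def)

lemma occupation_after_death:
  assumes "0 \<le> t" "y t \<notin> G" "A \<in> sets borel" "A \<subseteq> {t..}"
  shows "emeasure (occupation c y) A = 0"
proof -
  have "c (y s) = 0" if "s \<in> A" for s
  proof -
    have "y s = 0" using assms that by (intro dead_later[OF assms(1,2)]) auto
    then show ?thesis using c_outside zero_notin_G by simp
  qed
  then show ?thesis
    using assms(3) by (subst emeasure_occupation) (auto intro!: nn_integral_zero' AE_I2 simp: indicator_def)
qed

lemma clock_set_nonempty:
  assumes "0 \<le> t" "ennreal t < total_clock c y"
  shows "\<exists>s\<ge>0. ennreal t < path_clock c y s"
proof -
  obtain s where s: "ennreal t < path_clock c y s" using less_total_clock[OF assms(2)] by blast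
  moreover have "0 \<le> s" using path_clock_nonpos[of s] s by (cases "0 \<le> s") auto
  ultimately show ?thesis by blast
qed

lemma inverse_clock_nonneg:
  assumes "0 \<le> t" "ennreal t < total_clock c y"
  shows "0 \<le> inverse_clock c y t"
  unfolding inverse_clock_def using clock_set_nonempty[OF assms] by (intro cInf_greatest) auto

lemma inverse_clock_lessD:
  assumes "0 \<le> t" "ennreal t < total_clock c y" "inverse_clock c y t < s"
  shows "ennreal t < path_clock c y s"
proof -
  have "{s. 0 \<le> s \<and> ennreal t < path_clock c y s} \<noteq> {}" using clock_set_nonempty[OF assms(1,2)] by auto
  from cInf_lessD[OF this, of s] assms(3)
  obtain r where "ennreal t < path_clock c y r" "r < s" unfolding inverse_clock_def by auto
  then show ?thesis using path_clock_mono[of r s c y] by (auto intro: order_less_le_trans)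
qed

lemma inverse_clock_le:
  assumes "0 \<le> s" "ennreal t < path_clock c y s"
  shows "inverse_clock c y t \<le> s"
  unfolding inverse_clock_def using assms by (intro cInf_lower) (auto intro!: bdd_belowI[of _ 0])

text \<open>The clock is left-continuous, so it exceeds \<open>t\<close> already at some time before
  \<open>s\<close>; hence the strict inequality.\<close>

lemma inverse_clock_less:
  assumes "0 \<le> t" "ennreal t < path_clock c y s"
  shows "inverse_clock c y t < s"
proof -
  obtain r where r: "r < s" "ennreal t < path_clock c y r" using less_path_clock_left[OF assms(2)] by blast
  have "0 \<le> r" using path_clock_nonpos[of r] r by (cases "0 \<le> r") auto
  then show ?thesis using inverse_clock_le[OF _ r(2)] r(1) by auto
qed

lemma path_clock_inverse_le:
  assumes "0 \<le> t"
  shows "path_clock c y (inverse_clock c y t) \<le> ennreal t"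
  using inverse_clock_less[OF assms, of "inverse_clock c y t"] by force

lemma inverse_clock_alive:
  assumes "0 \<le> t" "ennreal t < total_clock c y"
  shows "y (inverse_clock c y t) \<in> G"
proof (rule ccontr)
  let ?g = "inverse_clock c y t"
  \<comment> \<open>A path dead at time \<open>?g\<close> adds nothing to its clock afterwards, so
    the clock could never exceed \<open>t\<close>.\<close>
  assume "y ?g \<notin> G"
  obtain s where s: "0 \<le> s" "ennreal t < path_clock c y s" using clock_set_nonempty[OF assms] by blast
  have "path_clock c y s = path_clock c y ?g + emeasure (occupation c y) {?g..<s}"
    using inverse_clock_le[OF s] by (rule path_clock_split)
  also have "emeasure (occupation c y) {?g..<s} = 0"
    by (rule occupation_after_death[OF inverse_clock_nonneg[OF assms] \<open>y ?g \<notin> G\<close>]) auto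
  finally show False using s(2) path_clock_inverse_le[OF assms(1)] by simp
qed

lemma inverse_clock_mono:
  assumes "0 \<le> s" "s \<le> t" "ennreal t < total_clock c y"
  shows "inverse_clock c y s \<le> inverse_clock c y t"
proof -
  have "inverse_clock c y s \<le> Inf {r. 0 \<le> r \<and> ennreal t < path_clock c y r}"
  proof (rule cInf_greatest)
    show "{r. 0 \<le> r \<and> ennreal t < path_clock c y r} \<noteq> {}"
      using clock_set_nonempty[of t] assms by auto
    fix r assume r: "r \<in> {r. 0 \<le> r \<and> ennreal t < path_clock c y r}"
    have "ennreal s < path_clock c y r"
      using r assms(2) by (auto intro: order_le_less_trans[OF ennreal_leI])
    then show "inverse_clock c y s \<le> r" using r by (intro inverse_clock_le) auto
  qed
  then show ?thesis by (simp add: inverse_clock_def)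
qed

text \<open>The strict inequality in the definition makes the inverse right-continuous: a clock
  value above \<open>t\<close> is still above all \<open>s\<close> slightly larger than
  \<open>t\<close>. The second part records that the limit is approached from the right, the side on
  which the path itself is continuous.\<close>

lemma inverse_clock_at_right:
  assumes "0 \<le> t" "ennreal t < total_clock c y"
  shows "(inverse_clock c y \<longlongrightarrow> inverse_clock c y t) (at_right t)"
    and "\<forall>\<^sub>F s in at_right t. ennreal s < total_clock c y \<and> inverse_clock c y t \<le> inverse_clock c y s"
proof -
  let ?g = "inverse_clock c y t"
  have ex: "\<exists>b>t. \<forall>s. t < s \<longrightarrow> s < b \<longrightarrow> ennreal s < path_clock c y r" if "?g < r" for r
  proof (cases "path_clock c y r")
    case (real p)
    have *: "ennreal t < path_clock c y r" using inverse_clock_lessD[OF assms that] .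
    then have "t < p" using real assms(1) by (simp add: ennreal_less_iff)
    then show ?thesis using real assms(1) by (intro exI[of _ p]) (auto simp: ennreal_less_iff)
  next
    case top
    then show ?thesis by (intro exI[of _ "t+1"]) auto
  qed
  have "\<exists>b>t. \<forall>s. t < s \<longrightarrow> s < b \<longrightarrow> ennreal s < total_clock c y"
    using ex[of "?g + 1"] order_less_le_trans[OF _ path_clock_le_total] by (meson less_add_one)
  then have 1: "\<forall>\<^sub>F s in at_right t. ennreal s < total_clock c y"
    by (auto simp: eventually_at_right_field)
  have gt: "\<forall>\<^sub>F s in at_right t. t < s" by (auto simp: eventually_at_filter)
  show 2: "\<forall>\<^sub>F s in at_right t. ennreal s < total_clock c y \<and> ?g \<le> inverse_clock c y s"
    using 1 gt by eventually_elim (use inverse_clock_mono[of t] assms in auto)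
  show "(inverse_clock c y \<longlongrightarrow> ?g) (at_right t)"
  proof (rule order_tendstoI)
    fix a assume "a < ?g"
    then show "\<forall>\<^sub>F s in at_right t. a < inverse_clock c y s"
      using 2 by (auto elim: eventually_mono)
  next
    fix r assume "?g < r"
    from ex[OF this] have "\<forall>\<^sub>F s in at_right t. ennreal s < path_clock c y r"
      by (auto simp: eventually_at_right_field)
    with gt show "\<forall>\<^sub>F s in at_right t. inverse_clock c y s < r"
      by eventually_elim (use assms in \<open>auto intro: inverse_clock_less\<close>)
  qed
qed

end

context killed_path
begin

lemma AE_occupation: "AE s in occupation c y. 0 \<le> s \<and> y s \<in> G"
proof -
  have "AE s in lborel. 0 < indicator {0..} s * c (y s) \<longrightarrow> 0 \<le> s \<and> y s \<in> G"
  proof (intro AE_I2 impI)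
    fix s assume "0 < indicator {0..} s * c (y s)"
    then show "0 \<le> s \<and> y s \<in> G"
      using c_outside[of "y s"] by (cases "0 \<le> s"; cases "y s \<in> G") auto
  qed
  then show ?thesis unfolding occupation_def by (subst AE_density) auto
qed

lemma path_clock_measurable [measurable]: "path_clock c y \<in> borel_measurable borel"
proof -
  have "(\<lambda>t. \<integral>\<^sup>+s. (if s < t then indicator {0..} s * c (y s) else 0) \<partial>lborel) \<in> borel_measurable borel"
    by measurable
  also have "(\<lambda>t. \<integral>\<^sup>+s. (if s < t then indicator {0..} s * c (y s) else 0) \<partial>lborel) = path_clock c y"
    unfolding path_clock_def by (auto simp: emeasure_occupation indicator_def intro!: ext nn_integral_cong)
  finally show ?thesis .
qed

end

text \<open>With a finite clock up to death, clock and inverse clock are mutually inverse bijections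
  between the alive times and the times from \<open>0\<close> to the total clock.\<close>

locale finite_clock_path = killed_path G c y for G :: "'a::euclidean_space set" and c and y +
  assumes finite_clock: "0 \<le> s \<Longrightarrow> y s \<in> G \<Longrightarrow> path_clock c y s < \<infinity>"
begin

abbreviation (input) "real_clock s \<equiv> enn2real (path_clock c y s)"

lemma ennreal_real_clock: "0 \<le> s \<Longrightarrow> y s \<in> G \<Longrightarrow> ennreal (real_clock s) = path_clock c y s"
  using finite_clock by simp

lemma path_clock_less_total:
  assumes "0 \<le> s" "y s \<in> G"
  shows "path_clock c y s < total_clock c y"
  using path_clock_strict_mono[OF assms(1) _ assms(2) finite_clock[OF assms], of "s+1"] path_clock_le_total
  by (auto intro: order_less_le_trans)

lemma inverse_clock_real_clock:
  assumes "0 \<le> s" "y s \<in> G"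
  shows "inverse_clock c y (real_clock s) = s"
proof (rule antisym)
  show "s \<le> inverse_clock c y (real_clock s)"
  proof (rule leI, rule notI)
    assume *: "inverse_clock c y (real_clock s) < s"
    have "ennreal (real_clock s) < path_clock c y s"
      using path_clock_less_total[OF assms] by (intro inverse_clock_lessD[OF _ _ *]) (auto simp: ennreal_real_clock assms)
    then show False by (simp add: ennreal_real_clock assms)
  qed
  show "inverse_clock c y (real_clock s) \<le> s"
  proof (rule field_le_epsilon)
    fix e :: real assume "0 < e"
    then have "path_clock c y s < path_clock c y (s + e)"
      using assms finite_clock by (intro path_clock_strict_mono) auto
    then show "inverse_clock c y (real_clock s) \<le> s + e"
      using assms \<open>0 < e\<close> by (intro inverse_clock_le) (auto simp: ennreal_real_clock)
  qed
qed

text \<open>The lower bound is right-continuity of the clock: its values exceed \<open>t\<close> at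
  all times beyond \<open>?g\<close>, the sets \<open>{..<?g + e / 2 / Suc n}\<close> have finite
  mass and decrease to \<open>{..?g}\<close>, and a single time has mass zero.\<close>

lemma path_clock_inverse_clock:
  assumes "0 \<le> t" "ennreal t < total_clock c y"
  shows "path_clock c y (inverse_clock c y t) = ennreal t"
proof (rule antisym)
  let ?g = "inverse_clock c y t"
  show "path_clock c y ?g \<le> ennreal t" using assms(1) by (rule path_clock_inverse_le)
  have g: "0 \<le> ?g" "y ?g \<in> G" using inverse_clock_nonneg inverse_clock_alive assms by auto
  obtain e where e: "e > 0" "\<And>r. ?g \<le> r \<Longrightarrow> r < ?g + e \<Longrightarrow> y r \<in> G"
    using right_nhd[OF g open_G] by blast
  define a where "a = ?g + e / 2"
  have fa: "path_clock c y a < \<infinity>" using e g by (intro finite_clock) (auto simp: a_def)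
  have B: "emeasure (occupation c y) (\<Inter>n. {..<?g + e / 2 / Suc n}) = (INF n. emeasure (occupation c y) {..<?g + e / 2 / Suc n})"
  proof (rule INF_emeasure_decseq[symmetric])
    show "decseq (\<lambda>n. {..<?g + e / 2 / Suc n})"
      using e by (intro antimonoI) (simp add: lessThan_subset_iff frac_le)
    fix n :: nat
    have "e / 2 / Suc n \<le> e / 2 / 1" using e by (intro divide_left_mono) auto
    then have "emeasure (occupation c y) {..<?g + e / 2 / Suc n} \<le> path_clock c y a"
      unfolding path_clock_def by (intro emeasure_mono) (auto simp: a_def)
    then show "emeasure (occupation c y) {..<?g + e / 2 / Suc n} \<noteq> \<infinity>" using fa by (auto simp: top_unique)
  qed auto
  have "ennreal t \<le> path_clock c y (?g + e / 2 / Suc n)" for n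
    using e by (intro less_imp_le inverse_clock_lessD[OF assms]) auto
  then have "ennreal t \<le> emeasure (occupation c y) (\<Inter>n. {..<?g + e / 2 / Suc n})"
    unfolding B path_clock_def by (intro INF_greatest)
  also have "(\<Inter>n. {..<?g + e / 2 / Suc n}) = {..?g}"
  proof (intro set_eqI iffI)
    fix r assume r: "r \<in> (\<Inter>n. {..<?g + e / 2 / real (Suc n)})"
    show "r \<in> {..?g}"
    proof (rule ccontr)
      assume "r \<notin> {..?g}"
      then have "0 < (r - ?g) / (e / 2)" using e by auto
      then obtain n where "1 / real (Suc n) < (r - ?g) / (e / 2)" using nat_approx_posE by metis
      then have "e / 2 * (1 / real (Suc n)) < e / 2 * ((r - ?g) / (e / 2))"
        using e by (intro mult_strict_left_mono) auto
      moreover have "e / 2 * (1 / real (Suc n)) = e / 2 / real (Suc n)" "e / 2 * ((r - ?g) / (e / 2)) = r - ?g"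
        using e by simp_all
      ultimately have "e / 2 / real (Suc n) < r - ?g" by linarith
      moreover have "r < ?g + e / 2 / real (Suc n)" using r by blast
      ultimately show False by linarith
    qed
  next
    fix r assume r: "r \<in> {..?g}"
    have "0 < e / 2 / real (Suc n)" for n using e by simp
    then show "r \<in> (\<Inter>n. {..<?g + e / 2 / real (Suc n)})" using r by (auto intro: order_le_less_trans)
  qed
  also have "emeasure (occupation c y) {..?g} = emeasure (occupation c y) {..<?g} + emeasure (occupation c y) {?g}"
  proof -
    have "{..?g} = {..<?g} \<union> {?g}" by auto
    moreover have "emeasure (occupation c y) {..<?g} + emeasure (occupation c y) {?g} = emeasure (occupation c y) ({..<?g} \<union> {?g})"
      by (rule plus_emeasure) auto
    ultimately show ?thesis by simp
  qed
  also have "emeasure (occupation c y) {?g} = 0"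
  proof -
    have "AE s in lborel. indicator {0..} s * c (y s) * indicator {?g} s = 0"
      using AE_lborel_singleton[of ?g] by eventually_elim simp
    then have "(\<integral>\<^sup>+s. indicator {0..} s * c (y s) * indicator {?g} s \<partial>lborel) = 0"
      by (subst nn_integral_0_iff_AE) auto
    then show ?thesis by (subst emeasure_occupation) auto
  qed
  finally show "ennreal t \<le> path_clock c y ?g" by (simp add: path_clock_def)
qed

lemma real_clock_less_iff:
  assumes "0 \<le> s" "y s \<in> G" "0 \<le> t" "ennreal t < total_clock c y"
  shows "real_clock s < t \<longleftrightarrow> s < inverse_clock c y t"
proof
  assume "s < inverse_clock c y t"
  then have "path_clock c y s < ennreal t"
    using path_clock_strict_mono[OF assms(1) _ assms(2) finite_clock[OF assms(1,2)], of "inverse_clock c y t"]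
    by (simp add: path_clock_inverse_clock assms)
  then have "ennreal (real_clock s) < ennreal t"
    by (subst ennreal_real_clock[OF assms(1,2)])
  then show "real_clock s < t" by (simp add: ennreal_less_iff)
next
  assume *: "real_clock s < t"
  show "s < inverse_clock c y t"
  proof (rule ccontr)
    assume "\<not> ?thesis"
    then have "path_clock c y (inverse_clock c y t) \<le> path_clock c y s" by (intro path_clock_mono) auto
    then have "ennreal t \<le> ennreal (real_clock s)"
      by (subst ennreal_real_clock[OF assms(1,2)], subst (asm) path_clock_inverse_clock[OF assms(3,4)])
    then show False using * by (simp add: ennreal_le_iff)
  qed
qed

text \<open>The substitution \<open>dt = c (y s) ds\<close> as an image measure: the times whose
  clock value is below \<open>a\<close> are those before \<open>inverse_clock c y a\<close>, and
  their mass is the clock value there, namely \<open>a\<close>. If \<open>a\<close> is past the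
  total clock, both sides are the total mass.\<close>

lemma distr_real_clock:
  "distr (occupation c y) borel real_clock = density lborel (indicator {t. 0 \<le> t \<and> ennreal t < total_clock c y})"
    (is "?L = ?R")
proof -
  let ?T = "{t. 0 \<le> t \<and> ennreal t < total_clock c y}"
  have [measurable]: "?T \<in> sets borel" by measurable
  have R: "emeasure ?R A = emeasure lborel (?T \<inter> A)" if "A \<in> sets borel" for A
  proof -
    have "emeasure ?R A = (\<integral>\<^sup>+x. indicator ?T x * indicator A x \<partial>lborel)"
      using that by (subst emeasure_density) auto
    also have "\<dots> = (\<integral>\<^sup>+x. indicator (?T \<inter> A) x \<partial>lborel)"
      by (simp only: indicator_inter_arith)
    also have "\<dots> = emeasure lborel (?T \<inter> A)" using that by (subst nn_integral_indicator) auto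
    finally show ?thesis .
  qed
  have eq: "emeasure ?L {..<a} = emeasure ?R {..<a}" for a
  proof (cases "a \<le> 0")
    case True
    then have "real_clock s \<notin> {..<a}" for s
      using enn2real_nonneg[of "path_clock c y s"] True by (simp add: not_less del: enn2real_nonneg)
    then have "real_clock -` {..<a} = {}" "?T \<inter> {..<a} = {}"
      using True by auto
    then show ?thesis by (simp add: emeasure_distr R)
  next
    case False
    then have a: "0 \<le> a" by simp
    show ?thesis
    proof (cases "ennreal a < total_clock c y")
      case True
      have "?T \<inter> {..<a} = {0..<a}"
        using order_le_less_trans[OF ennreal_leI True] by force
      then have "emeasure ?R {..<a} = ennreal a" using a by (simp add: R)
      also have "\<dots> = emeasure (occupation c y) {..<inverse_clock c y a}"
        using path_clock_inverse_clock[OF a True] by (simp add: path_clock_def)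
      also have "\<dots> = emeasure (occupation c y) (real_clock -` {..<a})"
      proof (rule emeasure_eq_AE)
        show "AE s in occupation c y. s \<in> {..<inverse_clock c y a} \<longleftrightarrow> s \<in> real_clock -` {..<a}"
          using AE_occupation by eventually_elim (auto simp: real_clock_less_iff[OF _ _ a True])
        have "real_clock -` {..<a} \<inter> space borel \<in> sets borel" by measurable
        then show "real_clock -` {..<a} \<in> sets (occupation c y)" by simp
      qed simp
      also have "\<dots> = emeasure ?L {..<a}" by (subst emeasure_distr) simp_all
      finally show ?thesis by simp
    next
      case False
      then have le: "total_clock c y \<le> ennreal a" by simp
      define b where "b = enn2real (total_clock c y)"
      have b: "total_clock c y = ennreal b" "0 \<le> b"
        using order_le_less_trans[OF le ennreal_less_top] by (simp_all add: b_def)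
      have "?T \<inter> {..<a} = {0..<b}"
      proof -
        have "b \<le> a" using le b a by (simp add: ennreal_le_iff)
        then show ?thesis using b by (auto simp: ennreal_less_iff)
      qed
      then have "emeasure ?R {..<a} = total_clock c y" using b R[of "{..<a}"] by simp
      also have "\<dots> = emeasure (occupation c y) (real_clock -` {..<a})"
        unfolding total_clock_def
      proof (rule emeasure_eq_AE)
        show "AE s in occupation c y. s \<in> UNIV \<longleftrightarrow> s \<in> real_clock -` {..<a}"
          using AE_occupation
        proof eventually_elim
          case (elim s)
          then have "ennreal (real_clock s) < ennreal a"
            using order_less_le_trans[OF path_clock_less_total[of s] le] by (simp add: ennreal_real_clock)
          then show ?case by (simp add: ennreal_less_iff)
        qed
        have "real_clock -` {..<a} \<inter> space borel \<in> sets borel" by measurable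
        then show "real_clock -` {..<a} \<in> sets (occupation c y)" by simp
      qed simp
      also have "\<dots> = emeasure ?L {..<a}" by (subst emeasure_distr) simp_all
      finally show ?thesis by simp
    qed
  qed
  show ?thesis
  proof (rule measure_eqI_generator_eq[where E="range lessThan" and \<Omega>=UNIV and A="\<lambda>n. {..<real n}"])
    show "Int_stable (range (lessThan :: real \<Rightarrow> _))"
    proof (rule Int_stableI)
      fix a b assume "a \<in> range (lessThan :: real \<Rightarrow> _)" "b \<in> range (lessThan :: real \<Rightarrow> _)"
      then obtain x y :: real where "a = {..<x}" "b = {..<y}" by auto
      moreover have "{..<x} \<inter> {..<y} = {..<min x y}" by auto
      ultimately show "a \<inter> b \<in> range lessThan" by simp
    qed
    show "sets ?L = sigma_sets UNIV (range lessThan)" "sets ?R = sigma_sets UNIV (range lessThan)"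
      by (simp_all add: borel_Iio)
    show "(\<Union>i. {..<real i}) = UNIV" using reals_Archimedean2 by auto
    have "emeasure lborel (?T \<inter> {..<real i}) \<le> emeasure lborel {0..<real i}" for i
      by (intro emeasure_mono) auto
    then show "emeasure ?L {..<real i} \<noteq> \<infinity>" for i
      using order_le_less_trans[of "emeasure lborel (?T \<inter> {..<real i})" "emeasure lborel {0..<real i}" \<infinity>]
      by (simp add: eq R)
  qed (auto simp: eq)
qed

lemma nn_integral_real_clock:
  assumes [measurable]: "F \<in> borel_measurable borel"
  shows "(\<integral>\<^sup>+t. indicator {t. 0 \<le> t \<and> ennreal t < total_clock c y} t * F t \<partial>lborel) =
    (\<integral>\<^sup>+s. indicator {0..} s * c (y s) * F (real_clock s) \<partial>lborel)"
proof -
  have "(\<integral>\<^sup>+t. indicator {t. 0 \<le> t \<and> ennreal t < total_clock c y} t * F t \<partial>lborel) =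
      (\<integral>\<^sup>+t. F t \<partial>distr (occupation c y) borel real_clock)"
    by (subst distr_real_clock, subst nn_integral_density) auto
  also have "\<dots> = (\<integral>\<^sup>+s. F (real_clock s) \<partial>occupation c y)"
    by (subst nn_integral_distr) auto
  also have "\<dots> = (\<integral>\<^sup>+s. indicator {0..} s * c (y s) * F (real_clock s) \<partial>lborel)"
    unfolding occupation_def by (subst nn_integral_density) auto
  finally show ?thesis .
qed

end

section \<open>Inverted paths: substitution, involution and hitting\<close>

definition stays :: "'a set \<Rightarrow> (real \<Rightarrow> 'a) \<Rightarrow> real \<Rightarrow> bool" where
  "stays B y t \<longleftrightarrow> (\<forall>u\<in>{0..t}. y u \<in> B)"

locale inverted_domain = killed_domain G c for G :: "'a::euclidean_space set" and c +
  fixes J :: "'a \<Rightarrow> 'a"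
  assumes J_in: "x \<in> G \<Longrightarrow> J x \<in> G" and J_J: "x \<in> G \<Longrightarrow> J (J x) = x"
    and J_continuous: "continuous_on G J"
    and J_measurable [measurable]: "J \<in> borel_measurable borel"

locale inverted_path = inverted_domain G c J + killed_path G c y
  for G :: "'a::euclidean_space set" and c and J and y
begin

lemma time_changed_alive: "0 \<le> t \<Longrightarrow> ennreal t < total_clock c y \<Longrightarrow> time_changed c J y t \<in> G"
  unfolding time_changed_def using inverse_clock_alive J_in by auto

lemma time_changed_dead: "\<not> ennreal t < total_clock c y \<Longrightarrow> time_changed c J y t = 0"
  unfolding time_changed_def by simp

text \<open>The inverse clock approaches its limit from the right, so right-continuity of
  \<open>y\<close> and continuity of \<open>J\<close> on \<open>G\<close> can be composed.\<close>

lemma rc_time_changed: "rc_path G (time_changed c J y)"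
  unfolding rc_path_def
proof (intro allI impI)
  fix t :: real assume t: "0 \<le> t"
  show "time_changed c J y t \<in> G \<and> (time_changed c J y \<longlongrightarrow> time_changed c J y t) (at_right t) \<or> (\<forall>s\<ge>t. time_changed c J y s = 0)"
  proof (cases "ennreal t < total_clock c y")
    case True
    let ?g = "inverse_clock c y"
    have g: "0 \<le> ?g t" "y (?g t) \<in> G" using inverse_clock_nonneg inverse_clock_alive t True by auto
    have "((\<lambda>s. y (?g s)) \<longlongrightarrow> y (?g t)) (at_right t)"
    proof (rule topological_tendstoI)
      fix U assume "open U" "y (?g t) \<in> U"
      then obtain e where e: "e > 0" "\<forall>s. ?g t \<le> s \<and> s < ?g t + e \<longrightarrow> y s \<in> U"
        using right_nhd[OF g(1)] by blast
      have "\<forall>\<^sub>F s in at_right t. ?g s < ?g t + e"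
        using inverse_clock_at_right(1)[OF t True] e(1) by (intro order_tendstoD) auto
      with inverse_clock_at_right(2)[OF t True] show "\<forall>\<^sub>F s in at_right t. y (?g s) \<in> U"
        by eventually_elim (use e(2) in blast)
    qed
    then have "((\<lambda>s. J (y (?g s))) \<longlongrightarrow> J (y (?g t))) (at_right t)"
      using J_continuous g(2) open_G
      by (intro isCont_tendsto_compose[of "y (?g t)" J]) (auto simp: continuous_on_eq_continuous_at)
    moreover have "\<forall>\<^sub>F s in at_right t. J (y (?g s)) = time_changed c J y s"
      using inverse_clock_at_right(2)[OF t True] by eventually_elim (simp add: time_changed_def)
    ultimately have "(time_changed c J y \<longlongrightarrow> J (y (?g t))) (at_right t)"
      by (rule Lim_transform_eventually)
    then show ?thesis using time_changed_alive[OF t True] True by (simp add: time_changed_def)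
  next
    case False
    have "time_changed c J y s = 0" if "s \<ge> t" for s
    proof (rule time_changed_dead)
      have "ennreal t \<le> ennreal s" using that by (rule ennreal_leI)
      with False show "\<not> ennreal s < total_clock c y" by (auto dest: order_le_less_trans)
    qed
    then show ?thesis by blast
  qed
qed

end

locale inverted_finite_path = inverted_domain G c J + finite_clock_path G c y
  for G :: "'a::euclidean_space set" and c and J and y

sublocale inverted_finite_path \<subseteq> inverted_path ..

context inverted_finite_path
begin

abbreviation (input) "time_changed_path \<equiv> time_changed c J y"

lemma time_changed_real_clock:
  assumes "0 \<le> s" "y s \<in> G"
  shows "time_changed_path (real_clock s) = J (y s)"
  using path_clock_less_total[OF assms] inverse_clock_real_clock[OF assms] ennreal_real_clock[OF assms]
  by (simp add: time_changed_def)

text \<open>The clock maps the old times up to \<open>s\<close> onto the new times up to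
  \<open>real_clock s\<close>, so both paths run through corresponding points; injectivity of
  \<open>J\<close> on \<open>G\<close> is used to return from images to points of
  \<open>B\<close>.\<close>

lemma stays_time_changed:
  assumes "0 \<le> s" "y s \<in> G" "B \<subseteq> G"
  shows "stays (J ` B) time_changed_path (real_clock s) \<longleftrightarrow> stays B y s"
proof
  assume *: "stays (J ` B) time_changed_path (real_clock s)"
  show "stays B y s"
    unfolding stays_def
  proof
    fix r assume r: "r \<in> {0..s}"
    then have yr: "y r \<in> G" using alive_before[of r s] assms by auto
    have "path_clock c y r \<le> path_clock c y s" using r by (intro path_clock_mono) auto
    then have "real_clock r \<in> {0..real_clock s}"
      using finite_clock[OF assms(1,2)] by (auto intro: enn2real_mono)
    then have "time_changed_path (real_clock r) \<in> J ` B" using * unfolding stays_def by blast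
    then have "J (y r) \<in> J ` B" using time_changed_real_clock[OF _ yr] r by simp
    then obtain b where "b \<in> B" "J (y r) = J b" by auto
    then show "y r \<in> B" using J_J[OF yr] J_J[of b] assms(3) by auto
  qed
next
  assume *: "stays B y s"
  show "stays (J ` B) time_changed_path (real_clock s)"
    unfolding stays_def
  proof
    fix u assume u: "u \<in> {0..real_clock s}"
    have lt: "ennreal (real_clock s) < total_clock c y"
      using path_clock_less_total[OF assms(1,2)] ennreal_real_clock[OF assms(1,2)] by simp
    have "ennreal u \<le> ennreal (real_clock s)" using u by (intro ennreal_leI) auto
    then have ut: "ennreal u < total_clock c y" using lt by (rule order_le_less_trans)
    have "inverse_clock c y u \<le> s"
      using inverse_clock_mono[of u "real_clock s"] lt u inverse_clock_real_clock[OF assms(1,2)] by simp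
    moreover have "0 \<le> inverse_clock c y u" using inverse_clock_nonneg ut u by auto
    ultimately show "time_changed_path u \<in> J ` B" using * ut unfolding stays_def time_changed_def by auto
  qed
qed

lemma stays_measurable [measurable]: "{t. stays B z t} \<in> sets borel"
proof -
  \<comment> \<open>The condition is inherited by smaller \<open>t\<close> and holds vacuously for
    negative \<open>t\<close>, so the set is a half-line or everything.\<close>
  have "is_interval {t. stays B z t}"
    unfolding is_interval_1 stays_def by auto
  then show ?thesis by (rule real_interval_borel_measurable)
qed

text \<open>Substitution at \<open>t = real_clock s\<close>. A dead path sits at \<open>0\<close>,
  which is not in the image of \<open>B\<close>, so staying in that image already forces
  \<open>t\<close> to lie before the total clock.\<close>

lemma nn_integral_stays_time_changed:
  assumes [measurable]: "f \<in> borel_measurable borel" and B: "B \<subseteq> G"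
  shows "(\<integral>\<^sup>+t. indicator {t. 0 \<le> t \<and> stays (J ` B) time_changed_path t} t * f (time_changed_path t) \<partial>lborel) =
    (\<integral>\<^sup>+s. indicator {s. 0 \<le> s \<and> stays B y s} s * (f (J (y s)) * c (y s)) \<partial>lborel)"
proof -
  define W0 where "W0 t = (if 0 \<le> t then time_changed_path t else 0)" for t
  have [measurable]: "W0 \<in> borel_measurable borel"
    unfolding W0_def using rc_path_measurable[OF rc_time_changed] .
  define F where "F t = indicator {t. stays (J ` B) time_changed_path t} t * f (W0 t)" for t
  have [measurable]: "F \<in> borel_measurable borel" unfolding F_def by measurable
  have "(\<integral>\<^sup>+t. indicator {t. 0 \<le> t \<and> stays (J ` B) time_changed_path t} t * f (time_changed_path t) \<partial>lborel) =
     (\<integral>\<^sup>+t. indicator {t. 0 \<le> t \<and> ennreal t < total_clock c y} t * F t \<partial>lborel)"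
  proof (rule nn_integral_cong)
    fix t
    have "ennreal t < total_clock c y" if "0 \<le> t" "stays (J ` B) time_changed_path t"
    proof (rule ccontr)
      assume "\<not> ?thesis"
      then have "time_changed_path t = 0" by (rule time_changed_dead)
      moreover have "time_changed_path t \<in> J ` B" using that unfolding stays_def by auto
      ultimately have "0 \<in> J ` B" by simp
      then show False using J_in B zero_notin_G by (metis image_iff subsetD)
    qed
    then show "indicator {t. 0 \<le> t \<and> stays (J ` B) time_changed_path t} t * f (time_changed_path t) =
       indicator {t. 0 \<le> t \<and> ennreal t < total_clock c y} t * F t"
      by (auto simp: F_def W0_def indicator_def)
  qed
  also have "\<dots> = (\<integral>\<^sup>+s. indicator {0..} s * c (y s) * F (real_clock s) \<partial>lborel)"
    by (rule nn_integral_real_clock) measurable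
  also have "\<dots> = (\<integral>\<^sup>+s. indicator {s. 0 \<le> s \<and> stays B y s} s * (f (J (y s)) * c (y s)) \<partial>lborel)"
  proof (rule nn_integral_cong)
    fix s
    show "indicator {0..} s * c (y s) * F (real_clock s) =
      indicator {s. 0 \<le> s \<and> stays B y s} s * (f (J (y s)) * c (y s))"
    proof (cases "0 \<le> s \<and> y s \<in> G")
      case True
      then show ?thesis
        using stays_time_changed[of s B] time_changed_real_clock[of s] B
        by (simp add: F_def W0_def indicator_def mult.commute)
    next
      case False
      then show ?thesis by (auto simp: c_outside indicator_def)
    qed
  qed
  finally show ?thesis .
qed

text \<open>The clock of the new path at the new time \<open>real_clock s\<close> is the integral of
  \<open>c (J (y r)) * c (y r) = 1\<close> over the old times \<open>r < s\<close>, hence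
  \<open>s\<close>. The second clock thus inverts the first, and \<open>J\<close> is an
  involution.\<close>

lemma time_changed_time_changed:
  assumes cJ: "\<And>x. x \<in> G \<Longrightarrow> c x * c (J x) = 1" and t: "0 \<le> t"
  shows "time_changed c J time_changed_path t = y t"
proof -
  interpret time_changed_path: killed_path G c time_changed_path using rc_time_changed by unfold_locales
  have alive_meas: "{s. 0 \<le> s \<and> y s \<in> G} \<in> sets borel"
  proof -
    have "is_interval {s. 0 \<le> s \<and> y s \<in> G}" unfolding is_interval_1 using alive_before by auto
    then show ?thesis by (rule real_interval_borel_measurable)
  qed
  have real_clock_meas [measurable]: "real_clock \<in> borel_measurable borel" by measurable
  have occ: "emeasure (occupation c time_changed_path) A = emeasure lborel ({s. 0 \<le> s \<and> y s \<in> G} \<inter> real_clock -` A)"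
    if [measurable]: "A \<in> sets borel" for A
  proof -
    define F where "F t = (if 0 \<le> t then c (time_changed_path t) else 0) * indicator A t" for t
    have "(\<lambda>t. c (if 0 \<le> t then time_changed_path t else 0)) \<in> borel_measurable borel"
      using rc_path_measurable[OF rc_time_changed] by measurable
    then have "(\<lambda>t. (if 0 \<le> t then c (if 0 \<le> t then time_changed_path t else 0) else 0) * indicator A t) \<in> borel_measurable borel"
      by measurable
    also have "(\<lambda>t. (if 0 \<le> t then c (if 0 \<le> t then time_changed_path t else 0) else 0) * indicator A t) = F"
      by (auto simp: F_def)
    finally have [measurable]: "F \<in> borel_measurable borel" .
    have [measurable]: "{s. 0 \<le> s \<and> y s \<in> G} \<inter> real_clock -` A \<in> sets borel"
      using alive_meas measurable_sets[OF real_clock_meas that] by auto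
    have "emeasure (occupation c time_changed_path) A = (\<integral>\<^sup>+t. indicator {0..} t * c (time_changed_path t) * indicator A t \<partial>lborel)"
      by (rule time_changed_path.emeasure_occupation) fact
    also have "\<dots> = (\<integral>\<^sup>+t. indicator {t. 0 \<le> t \<and> ennreal t < total_clock c y} t * F t \<partial>lborel)"
      using c_outside[OF zero_notin_G]
      by (intro nn_integral_cong) (auto simp: F_def indicator_def time_changed_dead)
    also have "\<dots> = (\<integral>\<^sup>+s. indicator {0..} s * c (y s) * F (real_clock s) \<partial>lborel)"
      by (rule nn_integral_real_clock) measurable
    also have "\<dots> = (\<integral>\<^sup>+s. indicator ({s. 0 \<le> s \<and> y s \<in> G} \<inter> real_clock -` A) s \<partial>lborel)"
    proof (rule nn_integral_cong)
      fix s
      show "indicator {0..} s * c (y s) * F (real_clock s) = indicator ({s. 0 \<le> s \<and> y s \<in> G} \<inter> real_clock -` A) s"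
      proof (cases "0 \<le> s \<and> y s \<in> G")
        case True
        then show ?thesis
          using time_changed_real_clock[of s] cJ[of "y s"] by (simp add: F_def indicator_def)
      next
        case False
        then show ?thesis by (auto simp: c_outside indicator_def)
      qed
    qed
    also have "\<dots> = emeasure lborel ({s. 0 \<le> s \<and> y s \<in> G} \<inter> real_clock -` A)"
      by (subst nn_integral_indicator) auto
    finally show ?thesis .
  qed
  show ?thesis
  proof (cases "y t \<in> G")
    case True
    \<comment> \<open>For any \<open>T\<close> beyond the new time of \<open>t\<close>, slightly
      more than \<open>t\<close> units of old time are used before \<open>T\<close>. If
      \<open>T\<close> is past the total clock, the surplus comes from right-continuity of the path
      at \<open>t\<close>.\<close>
    have up: "ennreal t < path_clock c time_changed_path T" if T: "real_clock t < T" for T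
    proof -
      have "\<exists>e>t. \<forall>s. 0 \<le> s \<and> s < e \<longrightarrow> y s \<in> G \<and> real_clock s < T"
      proof (cases "ennreal T < total_clock c y")
        case lt: True
        have T0: "0 \<le> T" using T enn2real_nonneg[of "path_clock c y t"] by linarith
        have g: "y (inverse_clock c y T) \<in> G" using inverse_clock_alive T0 lt by auto
        have "t < inverse_clock c y T" using real_clock_less_iff[OF t True T0 lt] T by simp
        moreover have "y s \<in> G \<and> real_clock s < T" if "0 \<le> s" "s < inverse_clock c y T" for s
          using alive_before[of s "inverse_clock c y T"] g that real_clock_less_iff[OF _ _ T0 lt, of s] by simp
        ultimately show ?thesis by blast
      next
        case False
        obtain e where e: "e > 0" "\<forall>s. t \<le> s \<and> s < t + e \<longrightarrow> y s \<in> G"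
          using right_nhd[OF t True open_G] by blast
        have "y s \<in> G \<and> real_clock s < T" if s: "0 \<le> s" "s < t + e" for s
        proof
          show ys: "y s \<in> G" using e(2) alive_before[of s t] True s by (cases "s \<le> t") auto
          have "ennreal (real_clock s) < ennreal T"
            using path_clock_less_total[OF s(1) ys] False ennreal_real_clock[OF s(1) ys] by simp
          then show "real_clock s < T" by (simp add: ennreal_less_iff)
        qed
        with e(1) show ?thesis by (intro exI[of _ "t + e"]) auto
      qed
      then obtain e where e: "t < e" "\<forall>s. 0 \<le> s \<and> s < e \<longrightarrow> y s \<in> G \<and> real_clock s < T" by blast
      have "ennreal t < ennreal e" using e t by (simp add: ennreal_less_iff)
      also have "ennreal e = emeasure lborel {0..<e}" using e t by simp
      also have "\<dots> \<le> emeasure lborel ({s. 0 \<le> s \<and> y s \<in> G} \<inter> real_clock -` {..<T})"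
        using e alive_meas measurable_sets[OF real_clock_meas, of "{..<T}"] by (intro emeasure_mono) auto
      also have "\<dots> = path_clock c time_changed_path T" using occ[of "{..<T}"] by (simp add: path_clock_def[of c time_changed_path])
      finally show ?thesis .
    qed
    have down: "path_clock c time_changed_path (real_clock t) \<le> ennreal t"
    proof -
      have "path_clock c time_changed_path (real_clock t) = emeasure lborel ({s. 0 \<le> s \<and> y s \<in> G} \<inter> real_clock -` {..<real_clock t})"
        using occ[of "{..<real_clock t}"] by (simp add: path_clock_def[of c time_changed_path])
      also have "\<dots> \<le> emeasure lborel {0..<t}"
      proof (rule emeasure_mono)
        show "{s. 0 \<le> s \<and> y s \<in> G} \<inter> real_clock -` {..<real_clock t} \<subseteq> {0..<t}"
        proof
          fix s assume s: "s \<in> {s. 0 \<le> s \<and> y s \<in> G} \<inter> real_clock -` {..<real_clock t}"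
          have "\<not> t \<le> s"
          proof
            assume "t \<le> s"
            then have "path_clock c y t \<le> path_clock c y s" by (rule path_clock_mono)
            then have "real_clock t \<le> real_clock s" using finite_clock[of s] s by (auto intro: enn2real_mono)
            then show False using s by simp
          qed
          then show "s \<in> {0..<t}" using s by simp
        qed
      qed simp
      also have "\<dots> = ennreal t" using t by simp
      finally show ?thesis .
    qed
    have tot: "ennreal t < total_clock c time_changed_path"
      using up[of "real_clock t + 1"] path_clock_le_total[of c time_changed_path] by (auto intro: order_less_le_trans)
    have "inverse_clock c time_changed_path t = real_clock t"
    proof (rule antisym)
      show "real_clock t \<le> inverse_clock c time_changed_path t"
        using time_changed_path.inverse_clock_lessD[OF t tot, of "real_clock t"] down by (meson leD leI)
      show "inverse_clock c time_changed_path t \<le> real_clock t"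
      proof (rule field_le_epsilon)
        fix e :: real assume "0 < e"
        then show "inverse_clock c time_changed_path t \<le> real_clock t + e"
          using up by (intro time_changed_path.inverse_clock_le) auto
      qed
    qed
    then have "time_changed c J time_changed_path t = J (time_changed_path (real_clock t))" using tot by (simp add: time_changed_def)
    then show ?thesis using time_changed_real_clock[OF t True] J_J[OF True] by simp
  next
    case False
    \<comment> \<open>The old path is alive only before \<open>t\<close>, so the second clock has
      total mass at most \<open>t\<close> and the result is dead at \<open>t\<close>, like
      \<open>y\<close>.\<close>
    have "total_clock c time_changed_path = emeasure lborel ({s. 0 \<le> s \<and> y s \<in> G} \<inter> real_clock -` UNIV)"
      unfolding total_clock_def by (rule occ) simp
    also have "\<dots> \<le> emeasure lborel {0..<t}"
      using alive_before[OF t _ ] False by (intro emeasure_mono) (auto simp: not_le[symmetric])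
    also have "\<dots> = ennreal t" using t by simp
    finally have "\<not> ennreal t < total_clock c time_changed_path" by simp
    then have "time_changed c J time_changed_path t = 0" by (simp only: time_changed_def[of c J time_changed_path] if_False)
    then show ?thesis using dead_later[OF t False, of t] by simp
  qed
qed

lemma time_changed_hits:
  assumes "U \<subseteq> G"
  shows "(\<exists>t\<ge>0. time_changed_path t \<in> U) \<longleftrightarrow> (\<exists>t\<ge>0. y t \<in> J ` U)"
proof
  assume "\<exists>t\<ge>0. time_changed_path t \<in> U"
  then obtain t where t: "0 \<le> t" "time_changed_path t \<in> U" by blast
  then have lt: "ennreal t < total_clock c y" using time_changed_dead[of t] zero_notin_G assms by fastforce
  then have "J (y (inverse_clock c y t)) \<in> U" using t by (simp add: time_changed_def)
  then have "y (inverse_clock c y t) \<in> J ` U"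
    using J_J[OF inverse_clock_alive[OF t(1) lt]] by (metis image_eqI)
  then show "\<exists>t\<ge>0. y t \<in> J ` U" using inverse_clock_nonneg[OF t(1) lt] by blast
next
  assume "\<exists>t\<ge>0. y t \<in> J ` U"
  then obtain t u where t: "0 \<le> t" "y t = J u" "u \<in> U" by blast
  then have "time_changed_path (real_clock t) = u" using time_changed_real_clock[of t] J_in[of u] J_J[of u] assms by auto
  then show "\<exists>t\<ge>0. time_changed_path t \<in> U" using t by (intro exI[of _ "real_clock t"]) auto
qed

end

section \<open>Laws of killed processes\<close>

lemma borel_component:
  assumes "(\<lambda>(w, t). Y w t) \<in> borel_measurable (M \<Otimes>\<^sub>M borel)" "w \<in> space M"
  shows "Y w \<in> borel_measurable (borel :: 'b::topological_space measure)"
  using measurable_compose[OF measurable_Pair1'[OF assms(2)] assms(1)] by simp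

section \<open>Measurability of the time change as a function of the path\<close>

context inverted_domain
begin

context
  fixes M :: "'w measure" and Y :: "'w \<Rightarrow> real \<Rightarrow> 'a"
  assumes Y: "(\<lambda>(w, t). Y w t) \<in> borel_measurable (M \<Otimes>\<^sub>M borel)"
begin

lemma emeasure_occupation_process:
  assumes "w \<in> space M" and [measurable]: "A \<in> sets borel"
  shows "emeasure (occupation c (Y w)) A = (\<integral>\<^sup>+s. indicator {0..} s * c (Y w s) * indicator A s \<partial>lborel)"
proof -
  have [measurable]: "Y w \<in> borel_measurable borel" using borel_component[OF Y assms(1)] .
  show ?thesis unfolding occupation_def by (subst emeasure_density) auto
qed

lemma emeasure_occupation_measurable:
  assumes [measurable]: "A \<in> sets borel"
  shows "(\<lambda>w. emeasure (occupation c (Y w)) A) \<in> borel_measurable M"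
proof -
  have [measurable]: "(\<lambda>x. Y (fst x) (snd x)) \<in> borel_measurable (M \<Otimes>\<^sub>M borel)"
    using Y by (simp add: case_prod_beta)
  have "(\<lambda>w. \<integral>\<^sup>+s. indicator {0..} s * c (Y w s) * indicator A s \<partial>lborel) \<in> borel_measurable M"
    by (rule lborel.borel_measurable_nn_integral) (simp add: case_prod_beta)
  then show ?thesis by (subst measurable_cong[OF emeasure_occupation_process[OF _ assms]])
qed

lemma path_clock_process_measurable: "(\<lambda>w. path_clock c (Y w) t) \<in> borel_measurable M"
  unfolding path_clock_def by (rule emeasure_occupation_measurable) simp

lemma total_clock_process_measurable: "(\<lambda>w. total_clock c (Y w)) \<in> borel_measurable M"
  unfolding total_clock_def by (rule emeasure_occupation_measurable) simp

lemma time_changed_process_measurable: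
  assumes t: "0 \<le> t"
  shows "(\<lambda>w. time_changed c J (Y w) t) \<in> borel_measurable M"
proof -
  note [measurable] = path_clock_process_measurable total_clock_process_measurable
  define g where "g w = (if ennreal t < total_clock c (Y w) then inverse_clock c (Y w) t else 0)" for w
  \<comment> \<open>The clock is monotone, so the infimum lies below \<open>r\<close> iff some
    rational time below \<open>r\<close> already has clock above \<open>t\<close>; this exhibits the
    sub-level sets as countable unions.\<close>
  have g_less: "g w < r \<longleftrightarrow> (ennreal t < total_clock c (Y w) \<and> (\<exists>q\<in>\<rat>. 0 \<le> q \<and> q < r \<and> ennreal t < path_clock c (Y w) q))
      \<or> (\<not> ennreal t < total_clock c (Y w) \<and> 0 < r)" if w: "w \<in> space M" for w r
  proof (cases "ennreal t < total_clock c (Y w)")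
    case True
    have "\<exists>s\<ge>0. ennreal t < path_clock c (Y w) s"
    proof -
      obtain s where s: "ennreal t < path_clock c (Y w) s" using less_total_clock[OF True] by blast
      have "0 \<le> s"
      proof (rule ccontr)
        assume neg: "\<not> ?thesis"
        have "path_clock c (Y w) s = (\<integral>\<^sup>+(s::real). 0 \<partial>lborel)"
          unfolding path_clock_def emeasure_occupation_process[OF w, of "{..<s}", simplified]
        proof (rule nn_integral_cong)
          fix r show "indicator {0..} r * c (Y w r) * indicator {..<s} r = 0"
            using neg by (cases "0 \<le> r") (auto simp: indicator_def)
        qed
        then show False using s by simp
      qed
      with s show ?thesis by blast
    qed
    then have ne: "{s. 0 \<le> s \<and> ennreal t < path_clock c (Y w) s} \<noteq> {}" by auto
    have "inverse_clock c (Y w) t < r \<longleftrightarrow> (\<exists>q\<in>\<rat>. 0 \<le> q \<and> q < r \<and> ennreal t < path_clock c (Y w) q)"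
    proof
      assume "inverse_clock c (Y w) t < r"
      then obtain s where s: "0 \<le> s" "ennreal t < path_clock c (Y w) s" "s < r"
        unfolding inverse_clock_def using cInf_lessD[OF ne, of r] by blast
      obtain q where q: "q \<in> \<rat>" "s < q" "q < r" using Rats_dense_in_real[OF s(3)] by blast
      have "ennreal t < path_clock c (Y w) q"
        using s(2) path_clock_mono[of s q c "Y w"] q by (auto intro: order_less_le_trans)
      then show "\<exists>q\<in>\<rat>. 0 \<le> q \<and> q < r \<and> ennreal t < path_clock c (Y w) q" using q s by (intro bexI[of _ q]) auto
    next
      assume "\<exists>q\<in>\<rat>. 0 \<le> q \<and> q < r \<and> ennreal t < path_clock c (Y w) q"
      then obtain q where q: "0 \<le> q" "q < r" "ennreal t < path_clock c (Y w) q" by blast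
      have "inverse_clock c (Y w) t \<le> q"
        unfolding inverse_clock_def using q by (intro cInf_lower) (auto intro!: bdd_belowI[of _ 0])
      then show "inverse_clock c (Y w) t < r" using q(2) by simp
    qed
    then show ?thesis using True by (simp add: g_def)
  qed (simp add: g_def)
  have [measurable]: "g \<in> borel_measurable M"
    unfolding borel_measurable_iff_less
  proof
    fix r
    have "{w \<in> space M. g w < r} = {w \<in> space M. (ennreal t < total_clock c (Y w) \<and> (\<exists>q\<in>\<rat>. 0 \<le> q \<and> q < r \<and> ennreal t < path_clock c (Y w) q))
      \<or> (\<not> ennreal t < total_clock c (Y w) \<and> 0 < r)}"
      using g_less by blast
    also have "\<dots> \<in> sets M" using countable_rat by measurable
    finally show "{w \<in> space M. g w < r} \<in> sets M" .
  qed
  have [measurable]: "(\<lambda>w. Y w (g w)) \<in> borel_measurable M"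
    using measurable_compose[OF measurable_Pair[OF measurable_ident_sets[OF refl] \<open>g \<in> borel_measurable M\<close>] Y] by simp
  have "(\<lambda>w. if ennreal t < total_clock c (Y w) then J (Y w (g w)) else 0) \<in> borel_measurable M"
    by measurable
  also have "(\<lambda>w. if ennreal t < total_clock c (Y w) then J (Y w (g w)) else 0) = (\<lambda>w. time_changed c J (Y w) t)"
    by (auto simp: time_changed_def g_def)
  finally show ?thesis .
qed

end

lemma occupation_cong:
  assumes "\<And>s. 0 \<le> s \<Longrightarrow> y s = z s"
  shows "occupation c y = occupation c z"
  unfolding occupation_def using assms by (intro arg_cong[where f="density lborel"] ext) (auto simp: indicator_def)

lemma time_changed_cong:
  assumes "rc_path G y" "\<And>s. 0 \<le> s \<Longrightarrow> y s = z s" "0 \<le> t"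
  shows "time_changed c J y t = time_changed c J z t"
proof -
  interpret killed_path G c y using assms(1) by unfold_locales
  have occ: "occupation c y = occupation c z" using assms(2) by (rule occupation_cong)
  have pc: "path_clock c y = path_clock c z" "total_clock c y = total_clock c z"
    using occ by (auto simp: path_clock_def total_clock_def)
  have ic: "inverse_clock c y t = inverse_clock c z t" unfolding inverse_clock_def pc ..
  show ?thesis
    using inverse_clock_nonneg[OF assms(3)] assms(2)
    by (simp add: time_changed_def ic[symmetric] pc(2)[symmetric])
qed

lemma time_changed_rc_measurable:
  assumes "\<And>t. 0 \<le> t \<Longrightarrow> y t \<in> borel_measurable M"
    and "\<And>w. w \<in> space M \<Longrightarrow> rc_path G (\<lambda>t. y t w)" and "0 \<le> t"
  shows "(\<lambda>w. time_changed c J (\<lambda>s. y s w) t) \<in> borel_measurable M"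
proof -
  have "(\<lambda>w. time_changed c J (\<lambda>s. if 0 \<le> s then y s w else 0) t) \<in> borel_measurable M"
    using rc_process_jointly_measurable[OF assms(1,2)] assms(3)
    by (rule time_changed_process_measurable)
  then show ?thesis
    by (rule measurable_cong[THEN iffD1, rotated]) (intro time_changed_cong[symmetric] assms; simp)
qed

lemma rc_process_eq:
  assumes "rc_path G y" "0 \<le> t"
  shows "lim (\<lambda>n. (\<lambda>s\<in>{0..}. y s) (dyadic_up n t)) = y t"
proof (rule limI)
  have "0 \<le> dyadic_up n t" for n using assms(2) dyadic_up_gt[of t n] by linarith
  then show "(\<lambda>n. (\<lambda>s\<in>{0..}. y s) (dyadic_up n t)) \<longlonglongrightarrow> y t"
    using rc_path_dyadic_tendsto[OF assms] by simp
qed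

text \<open>On the path space, the time change is applied to the right-continuous regularisation of a
  path along the dyadics, so that it is a measurable functional of the path.\<close>

lemma time_changed_law_eq:
  assumes y1: "\<And>t. 0 \<le> t \<Longrightarrow> y1 t \<in> borel_measurable M1" "\<And>w. w \<in> space M1 \<Longrightarrow> rc_path G (\<lambda>t. y1 t w)"
    and y2: "\<And>t. 0 \<le> t \<Longrightarrow> y2 t \<in> borel_measurable M2" "\<And>w. w \<in> space M2 \<Longrightarrow> rc_path G (\<lambda>t. y2 t w)"
    and eq: "distr M1 (PiM {0..} (\<lambda>_. borel)) (\<lambda>w. \<lambda>t\<in>{0..}. y1 t w) = distr M2 (PiM {0..} (\<lambda>_. borel)) (\<lambda>w. \<lambda>t\<in>{0..}. y2 t w)"
    and l: "\<And>t B. (t, B) \<in> set l \<Longrightarrow> 0 \<le> t \<and> B \<in> sets borel"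
  shows "emeasure M1 {w \<in> space M1. \<forall>(t, B) \<in> set l. time_changed c J (\<lambda>s. y1 s w) t \<in> B} =
    emeasure M2 {w \<in> space M2. \<forall>(t, B) \<in> set l. time_changed c J (\<lambda>s. y2 s w) t \<in> B}"
proof -
  let ?P = "PiM {0..} (\<lambda>_. borel :: 'a measure)"
  define R where "R \<eta> t = (if 0 \<le> t then lim (\<lambda>n. \<eta> (dyadic_up n t)) else 0)" for \<eta> :: "real \<Rightarrow> 'a" and t
  have "(\<lambda>x. (if 0 \<le> dyadic_up n (snd x) then fst x (dyadic_up n (snd x)) else 0)) \<in> borel_measurable (?P \<Otimes>\<^sub>M borel)" for n
  proof (rule measurable_compose_countable'[where f="\<lambda>q x. if 0 \<le> q then fst x q else 0" and I=dyadics])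
    show "(\<lambda>x. if 0 \<le> q then fst x q else 0) \<in> borel_measurable (?P \<Otimes>\<^sub>M borel)" for q
      by (cases "0 \<le> q") (auto intro: measurable_compose[OF measurable_fst measurable_component_singleton])
    show "(\<lambda>x. dyadic_up n (snd x)) \<in> ?P \<Otimes>\<^sub>M borel \<rightarrow>\<^sub>M count_space dyadics" by measurable
  qed (rule countable_dyadics)
  then have "(\<lambda>x. if 0 \<le> snd x then lim (\<lambda>n. (if 0 \<le> dyadic_up n (snd x) then fst x (dyadic_up n (snd x)) else 0)) else 0)
      \<in> borel_measurable (?P \<Otimes>\<^sub>M borel)"
    by measurable
  also have "(\<lambda>x. if 0 \<le> snd x then lim (\<lambda>n. (if 0 \<le> dyadic_up n (snd x) then fst x (dyadic_up n (snd x)) else 0)) else 0)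
      = (\<lambda>(\<eta>, t). R \<eta> t)"
  proof
    fix x :: "(real \<Rightarrow> 'a) \<times> real"
    have "0 \<le> dyadic_up n (snd x)" if "0 \<le> snd x" for n using that dyadic_up_gt[of "snd x" n] by linarith
    then show "(if 0 \<le> snd x then lim (\<lambda>n. (if 0 \<le> dyadic_up n (snd x) then fst x (dyadic_up n (snd x)) else 0)) else 0)
        = (case x of (\<eta>, t) \<Rightarrow> R \<eta> t)" by (simp add: R_def case_prod_beta)
  qed
  finally have R: "(\<lambda>(\<eta>, t). R \<eta> t) \<in> borel_measurable (?P \<Otimes>\<^sub>M borel)" .
  have "{\<eta> \<in> space ?P. time_changed c J (R \<eta>) (fst p) \<in> snd p} \<in> sets ?P" if "p \<in> set l" for p
  proof -
    have p: "0 \<le> fst p" "snd p \<in> sets borel" using l[of "fst p" "snd p"] that by auto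
    show ?thesis
      using measurable_sets[OF time_changed_process_measurable[OF R p(1)] p(2)]
      by (simp add: vimage_def Int_def conj_commute)
  qed
  then have E: "{\<eta> \<in> space ?P. \<forall>p\<in>set l. time_changed c J (R \<eta>) (fst p) \<in> snd p} \<in> sets ?P" (is "?E \<in> _")
    by (intro sets.sets_Collect_finite_All) auto
  have main: "emeasure M {w \<in> space M. \<forall>(t, B) \<in> set l. time_changed c J (\<lambda>s. y s w) t \<in> B}
      = emeasure (distr M ?P (\<lambda>w. \<lambda>t\<in>{0..}. y t w)) ?E"
    if y: "\<And>t. 0 \<le> t \<Longrightarrow> y t \<in> borel_measurable M" "\<And>w. w \<in> space M \<Longrightarrow> rc_path G (\<lambda>t. y t w)" for M :: "'z measure" and y
  proof -
    have m: "(\<lambda>w. \<lambda>t\<in>{0..}. y t w) \<in> measurable M ?P" using y(1) by (intro measurable_restrict) auto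
    have "time_changed c J (R (\<lambda>t\<in>{0..}. y t w)) t = time_changed c J (\<lambda>s. y s w) t"
      if "w \<in> space M" "0 \<le> t" for w t
      by (rule time_changed_cong[symmetric, OF y(2)[OF that(1)] _ that(2)])
         (simp only: R_def if_True rc_process_eq[OF y(2)[OF that(1)]])
    then have "(\<lambda>w. \<lambda>t\<in>{0..}. y t w) -` ?E \<inter> space M = {w \<in> space M. \<forall>(t, B) \<in> set l. time_changed c J (\<lambda>s. y s w) t \<in> B}"
      using l measurable_space[OF m] by fastforce
    then show ?thesis by (subst emeasure_distr[OF m E]) simp
  qed
  show ?thesis using main[OF y1] main[OF y2] eq by simp
qed

end

text \<open>The only value of \<open>y k\<close> outside \<open>G\<close> is \<open>0\<close>, and
  the event of taking it is the complement of lying in \<open>G\<close> under the remaining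
  constraints. Finiteness of \<open>N\<close> allows the subtraction.\<close>

lemma measure_split_dead:
  fixes N :: "'w measure" and y :: "'i \<Rightarrow> 'w \<Rightarrow> 'a::euclidean_space"
  assumes N: "finite_measure N" and G: "G \<in> sets borel" "0 \<notin> G"
    and y: "\<And>w. w \<in> space N \<Longrightarrow> y k w \<in> insert 0 G" and k: "k \<notin> K"
    and m: "\<And>A. (\<And>i. i \<in> insert k K \<Longrightarrow> A i \<in> sets borel) \<Longrightarrow> {w \<in> space N. \<forall>i\<in>insert k K. y i w \<in> A i} \<in> sets N"
    and A: "\<And>i. i \<in> insert k K \<Longrightarrow> A i \<in> sets borel"
  shows "measure N {w \<in> space N. \<forall>i\<in>insert k K. y i w \<in> A i} =
      measure N {w \<in> space N. \<forall>i\<in>insert k K. y i w \<in> (A(k := A k \<inter> G)) i} +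
      (if 0 \<in> A k then measure N {w \<in> space N. \<forall>i\<in>K. y i w \<in> A i} -
         measure N {w \<in> space N. \<forall>i\<in>insert k K. y i w \<in> (A(k := G)) i} else 0)"
  proof -
    interpret N: finite_measure N by fact
    let ?S = "\<lambda>B. {w \<in> space N. \<forall>i\<in>insert k K. y i w \<in> (A(k := B)) i}"
    have S: "?S B \<in> sets N" if "B \<in> sets borel" for B using that A by (intro m) auto
    have U: "?S UNIV = {w \<in> space N. \<forall>i\<in>K. y i w \<in> A i}" using k by auto
    have a: "?S (A k) = {w \<in> space N. \<forall>i\<in>insert k K. y i w \<in> A i}" by simp
    have d: "measure N (?S UNIV - ?S G) = measure N (?S UNIV) - measure N (?S G)"
      by (intro N.finite_measure_Diff S G) auto
    show ?thesis
    proof (cases "0 \<in> A k")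
      case True
      have "?S (A k) = ?S (A k \<inter> G) \<union> (?S UNIV - ?S G)"
        using True k by (auto dest: y)
      moreover have "measure N (?S (A k \<inter> G) \<union> (?S UNIV - ?S G)) = measure N (?S (A k \<inter> G)) + measure N (?S UNIV - ?S G)"
        using A[of k] G(1) by (intro N.finite_measure_Union sets.Diff S G(1) sets.Int) auto
      ultimately show ?thesis using True d U a by simp
    next
      case False
      then have "?S (A k) = ?S (A k \<inter> G)" using k by (auto dest: y)
      then show ?thesis using False a by simp
    qed
  qed

text \<open>\<open>has_law\<close> directly controls only events in which the process is alive at
  all named times. Events that allow the dead value are reduced to these one index at a time by
  \<open>measure_split_dead\<close>, and cylinders determine a finite measure on the product
  space.\<close>

lemma distr_eq_of_alive_cylinders:
  fixes N1 :: "'v measure" and N2 :: "'w measure" and y1 :: "'i \<Rightarrow> 'v \<Rightarrow> 'a::euclidean_space" and y2 :: "'i \<Rightarrow> 'w \<Rightarrow> 'a"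
  assumes fin: "finite_measure N1" "finite_measure N2"
    and G: "G \<in> sets borel" "0 \<notin> G"
    and y1: "\<And>i. i \<in> I \<Longrightarrow> y1 i \<in> borel_measurable N1" "\<And>i w. i \<in> I \<Longrightarrow> w \<in> space N1 \<Longrightarrow> y1 i w \<in> insert 0 G"
    and y2: "\<And>i. i \<in> I \<Longrightarrow> y2 i \<in> borel_measurable N2" "\<And>i w. i \<in> I \<Longrightarrow> w \<in> space N2 \<Longrightarrow> y2 i w \<in> insert 0 G"
    and eq: "\<And>K A. finite K \<Longrightarrow> K \<subseteq> I \<Longrightarrow> (\<And>i. i \<in> K \<Longrightarrow> A i \<in> sets borel \<and> A i \<subseteq> G) \<Longrightarrow>
      emeasure N1 {w \<in> space N1. \<forall>i\<in>K. y1 i w \<in> A i} = emeasure N2 {w \<in> space N2. \<forall>i\<in>K. y2 i w \<in> A i}"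
  shows "distr N1 (PiM I (\<lambda>_. borel)) (\<lambda>w. \<lambda>i\<in>I. y1 i w) = distr N2 (PiM I (\<lambda>_. borel)) (\<lambda>w. \<lambda>i\<in>I. y2 i w)"
proof -
  interpret N1: finite_measure N1 by fact
  interpret N2: finite_measure N2 by fact
  define p1 where "p1 K A = measure N1 {w \<in> space N1. \<forall>i\<in>K. y1 i w \<in> A i}" for K A
  define p2 where "p2 K A = measure N2 {w \<in> space N2. \<forall>i\<in>K. y2 i w \<in> A i}" for K A
  have m1: "{w \<in> space N1. \<forall>i\<in>K. y1 i w \<in> A i} \<in> sets N1"
    if "finite K" "K \<subseteq> I" "\<And>i. i \<in> K \<Longrightarrow> A i \<in> sets borel" for K A
    using that by (intro sets.sets_Collect_finite_All measurable_sets_Collect[OF y1(1)]) auto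
  have m2: "{w \<in> space N2. \<forall>i\<in>K. y2 i w \<in> A i} \<in> sets N2"
    if "finite K" "K \<subseteq> I" "\<And>i. i \<in> K \<Longrightarrow> A i \<in> sets borel" for K A
    using that by (intro sets.sets_Collect_finite_All measurable_sets_Collect[OF y2(1)]) auto
  \<comment> \<open>\<open>K'\<close> holds the indices where \<open>A i\<close> may reach outside
    \<open>G\<close>; the induction replaces \<open>A k\<close> by its part in \<open>G\<close>, by
    \<open>G\<close> itself, or drops \<open>k\<close>.\<close>
  have step: "p1 K A = p2 K A"
    if "finite K'" "finite K" "K \<subseteq> I" "\<And>i. i \<in> K \<Longrightarrow> A i \<in> sets borel" "\<And>i. i \<in> K \<Longrightarrow> i \<notin> K' \<Longrightarrow> A i \<subseteq> G" for K K' A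
    using that
  proof (induction K' arbitrary: K A rule: finite_induct)
    case empty
    then have "emeasure N1 {w \<in> space N1. \<forall>i\<in>K. y1 i w \<in> A i} = emeasure N2 {w \<in> space N2. \<forall>i\<in>K. y2 i w \<in> A i}"
      by (intro eq) auto
    then show ?case by (simp add: p1_def p2_def measure_def)
  next
    case (insert k K')
    show ?case
    proof (cases "k \<in> K")
      case False
      then show ?thesis using insert.prems by (intro insert.IH) auto
    next
      case True
      define L where "L = K - {k}"
      have L: "K = insert k L" "k \<notin> L" using True by (auto simp: L_def)
      have kI: "k \<in> I" using True insert.prems by auto
      have "p1 (insert k L) (A(k := A k \<inter> G)) = p2 (insert k L) (A(k := A k \<inter> G))"
        using insert.prems L G by (intro insert.IH) auto
      moreover have "p1 (insert k L) (A(k := G)) = p2 (insert k L) (A(k := G))"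
        using insert.prems L G by (intro insert.IH) auto
      moreover have "p1 L A = p2 L A"
        using insert.prems L by (intro insert.IH) auto
      moreover have "p1 (insert k L) A = p1 (insert k L) (A(k := A k \<inter> G)) +
          (if 0 \<in> A k then p1 L A - p1 (insert k L) (A(k := G)) else 0)"
        unfolding p1_def
        by (rule measure_split_dead[OF fin(1) G y1(2)[OF kI] L(2) m1]) (use insert.prems L in auto)
      moreover have "p2 (insert k L) A = p2 (insert k L) (A(k := A k \<inter> G)) +
          (if 0 \<in> A k then p2 L A - p2 (insert k L) (A(k := G)) else 0)"
        unfolding p2_def
        by (rule measure_split_dead[OF fin(2) G y2(2)[OF kI] L(2) m2]) (use insert.prems L in auto)
      ultimately show ?thesis unfolding L(1) by (simp only:)
    qed
  qed
  let ?P = "PiM I (\<lambda>_. borel :: 'a measure)"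
  have r1: "(\<lambda>w. \<lambda>i\<in>I. y1 i w) \<in> measurable N1 ?P" using y1(1) by (rule measurable_restrict)
  have r2: "(\<lambda>w. \<lambda>i\<in>I. y2 i w) \<in> measurable N2 ?P" using y2(1) by (rule measurable_restrict)
  show ?thesis
  proof (rule measure_eqI_PiM_infinite)
    fix A :: "'i \<Rightarrow> 'a set" and K assume K: "finite K" "K \<subseteq> I" "\<And>i. i \<in> K \<Longrightarrow> A i \<in> sets borel"
    have E: "prod_emb I (\<lambda>_. borel) K (Pi\<^sub>E K A) \<in> sets ?P" using K by (intro sets_PiM_I) auto
    have v: "(\<lambda>w. \<lambda>i\<in>I. y i w) -` prod_emb I (\<lambda>_. borel) K (Pi\<^sub>E K A) \<inter> space N = {w \<in> space N. \<forall>i\<in>K. y i w \<in> A i}"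
      for N :: "'z measure" and y :: "'i \<Rightarrow> 'z \<Rightarrow> 'a"
      using K(2) by (auto simp: prod_emb_def PiE_iff restrict_def extensional_def split: if_splits)
    show "emeasure (distr N1 ?P (\<lambda>w. \<lambda>i\<in>I. y1 i w)) (prod_emb I (\<lambda>_. borel) K (Pi\<^sub>E K A)) =
        emeasure (distr N2 ?P (\<lambda>w. \<lambda>i\<in>I. y2 i w)) (prod_emb I (\<lambda>_. borel) K (Pi\<^sub>E K A))"
      using step[OF K(1) K(1) K(2,3)] unfolding emeasure_distr[OF r1 E] emeasure_distr[OF r2 E] v p1_def p2_def
      by (simp add: N1.emeasure_eq_measure N2.emeasure_eq_measure)
  qed (auto intro: N1.finite_measure_distr r1)
qed

section \<open>The compactified state space\<close>

definition alive_set :: "'a::euclidean_space set \<Rightarrow> 'a set" where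
  "alive_set S = interior S - {0}"

text \<open>Dead points are sent to \<open>0\<close>, which does not belong to \<^const>\<open>alive_set\<close>.\<close>

definition alive_point :: "'a::euclidean_space set \<Rightarrow> 'a option \<Rightarrow> 'a" where
  "alive_point S z = (if z \<in> E_int S then the z else 0)"

lemma open_alive_set: "open (alive_set S)" and zero_notin_alive_set: "0 \<notin> alive_set S"
  and alive_set_subset: "alive_set S \<subseteq> S"
  using interior_subset by (auto simp: alive_set_def)

lemma E_int_eq: "E_int S = Some ` alive_set S"
  by (simp add: E_int_def alive_set_def)

lemma Some_in_E_int [simp]: "Some x \<in> E_int S \<longleftrightarrow> x \<in> alive_set S"
  by (auto simp: E_int_eq)

lemma alive_point_in [simp]: "alive_point S z \<in> alive_set S \<longleftrightarrow> z \<in> E_int S"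
  using zero_notin_alive_set by (auto simp: alive_point_def E_int_eq)

lemma alive_point_Some [simp]: "x \<in> alive_set S \<Longrightarrow> alive_point S (Some x) = x"
  by (auto simp: alive_point_def)

lemma Some_alive_point: "z \<in> E_int S \<Longrightarrow> Some (alive_point S z) = z"
  by (auto simp: alive_point_def E_int_eq)

lemma alive_point_dead: "z \<notin> E_int S \<Longrightarrow> alive_point S z = 0"
  by (simp add: alive_point_def)

lemma E_space_eq: "E_space S = insert None (Some ` S)"
  by (simp add: E_top_def)

lemma E_int_subset: "E_int S \<subseteq> E_space S"
  using alive_set_subset by (auto simp: E_int_eq E_space_eq)

lemma E_int_Int_E_space [simp]: "E_int S \<inter> E_space S = E_int S"
  using E_int_subset by blast

lemma openin_E_top_image:
  assumes "open U" "U \<subseteq> alive_set S"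
  shows "openin (E_top S) (Some ` U)"
  using assms alive_set_subset[of S] by (auto simp: E_top_def intro!: open_subset)

lemma openin_E_int: "openin (E_top S) (E_int S)"
  unfolding E_int_eq using open_alive_set by (rule openin_E_top_image) simp

lemma space_E_borel [simp]: "space (E_borel S) = E_space S"
  unfolding E_borel_def by (rule space_measure_of) (auto dest: openin_subset)

lemma sets_E_borel: "sets (E_borel S) = sigma_sets (E_space S) {U. openin (E_top S) U}"
  unfolding E_borel_def by (rule sets_measure_of) (auto dest: openin_subset)

lemma openin_sets_E_borel: "openin (E_top S) U \<Longrightarrow> U \<in> sets (E_borel S)"
  unfolding sets_E_borel by (intro sigma_sets.Basic) simp

lemma E_int_sets [measurable]: "E_int S \<in> sets (E_borel S)"
  using openin_E_int by (rule openin_sets_E_borel)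

lemma measurable_into_E_borel:
  assumes "f \<in> space N \<rightarrow> E_space S" "\<And>U. openin (E_top S) U \<Longrightarrow> f -` U \<inter> space N \<in> sets N"
  shows "f \<in> measurable N (E_borel S)"
  unfolding E_borel_def using assms by (intro measurable_sigma_sets[where A="{U. openin (E_top S) U}" and \<Omega>="E_space S"])
    (auto dest: openin_subset simp: sets_E_borel[unfolded E_borel_def])

lemma alive_point_vimage: "U \<subseteq> alive_set S \<Longrightarrow> {z \<in> E_space S. alive_point S z \<in> U} = Some ` U"
  using alive_set_subset[of S] zero_notin_alive_set[of S]
  by (auto simp: alive_point_def E_space_eq E_int_eq split: if_splits)

lemma alive_point_measurable [measurable]: "alive_point S \<in> measurable (E_borel S) borel"
proof (rule borel_measurableI)
  fix U :: "'a set" assume U: "open U"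
  have "{z \<in> E_space S. alive_point S z \<in> U \<inter> alive_set S} \<in> sets (E_borel S)"
    using U by (subst alive_point_vimage) (auto intro!: openin_sets_E_borel openin_E_top_image open_alive_set)
  then have "{z \<in> E_space S. alive_point S z \<in> U \<inter> alive_set S} \<union> (if 0 \<in> U then space (E_borel S) - E_int S else {}) \<in> sets (E_borel S)"
    using sets.compl_sets[OF E_int_sets, of S] by auto
  also have "{z \<in> E_space S. alive_point S z \<in> U \<inter> alive_set S} \<union> (if 0 \<in> U then space (E_borel S) - E_int S else {})
      = alive_point S -` U \<inter> space (E_borel S)"
    by (auto simp: alive_point_dead) (metis alive_point_dead)
  finally show "alive_point S -` U \<inter> space (E_borel S) \<in> sets (E_borel S)" .
qed

lemma continuous_map_Some_alive: "continuous_map (top_of_set (alive_set S)) (subtopology (E_top S) (E_int S)) Some"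
proof -
  have "continuous_map (top_of_set S) (E_top S) Some" unfolding E_top_def by (rule continuous_map_Some)
  then have "continuous_map (subtopology (top_of_set S) (alive_set S)) (E_top S) Some"
    by (rule continuous_map_from_subtopology)
  then show ?thesis
    using alive_set_subset[of S]
    by (auto simp: continuous_map_in_subtopology subtopology_subtopology Int_absorb1 E_int_eq)
qed

lemma Some_measurable: "Some \<in> measurable (restrict_space borel (alive_set S)) (E_borel S)"
proof (rule measurable_into_E_borel)
  fix U assume "openin (E_top S) U"
  have "openin (top_of_set (alive_set S)) {x \<in> topspace (top_of_set (alive_set S)). Some x \<in> U \<inter> E_int S}"
    using continuous_map_Some_alive[of S] \<open>openin (E_top S) U\<close>
    by (intro openin_continuous_map_preimage[OF continuous_map_Some_alive]) (auto simp: openin_subtopology)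
  then have "open {x \<in> alive_set S. Some x \<in> U \<inter> E_int S}"
    using open_alive_set[of S] by (auto simp: openin_open_eq)
  then have "{x \<in> alive_set S. Some x \<in> U \<inter> E_int S} \<in> sets borel" by auto
  moreover have "Some -` U \<inter> space (restrict_space borel (alive_set S)) = {x \<in> alive_set S. Some x \<in> U \<inter> E_int S}"
    by (auto simp: space_restrict_space)
  ultimately show "Some -` U \<inter> space (restrict_space borel (alive_set S)) \<in> sets (restrict_space borel (alive_set S))"
    using open_alive_set[of S] by (auto simp: sets_restrict_space_iff)
qed (use alive_set_subset[of S] in \<open>auto simp: space_restrict_space E_space_eq\<close>)

lemma measurable_on_alive:
  assumes "f \<in> borel_measurable (E_borel S)"
  shows "(\<lambda>x. if x \<in> alive_set S then f (Some x) else 0) \<in> borel_measurable borel"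
  using measurable_compose[OF Some_measurable assms] open_alive_set[of S]
  by (subst (asm) measurable_restrict_space_iff) auto

lemma Some_vimage_sets:
  assumes "B \<in> sets (E_borel S)"
  shows "{x \<in> alive_set S. Some x \<in> B} \<in> sets borel"
proof -
  from measurable_sets[OF Some_measurable assms]
  have "Some -` B \<inter> alive_set S \<in> sets borel"
    using open_alive_set[of S] by (simp add: space_restrict_space sets_restrict_space_iff)
  also have "Some -` B \<inter> alive_set S = {x \<in> alive_set S. Some x \<in> B}" by auto
  finally show ?thesis .
qed

lemma Some_image_sets:
  assumes "A \<in> sets borel" "A \<subseteq> alive_set S"
  shows "Some ` A \<in> sets (E_borel S)"
proof -
  have "Some ` A = alive_point S -` A \<inter> space (E_borel S)"
    unfolding alive_point_vimage[OF assms(2), symmetric] by auto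
  then show ?thesis using measurable_sets[OF alive_point_measurable assms(1), of S] by simp
qed

lemma continuous_map_alive_point: "continuous_map (subtopology (E_top S) (E_int S)) euclidean (alive_point S)"
  unfolding continuous_map_def
proof (intro conjI allI impI)
  fix U :: "'a set" assume "openin euclidean U"
  then have U: "open U" by simp
  have "{z \<in> topspace (subtopology (E_top S) (E_int S)). alive_point S z \<in> U} = Some ` (U \<inter> alive_set S)"
    using E_int_subset[of S] by (auto simp: E_int_eq image_iff)
  moreover have "openin (E_top S) (Some ` (U \<inter> alive_set S))"
    using U open_alive_set by (intro openin_E_top_image) auto
  ultimately show "openin (subtopology (E_top S) (E_int S)) {z \<in> topspace (subtopology (E_top S) (E_int S)). alive_point S z \<in> U}"
    using openin_E_int[of S] by (simp add: openin_open_subtopology) (auto simp: E_int_eq)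
qed simp

text \<open>The path regularity required in \<open>doob_transform\<close>, isolated because
  \<open>X\<close>, its image under \<open>I\<close> and every version of the Doob transform share
  it.\<close>

definition killed_rc :: "'a::euclidean_space set \<Rightarrow> (real \<Rightarrow> 'a option) \<Rightarrow> bool" where
  "killed_rc S z \<longleftrightarrow> (\<forall>t\<ge>0. (z t \<in> E_int S \<longrightarrow> limitin (E_top S) z (z t) (at_right t)) \<and>
     (z t \<notin> E_int S \<longrightarrow> (\<forall>s\<ge>t. z s \<notin> E_int S)))"

lemma limitin_alive_point:
  assumes "limitin (E_top S) f l F" "l \<in> E_int S"
  shows "((\<lambda>t. alive_point S (f t)) \<longlongrightarrow> alive_point S l) F"
proof (rule topological_tendstoI)
  fix U assume U: "open U" "alive_point S l \<in> U"
  have "openin (E_top S) (Some ` (U \<inter> alive_set S))"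
    using U open_alive_set by (intro openin_E_top_image) auto
  moreover have "l \<in> Some ` (U \<inter> alive_set S)" using U assms(2) by (auto simp: E_int_eq)
  ultimately have "\<forall>\<^sub>F t in F. f t \<in> Some ` (U \<inter> alive_set S)" using assms(1) by (auto simp: limitin_def)
  then show "\<forall>\<^sub>F t in F. alive_point S (f t) \<in> U" by eventually_elim auto
qed

lemma killed_rc_path:
  assumes "killed_rc S z"
  shows "rc_path (alive_set S) (\<lambda>t. alive_point S (z t))"
  unfolding rc_path_def
proof (intro allI impI)
  fix t :: real assume t: "0 \<le> t"
  show "alive_point S (z t) \<in> alive_set S \<and> ((\<lambda>t. alive_point S (z t)) \<longlongrightarrow> alive_point S (z t)) (at_right t) \<or>
       (\<forall>s\<ge>t. alive_point S (z s) = 0)"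
  proof (cases "z t \<in> E_int S")
    case True
    then show ?thesis using limitin_alive_point[of S z "z t" "at_right t"] assms t by (auto simp: killed_rc_def)
  next
    case False
    then show ?thesis using assms t by (auto simp: killed_rc_def alive_point_dead)
  qed
qed

definition inverse_speed :: "'a::euclidean_space set \<Rightarrow> ('a option \<Rightarrow> real) \<Rightarrow> 'a \<Rightarrow> ennreal" where
  "inverse_speed S v x = (if x \<in> alive_set S then ennreal (inverse (v (Some x))) else 0)"

lemma continuous_on_alive:
  assumes "continuous_map (subtopology (E_top S) (E_int S)) euclidean f"
  shows "continuous_on (alive_set S) (\<lambda>x. f (Some x))"
  using continuous_map_compose[OF continuous_map_Some_alive assms] by (simp add: o_def)

lemma borel_measurable_alive:
  assumes "continuous_on (alive_set S) f"
  shows "(\<lambda>x. if x \<in> alive_set S then f x else 0) \<in> borel_measurable borel"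
proof -
  have "f \<in> borel_measurable (restrict_space borel (alive_set S))"
    using assms by (rule borel_measurable_continuous_on_restrict)
  then show ?thesis using open_alive_set[of S] by (subst (asm) measurable_restrict_space_iff) auto
qed

lemma killed_domain_inverse_speed:
  assumes "continuous_map (subtopology (E_top S) (E_int S)) euclideanreal v" "\<forall>x\<in>E_int S. 0 < v x"
  shows "killed_domain (alive_set S) (inverse_speed S v)"
proof
  have c: "continuous_on (alive_set S) (\<lambda>x. ennreal (inverse (v (Some x))))"
    using continuous_on_alive[OF assms(1)] assms(2)
    by (intro continuous_on_ennreal continuous_on_inverse) (auto simp: E_int_eq)
  show "inverse_speed S v \<in> borel_measurable borel"
    unfolding inverse_speed_def using c by (rule borel_measurable_alive)
  show "continuous_on (alive_set S) (inverse_speed S v)"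
    using c by (rule continuous_on_eq) (simp add: inverse_speed_def)
  show "x \<in> alive_set S \<Longrightarrow> 0 < inverse_speed S v x" for x
    using assms(2) by (auto simp: inverse_speed_def E_int_eq)
qed (auto simp: inverse_speed_def open_alive_set zero_notin_alive_set)

text \<open>Absorption gives one direction; right-continuity into the open set
  \<open>E_int S\<close> gives the other, since a path alive at \<open>s\<close> remains alive a
  little longer.\<close>

lemma less_lifetime_iff:
  assumes z: "killed_rc S (\<lambda>t. Z t w)" and s: "0 \<le> s"
  shows "ennreal s < lifetime S Z w \<longleftrightarrow> Z s w \<in> E_int S"
proof
  assume *: "ennreal s < lifetime S Z w"
  show "Z s w \<in> E_int S"
  proof (rule ccontr)
    assume "Z s w \<notin> E_int S"
    then have dead: "Z r w \<notin> E_int S" if "s \<le> r" for r using z s that by (auto simp: killed_rc_def)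
    have le: "lifetime S Z w \<le> ennreal r" if "s < r" for r
      unfolding exit_time_def using that s dead[of r] by (intro Inf_lower) auto
    \<comment> \<open>The infimum only runs over positive times, so death at \<open>s = 0\<close> is
      detected at later times arbitrarily close to it; hence the intermediate
      \<open>u\<close>.\<close>
    obtain u where u: "ennreal s < u" "u < lifetime S Z w" using dense[OF *] by blast
    then obtain r where r: "u = ennreal r" "0 \<le> r" using le[of "s+1"] by (cases u) auto
    then have "s < r" using u s by (simp add: ennreal_less_iff)
    then show False using le[of r] u r by simp
  qed
next
  assume *: "Z s w \<in> E_int S"
  have "limitin (E_top S) (\<lambda>t. Z t w) (Z s w) (at_right s)" using z s * by (auto simp: killed_rc_def)
  then have "\<forall>\<^sub>F t in at_right s. Z t w \<in> E_int S" using openin_E_int * by (auto simp: limitin_def)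
  then obtain b where b: "b > s" "\<And>t. s < t \<Longrightarrow> t < b \<Longrightarrow> Z t w \<in> E_int S"
    by (auto simp: eventually_at_right_field)
  have al: "Z t w \<in> E_int S" if "0 \<le> t" "t < b" for t
  proof (cases "s < t")
    case False
    then show ?thesis using z that * by (auto simp: killed_rc_def)
  qed (use b that in auto)
  have "ennreal b \<le> lifetime S Z w"
    unfolding exit_time_def
  proof (rule Inf_greatest)
    fix u assume "u \<in> {ennreal s |s. 0 < s \<and> Z s w \<notin> E_int S}"
    then obtain r where r: "u = ennreal r" "0 < r" "Z r w \<notin> E_int S" by auto
    then have "b \<le> r" using al[of r] by force
    then show "ennreal b \<le> u" using r by (simp add: ennreal_leI)
  qed
  moreover have "ennreal s < ennreal b" using b s by (simp add: ennreal_less_iff)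
  ultimately show "ennreal s < lifetime S Z w" by simp
qed

context
  fixes S :: "'a::euclidean_space set" and v :: "'a option \<Rightarrow> real" and Z :: "real \<Rightarrow> 'w \<Rightarrow> 'a option" and w :: 'w
  assumes v: "continuous_map (subtopology (E_top S) (E_int S)) euclideanreal v" "\<forall>x\<in>E_int S. 0 < v x"
    and z: "killed_rc S (\<lambda>t. Z t w)"
begin

interpretation killed_path "alive_set S" "inverse_speed S v" "\<lambda>t. alive_point S (Z t w)"
  using killed_domain_inverse_speed[OF v] killed_rc_path[OF z]
  by (simp add: killed_path_def killed_path_axioms_def)

lemma clock_integrand:
  "indicator {s. 0 \<le> s \<and> ennreal s < lifetime S Z w} s * ennreal (inverse (v (Z s w))) =
   indicator {0..} s * inverse_speed S v (alive_point S (Z s w))"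
proof (cases "0 \<le> s \<and> Z s w \<in> E_int S")
  case True
  then show ?thesis
    using less_lifetime_iff[where Z=Z and w=w and s=s, OF z] by (simp add: inverse_speed_def Some_alive_point)
next
  case False
  then show ?thesis using less_lifetime_iff[where Z=Z and w=w and s=s, OF z] by (auto simp: inverse_speed_def indicator_def)
qed

lemma clock_eq_path_clock:
  assumes "0 \<le> t"
  shows "clock S v Z (ennreal t) w = path_clock (inverse_speed S v) (\<lambda>t. alive_point S (Z t w)) t"
proof -
  have "clock S v Z (ennreal t) w = (\<integral>\<^sup>+s. indicator {s. 0 \<le> s \<and> ennreal s < lifetime S Z w} s * ennreal (inverse (v (Z s w))) * indicator {..<t} s \<partial>lborel)"
    unfolding clock_def using assms by (intro nn_integral_cong) (auto simp: indicator_def ennreal_less_iff)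
  then show ?thesis unfolding path_clock_def by (subst emeasure_occupation) (auto simp: clock_integrand)
qed

lemma clock_eq_total_clock:
  "clock S v Z \<infinity> w = total_clock (inverse_speed S v) (\<lambda>t. alive_point S (Z t w))"
proof -
  have "clock S v Z \<infinity> w = (\<integral>\<^sup>+s. indicator {s. 0 \<le> s \<and> ennreal s < lifetime S Z w} s * ennreal (inverse (v (Z s w))) \<partial>lborel)"
    unfolding clock_def by simp
  then show ?thesis unfolding total_clock_def by (subst emeasure_occupation) (auto simp: clock_integrand)
qed

lemma time_change_eq:
  "time_change S v Z t w = inverse_clock (inverse_speed S v) (\<lambda>t. alive_point S (Z t w)) t"
  unfolding time_change_def inverse_clock_def
  using clock_eq_path_clock by (intro arg_cong[where f=Inf]) auto

lemma time_change_alive: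
  assumes "0 \<le> t" "ennreal t < clock S v Z \<infinity> w"
  shows "0 \<le> time_change S v Z t w" "Z (time_change S v Z t w) w \<in> E_int S"
  using inverse_clock_alive[of t] inverse_clock_nonneg[of t] assms
  unfolding clock_eq_total_clock time_change_eq by auto

text \<open>Once the clock is exhausted both sides fail, because the Euclidean path is at
  \<open>0\<close>, which is not in \<open>alive_set S\<close>. Before that the underlying point is
  alive and \<open>J\<close> is \<open>I\<close> in Euclidean coordinates.\<close>

lemma time_changed_event:
  assumes I: "\<And>x. x \<in> E_int S \<Longrightarrow> I x \<in> E_int S" and t: "0 \<le> t"
    and J: "\<And>x. x \<in> alive_set S \<Longrightarrow> J x = alive_point S (I (Some x))"
  shows "ennreal t < clock S v Z \<infinity> w \<and> I (Z (time_change S v Z t w) w) \<in> B \<longleftrightarrow>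
    time_changed (inverse_speed S v) J (\<lambda>t. alive_point S (Z t w)) t \<in> {x \<in> alive_set S. Some x \<in> B}"
proof (cases "ennreal t < clock S v Z \<infinity> w")
  case True
  let ?z = "Z (time_change S v Z t w) w"
  have a: "?z \<in> E_int S" using time_change_alive[OF t True] by simp
  have "time_changed (inverse_speed S v) J (\<lambda>t. alive_point S (Z t w)) t = J (alive_point S ?z)"
    using True unfolding clock_eq_total_clock time_change_eq by (simp add: time_changed_def)
  also have "\<dots> = alive_point S (I ?z)"
    using a J[of "alive_point S ?z"] by (simp add: Some_alive_point)
  finally show ?thesis using True I[OF a] Some_alive_point[OF I[OF a]] by simp
next
  case False
  then show ?thesis using zero_notin_alive_set[of S]
    unfolding clock_eq_total_clock by (simp add: time_changed_def)
qed

end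

section \<open>Markov property and finite-dimensional distributions\<close>

lemma nn_integral_killed_kernel:
  assumes rc: "\<And>w. w \<in> space (P x) \<Longrightarrow> killed_rc S (\<lambda>t. Z t w)" and t: "0 \<le> t"
    and A: "{w \<in> space (P x). Z t w \<in> E_int S} \<in> sets (P x)"
    and Z: "Z t \<in> measurable (restrict_space (P x) {w \<in> space (P x). Z t w \<in> E_int S}) (E_borel S)"
    and f: "f \<in> borel_measurable (E_borel S)"
  shows "(\<integral>\<^sup>+y. f y \<partial>killed_kernel S P Z (E_int S) t x) = (\<integral>\<^sup>+w. f (Z t w) * indicator (E_int S) (Z t w) \<partial>P x)"
proof -
  have eq: "{w \<in> space (P x). ennreal t < lifetime S Z w} = {w \<in> space (P x). Z t w \<in> E_int S}"
    using less_lifetime_iff[where Z=Z, OF rc t] by blast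
  have "(\<integral>\<^sup>+y. f y \<partial>killed_kernel S P Z (E_int S) t x) =
      (\<integral>\<^sup>+w. f (Z t w) * indicator {w \<in> space (P x). Z t w \<in> E_int S} w \<partial>P x)"
    unfolding killed_kernel_def eq using A f
    by (subst nn_integral_distr[OF Z]) (simp_all add: nn_integral_restrict_space)
  also have "\<dots> = (\<integral>\<^sup>+w. f (Z t w) * indicator (E_int S) (Z t w) \<partial>P x)"
    by (intro nn_integral_cong) (auto simp: indicator_def)
  finally show ?thesis .
qed

lemma sets_killed_kernel [simp]: "sets (killed_kernel S P Z U t x) = sets (E_borel S)"
  by (simp add: killed_kernel_def)

lemma sets_doob_kernel [simp]: "sets (doob_kernel S P Z h t x) = sets (E_borel S)"
  by (simp add: doob_kernel_def)

lemma space_killed_kernel [simp]: "space (killed_kernel S P Z U t x) = E_space S"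
  using sets_eq_imp_space_eq[OF sets_killed_kernel] by simp

lemma space_doob_kernel [simp]: "space (doob_kernel S P Z h t x) = E_space S"
  using sets_eq_imp_space_eq[OF sets_doob_kernel] by simp

lemma doob_set_Int_E_int:
  assumes "\<And>x. x \<in> E_int S \<Longrightarrow> 0 < h x \<and> h x < \<infinity>"
  shows "doob_set S h \<inter> E_int S = E_int S"
  using assms E_int_subset[of S] by (auto simp: doob_set_def)

context standard_process
begin

lemma killed_rc_X: "w \<in> space M \<Longrightarrow> killed_rc S (\<lambda>t. X t w)"
  unfolding killed_rc_def using right_continuous absorbed[of _ _ w] by metis

lemma space_P [simp]: "x \<in> E_space S \<Longrightarrow> space (P x) = space M"
  using sets_P by (rule sets_eq_imp_space_eq)

lemma space_F_eq [simp]: "space (F t) = space M"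
  by (rule space_F)

lemma measurable_X_F: "0 \<le> s \<Longrightarrow> s \<le> t \<Longrightarrow> X s \<in> measurable (F (ennreal t)) (E_borel S)"
  using adapted[of s] sets_F_mono[of "ennreal s" "ennreal t"] by (auto simp: measurable_def ennreal_leI)

lemma measurable_X [measurable]: "0 \<le> t \<Longrightarrow> X t \<in> measurable M (E_borel S)"
  using adapted[of t] F_sub[of "ennreal t"] by (auto simp: measurable_def)

lemma measurable_X_P: "0 \<le> t \<Longrightarrow> x \<in> E_space S \<Longrightarrow> X t \<in> measurable (P x) (E_borel S)"
  using measurable_X measurable_cong_sets[OF sets_P refl] by blast

lemma X_in_E_space: "0 \<le> t \<Longrightarrow> w \<in> space M \<Longrightarrow> X t w \<in> E_space S"
  using measurable_space[OF measurable_X] by simp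

definition transition :: "real \<Rightarrow> 'a option \<Rightarrow> 'a option measure" where
  "transition t x = distr (P x) (E_borel S) (X t)"

lemma transition_measurable:
  assumes t: "0 \<le> t"
  shows "transition t \<in> measurable (E_borel S) (subprob_algebra (E_borel S))"
proof (rule measurable_subprob_algebra)
  fix x assume "x \<in> space (E_borel S)"
  then have x: "x \<in> E_space S" by simp
  interpret prob_space "P x" using x by (rule prob_P)
  have "prob_space (transition t x)" unfolding transition_def
    by (rule prob_space_distr) (rule measurable_X_P[OF t x])
  then show "subprob_space (transition t x)" by (rule prob_space_imp_subprob_space)
  show "sets (transition t x) = sets (E_borel S)" by (simp add: transition_def)
next
  fix B assume B: "B \<in> sets (E_borel S)"
  have "(\<lambda>x. emeasure (P x) {w \<in> space M. X t w \<in> B}) \<in> borel_measurable (E_borel S)"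
    using measurable_P[OF t B] .
  then show "(\<lambda>x. emeasure (transition t x) B) \<in> borel_measurable (E_borel S)"
  proof (rule measurable_cong[THEN iffD1, rotated])
    fix x assume "x \<in> space (E_borel S)"
    then have x: "x \<in> E_space S" by simp
    show "emeasure (P x) {w \<in> space M. X t w \<in> B} = emeasure (transition t x) B"
      unfolding transition_def using x B
      by (subst emeasure_distr[OF measurable_X_P[OF t x]]) (auto intro!: arg_cong[where f="emeasure (P x)"])
  qed
qed

lemma nn_integral_transition:
  "0 \<le> t \<Longrightarrow> x \<in> E_space S \<Longrightarrow> f \<in> borel_measurable (E_borel S) \<Longrightarrow>
    (\<integral>\<^sup>+y. f y \<partial>transition t x) = (\<integral>\<^sup>+w. f (X t w) \<partial>P x)"
  unfolding transition_def by (rule nn_integral_distr) (auto intro: measurable_X_P)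

lemma nn_integral_X_measurable:
  assumes "0 \<le> t" "f \<in> borel_measurable (E_borel S)"
  shows "(\<lambda>x. \<integral>\<^sup>+w. f (X t w) \<partial>P x) \<in> borel_measurable (E_borel S)"
  using measurable_compose[OF transition_measurable[OF assms(1)] nn_integral_measurable_subprob_algebra[OF assms(2)]]
  by (rule measurable_cong[THEN iffD1, rotated]) (simp add: nn_integral_transition assms)

text \<open>\<open>strong_Markov\<close> at a constant time, carried from sets to functions. Both
  sides integrate \<open>f\<close> against measures on \<open>E\<close> that agree on sets by
  \<open>strong_Markov\<close>; measurability of the kernel \<open>transition\<close> makes the
  right-hand measure a \<open>bind\<close>.\<close>

lemma Markov:
  assumes s: "0 \<le> s" and t: "0 \<le> t" and x: "x \<in> E_space S" and \<Lambda>: "\<Lambda> \<in> sets (F (ennreal s))"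
    and f: "f \<in> borel_measurable (E_borel S)"
  shows "(\<integral>\<^sup>+w. indicator \<Lambda> w * f (X (s + t) w) \<partial>P x) =
    (\<integral>\<^sup>+w. indicator \<Lambda> w * (\<integral>\<^sup>+w'. f (X t w') \<partial>P (X s w)) \<partial>P x)"
proof -
  note [measurable_cong] = sets_P[OF x]
  have \<Lambda>M[measurable]: "\<Lambda> \<in> sets M" using F_sub \<Lambda> by blast
  have \<Lambda>P[measurable]: "\<Lambda> \<in> sets (P x)" using \<Lambda>M sets_P[OF x] by simp
  have [measurable]: "X s \<in> measurable (P x) (E_borel S)" "X (s + t) \<in> measurable (P x) (E_borel S)"
    using measurable_X_P x s t by auto
  note [measurable] = f transition_measurable[OF t]
  let ?D = "density (P x) (indicator \<Lambda>)"
  let ?m1 = "distr ?D (E_borel S) (X (s + t))"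
  let ?m0 = "distr ?D (E_borel S) (X s)"
  have ne: "space ?m0 \<noteq> {}" by (auto simp: E_space_eq)
  have T: "stopping_time F (\<lambda>_. ennreal s)" by (rule stopping_time_const)
  have pre: "\<Lambda> \<in> sets (pre_sigma (\<lambda>_. ennreal s))"
  proof -
    have "{w \<in> \<Lambda>. ennreal s \<le> u} \<in> sets (F u)" for u
    proof (cases "ennreal s \<le> u")
      case True
      then have "\<Lambda> \<in> sets (F u)" using sets_F_mono[OF True] \<Lambda> by blast
      then show ?thesis using True by simp
    qed simp
    then show ?thesis by (rule sets_pre_sigmaI[OF T])
  qed
  have "?m1 = ?m0 \<bind> transition t"
  proof (rule measure_eqI)
    show "sets ?m1 = sets (?m0 \<bind> transition t)"
      using sets_bind[of ?m0 "transition t" "E_borel S", OF _ ne] by (simp add: transition_def)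
    fix B assume "B \<in> sets ?m1"
    then have B[measurable]: "B \<in> sets (E_borel S)" by simp
    have "emeasure ?m1 B = emeasure (P x) {w \<in> \<Lambda>. X (s + t) w \<in> B}"
    proof -
      have "emeasure ?m1 B = (\<integral>\<^sup>+w. indicator \<Lambda> w * indicator (X (s + t) -` B \<inter> space (P x)) w \<partial>P x)"
        by (subst emeasure_distr, simp, simp, subst emeasure_density) auto
      also have "\<dots> = (\<integral>\<^sup>+w. indicator {w \<in> \<Lambda>. X (s + t) w \<in> B} w \<partial>P x)"
        using x by (intro nn_integral_cong) (auto simp: indicator_def)
      also have "\<dots> = emeasure (P x) {w \<in> \<Lambda>. X (s + t) w \<in> B}"
      proof (rule nn_integral_indicator)
        have "{w \<in> \<Lambda>. X (s + t) w \<in> B} = \<Lambda> \<inter> (X (s + t) -` B \<inter> space (P x))"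
          using sets.sets_into_space[OF \<Lambda>P] by auto
        then show "{w \<in> \<Lambda>. X (s + t) w \<in> B} \<in> sets (P x)" by simp
      qed
      finally show ?thesis .
    qed
    also have "\<dots> = (\<integral>\<^sup>+w. indicator \<Lambda> w * emeasure (P (X s w)) {w' \<in> space M. X t w' \<in> B} \<partial>P x)"
      using strong_Markov[OF T x t B pre] s by simp
    also have "\<dots> = (\<integral>\<^sup>+w. indicator \<Lambda> w * emeasure (transition t (X s w)) B \<partial>P x)"
    proof (rule nn_integral_cong)
      fix w assume "w \<in> space (P x)"
      then have "X s w \<in> E_space S" using X_in_E_space s x by simp
      then show "indicator \<Lambda> w * emeasure (P (X s w)) {w' \<in> space M. X t w' \<in> B} = indicator \<Lambda> w * emeasure (transition t (X s w)) B"
        unfolding transition_def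
        by (subst emeasure_distr[OF measurable_X_P[OF t]]) (auto intro!: arg_cong2[where f="(*)"] arg_cong[where f="emeasure (P (X s w))"])
    qed
    also have "\<dots> = (\<integral>\<^sup>+y. emeasure (transition t y) B \<partial>?m0)"
      by (subst nn_integral_distr, simp, measurable, subst nn_integral_density) auto
    also have "\<dots> = emeasure (?m0 \<bind> transition t) B"
      by (rule emeasure_bind[symmetric, OF ne _ B]) (simp add: transition_measurable t)
    finally show "emeasure ?m1 B = emeasure (?m0 \<bind> transition t) B" .
  qed
  then have "(\<integral>\<^sup>+y. f y \<partial>?m1) = (\<integral>\<^sup>+y. f y \<partial>(?m0 \<bind> transition t))" by simp
  also have "\<dots> = (\<integral>\<^sup>+y. (\<integral>\<^sup>+z. f z \<partial>transition t y) \<partial>?m0)"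
    by (rule nn_integral_bind[where B="E_borel S"]) auto
  also have "\<dots> = (\<integral>\<^sup>+w. indicator \<Lambda> w * (\<integral>\<^sup>+z. f z \<partial>transition t (X s w)) \<partial>P x)"
    by (subst nn_integral_distr, simp, measurable, subst nn_integral_density) auto
  also have "\<dots> = (\<integral>\<^sup>+w. indicator \<Lambda> w * (\<integral>\<^sup>+w'. f (X t w') \<partial>P (X s w)) \<partial>P x)"
    using X_in_E_space[OF s] x by (intro nn_integral_cong) (simp add: nn_integral_transition t f)
  finally show ?thesis
    by (subst (asm) nn_integral_distr, simp, measurable, subst (asm) nn_integral_density) auto
qed

lemma nn_integral_killed_X:
  assumes "0 \<le> t" "x \<in> E_space S" "f \<in> borel_measurable (E_borel S)"
  shows "(\<integral>\<^sup>+y. f y \<partial>killed_kernel S P X (E_int S) t x) = (\<integral>\<^sup>+w. f (X t w) * indicator (E_int S) (X t w) \<partial>P x)"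
  using assms killed_rc_X measurable_sets[OF measurable_X_P[OF assms(1,2)] E_int_sets]
  by (intro nn_integral_killed_kernel measurable_restrict_space1 measurable_X_P)
    (auto simp: vimage_def Int_def conj_commute)

lemma dead_from_start:
  assumes "x \<in> E_space S" "x \<notin> E_int S" "0 \<le> t"
  shows "AE w in P x. X t w \<notin> E_int S"
  using normal[OF assms(1)] AE_space
proof eventually_elim
  case (elim w)
  then show ?case using absorbed[of 0 t w] assms by simp
qed

text \<open>Used with \<open>\<rho> = h\<close> and with \<open>\<rho> = 1\<close>; in the latter
  case \<open>doob_kernel\<close> is the semigroup of \<open>X\<close> killed at its
  lifetime.\<close>

context
  fixes \<rho> :: "'a option \<Rightarrow> ennreal"
  assumes \<rho>[measurable]: "\<rho> \<in> borel_measurable (E_borel S)"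
    and \<rho>_pos: "\<And>x. x \<in> E_int S \<Longrightarrow> 0 < \<rho> x \<and> \<rho> x < \<infinity>"
begin

lemma nn_integral_doob_kernel:
  assumes t: "0 \<le> t" and x: "x \<in> E_space S" and f[measurable]: "f \<in> borel_measurable (E_borel S)"
  shows "(\<integral>\<^sup>+y. f y \<partial>doob_kernel S P X \<rho> t x) =
    (if x \<in> doob_set S \<rho> then (\<integral>\<^sup>+w. \<rho> (X t w) / \<rho> x * f (X t w) * indicator (E_int S) (X t w) \<partial>P x) else 0)"
proof (cases "x \<in> doob_set S \<rho>")
  case True
  have "(\<integral>\<^sup>+y. f y \<partial>doob_kernel S P X \<rho> t x) = (\<integral>\<^sup>+y. \<rho> y / \<rho> x * f y \<partial>killed_kernel S P X (E_int S) t x)"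
    using True doob_set_Int_E_int[of S \<rho>, OF \<rho>_pos]
    by (simp add: doob_kernel_def, subst nn_integral_density) (simp_all add: measurable_cong_sets[OF sets_killed_kernel refl])
  then show ?thesis using True t x by (simp add: nn_integral_killed_X)
next
  case False
  then show ?thesis by (simp add: doob_kernel_def)
qed

lemma nn_integral_doob_kernel_dead:
  assumes t: "0 \<le> t" and x: "x \<in> E_space S" "x \<notin> E_int S" and f[measurable]: "f \<in> borel_measurable (E_borel S)"
  shows "(\<integral>\<^sup>+y. f y \<partial>doob_kernel S P X \<rho> t x) = 0"
proof -
  have "(\<integral>\<^sup>+w. \<rho> (X t w) / \<rho> x * f (X t w) * indicator (E_int S) (X t w) \<partial>P x) = (\<integral>\<^sup>+w. 0 \<partial>P x)"
  proof (rule nn_integral_cong_AE)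
    show "AE w in P x. \<rho> (X t w) / \<rho> x * f (X t w) * indicator (E_int S) (X t w) = 0"
      using dead_from_start[OF x t] by eventually_elim simp
  qed
  then show ?thesis using nn_integral_doob_kernel[OF t x(1) f] by simp
qed

text \<open>Pulling the factor \<open>1 / \<rho> x\<close> out of the integral leaves a fixed
  function integrated against the transition kernel, which is measurable in
  \<open>x\<close>.\<close>

lemma fdd_doob_measurable:
  assumes "sorted_wrt (<) (map fst l)" "\<And>t B. (t, B) \<in> set l \<Longrightarrow> s \<le> t \<and> B \<in> sets (E_borel S)"
  shows "(\<lambda>y. fdd (doob_kernel S P X \<rho>) y s l) \<in> borel_measurable (E_borel S)"
  using assms
proof (induction l arbitrary: s)
  case (Cons p l)
  obtain t B where p: "p = (t, B)" by force
  have [measurable]: "B \<in> sets (E_borel S)" and st: "0 \<le> t - s" using Cons.prems p by auto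
  have [measurable]: "(\<lambda>y. fdd (doob_kernel S P X \<rho>) y t l) \<in> borel_measurable (E_borel S)"
    using Cons.prems p by (intro Cons.IH) (auto intro: less_imp_le)
  have [measurable]: "doob_set S \<rho> \<in> sets (E_borel S)"
  proof -
    have "{x \<in> space (E_borel S). 0 < \<rho> x \<and> \<rho> x < \<infinity>} \<in> sets (E_borel S)" by measurable
    then show ?thesis by (simp add: doob_set_def)
  qed
  let ?g = "\<lambda>z. indicator B z * fdd (doob_kernel S P X \<rho>) z t l"
  have [measurable]: "(\<lambda>x. \<integral>\<^sup>+w. \<rho> (X (t - s) w) * ?g (X (t - s) w) * indicator (E_int S) (X (t - s) w) \<partial>P x) \<in> borel_measurable (E_borel S)"
    using st by (rule nn_integral_X_measurable[where f="\<lambda>z. \<rho> z * ?g z * indicator (E_int S) z"]) measurable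
  have "(\<lambda>x. if x \<in> doob_set S \<rho> then (\<integral>\<^sup>+w. \<rho> (X (t - s) w) * ?g (X (t - s) w) * indicator (E_int S) (X (t - s) w) \<partial>P x) / \<rho> x else 0)
      \<in> borel_measurable (E_borel S)"
    by measurable
  then show ?case
  proof (rule measurable_cong[THEN iffD1, rotated])
    fix x assume "x \<in> space (E_borel S)"
    then have x: "x \<in> E_space S" by simp
    have [measurable]: "X (t - s) \<in> measurable (P x) (E_borel S)" using measurable_X_P[OF st x] .
    have "(\<integral>\<^sup>+w. \<rho> (X (t - s) w) / \<rho> x * ?g (X (t - s) w) * indicator (E_int S) (X (t - s) w) \<partial>P x) =
      (\<integral>\<^sup>+w. \<rho> (X (t - s) w) * ?g (X (t - s) w) * indicator (E_int S) (X (t - s) w) / \<rho> x \<partial>P x)"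
      by (intro nn_integral_cong) (simp add: divide_ennreal_def mult_ac)
    also have "\<dots> = (\<integral>\<^sup>+w. \<rho> (X (t - s) w) * ?g (X (t - s) w) * indicator (E_int S) (X (t - s) w) \<partial>P x) / \<rho> x"
      by (rule nn_integral_divide) measurable
    finally show "(if x \<in> doob_set S \<rho> then (\<integral>\<^sup>+w. \<rho> (X (t - s) w) * ?g (X (t - s) w) * indicator (E_int S) (X (t - s) w) \<partial>P x) / \<rho> x else 0)
        = fdd (doob_kernel S P X \<rho>) x s (p # l)"
      unfolding p fdd.simps by (subst nn_integral_doob_kernel[OF st x]) auto
  qed
qed simp

text \<open>The quotients of \<open>\<rho>\<close> at consecutive times telescope: the initial
  factor \<open>\<rho> (X s w)\<close> cancels the first denominator, and only the value at the last
  time survives. \<open>\<Lambda>\<close> carries the past, so that the induction can apply the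
  Markov property at each time.\<close>

lemma fdd_doob_Markov:
  assumes "sorted_wrt (<) (map fst l)" "\<And>t B. (t, B) \<in> set l \<Longrightarrow> s \<le> t \<and> B \<in> sets (E_borel S)"
    and "0 \<le> s" "x \<in> E_space S" "\<Lambda> \<in> sets (F (ennreal s))"
  shows "(\<integral>\<^sup>+w. indicator \<Lambda> w * (indicator (E_int S) (X s w) * \<rho> (X s w) * fdd (doob_kernel S P X \<rho>) (X s w) s l) \<partial>P x) =
    (\<integral>\<^sup>+w. indicator {w \<in> \<Lambda>. X s w \<in> E_int S \<and> (\<forall>(t, B)\<in>set l. X t w \<in> B \<inter> E_int S)} w * \<rho> (X (last (s # map fst l)) w) \<partial>P x)"
  using assms
proof (induction l arbitrary: s \<Lambda>)
  case Nil
  show ?case by (intro nn_integral_cong) (auto simp: indicator_def)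
next
  case (Cons p l)
  obtain t B where p: "p = (t, B)" by force
  let ?fd = "fdd (doob_kernel S P X \<rho>)"
  note x = Cons.prems(4)
  have B[measurable]: "B \<in> sets (E_borel S)" and st: "0 \<le> t - s" "0 \<le> t" "s \<le> t"
    using Cons.prems(2)[of t B] Cons.prems(3) p by auto
  have fm[measurable]: "(\<lambda>y. ?fd y t l) \<in> borel_measurable (E_borel S)"
    using Cons.prems p by (intro fdd_doob_measurable) (auto intro: less_imp_le)
  define g where "g z = indicator (B \<inter> E_int S) z * \<rho> z * ?fd z t l" for z
  have g[measurable]: "g \<in> borel_measurable (E_borel S)" unfolding g_def by measurable
  define \<Lambda>' where "\<Lambda>' = {w \<in> \<Lambda>. X s w \<in> E_int S}"
  have \<Lambda>sp: "\<Lambda> \<subseteq> space M" using sets.sets_into_space[OF Cons.prems(5)] by simp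
  have \<Lambda>': "\<Lambda>' \<in> sets (F (ennreal s))"
  proof -
    have "\<Lambda>' = \<Lambda> \<inter> (X s -` E_int S \<inter> space (F (ennreal s)))" using \<Lambda>sp by (auto simp: \<Lambda>'_def)
    then show ?thesis using Cons.prems measurable_sets[OF adapted E_int_sets] by auto
  qed
  define \<Lambda>'' where "\<Lambda>'' = {w \<in> \<Lambda>'. X t w \<in> B}"
  have \<Lambda>'': "\<Lambda>'' \<in> sets (F (ennreal t))"
  proof -
    have "\<Lambda>'' = \<Lambda>' \<inter> (X t -` B \<inter> space (F (ennreal t)))" using \<Lambda>sp by (auto simp: \<Lambda>'_def \<Lambda>''_def)
    moreover have "\<Lambda>' \<in> sets (F (ennreal t))" using \<Lambda>' sets_F_mono[OF ennreal_leI[OF st(3)]] by blast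
    ultimately show ?thesis using measurable_sets[OF adapted B] st by auto
  qed
  have "(\<integral>\<^sup>+w. indicator \<Lambda> w * (indicator (E_int S) (X s w) * \<rho> (X s w) * ?fd (X s w) s (p # l)) \<partial>P x) =
      (\<integral>\<^sup>+w. indicator \<Lambda>' w * (\<integral>\<^sup>+w'. g (X (t - s) w') \<partial>P (X s w)) \<partial>P x)"
  proof (rule nn_integral_cong)
    fix w assume w: "w \<in> space (P x)"
    show "indicator \<Lambda> w * (indicator (E_int S) (X s w) * \<rho> (X s w) * ?fd (X s w) s (p # l)) =
      indicator \<Lambda>' w * (\<integral>\<^sup>+w'. g (X (t - s) w') \<partial>P (X s w))"
    proof (cases "X s w \<in> E_int S")
      case True
      let ?y = "X s w"
      have y: "?y \<in> E_space S" using True E_int_subset by blast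
      have \<rho>y: "0 < \<rho> ?y" "\<rho> ?y < \<infinity>" using \<rho>_pos[OF True] by auto
      then have yd: "?y \<in> doob_set S \<rho>" using y by (auto simp: doob_set_def)
      have [measurable]: "X (t - s) \<in> measurable (P ?y) (E_borel S)" using measurable_X_P[OF st(1) y] .
      have "\<rho> ?y * ?fd ?y s (p # l) = \<rho> ?y * (\<integral>\<^sup>+w'. \<rho> (X (t - s) w') / \<rho> ?y * (indicator B (X (t - s) w') * ?fd (X (t - s) w') t l) * indicator (E_int S) (X (t - s) w') \<partial>P ?y)"
        unfolding p fdd.simps using yd by (subst nn_integral_doob_kernel[OF st(1) y]) auto
      also have "\<dots> = (\<integral>\<^sup>+w'. \<rho> ?y * (\<rho> (X (t - s) w') / \<rho> ?y * (indicator B (X (t - s) w') * ?fd (X (t - s) w') t l) * indicator (E_int S) (X (t - s) w')) \<partial>P ?y)"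
        by (rule nn_integral_cmult[symmetric]) measurable
      also have "\<dots> = (\<integral>\<^sup>+w'. g (X (t - s) w') \<partial>P ?y)"
      proof (rule nn_integral_cong)
        fix w'
        have "\<rho> ?y * (a / \<rho> ?y) = a" for a
          using \<rho>y ennreal_mult_divide_eq[of "\<rho> ?y" a] by (simp add: mult_divide_eq_ennreal ennreal_times_divide mult.commute)
        then show "\<rho> ?y * (\<rho> (X (t - s) w') / \<rho> ?y * (indicator B (X (t - s) w') * ?fd (X (t - s) w') t l) * indicator (E_int S) (X (t - s) w')) = g (X (t - s) w')"
          by (simp add: g_def indicator_inter_arith mult.assoc[symmetric]) (simp add: mult_ac)
      qed
      finally show ?thesis using True by (simp add: \<Lambda>'_def indicator_def)
    qed (simp add: \<Lambda>'_def)
  qed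
  also have "\<dots> = (\<integral>\<^sup>+w. indicator \<Lambda>' w * g (X t w) \<partial>P x)"
    using Markov[OF Cons.prems(3) st(1) x \<Lambda>' g] by simp
  also have "\<dots> = (\<integral>\<^sup>+w. indicator \<Lambda>'' w * (indicator (E_int S) (X t w) * \<rho> (X t w) * ?fd (X t w) t l) \<partial>P x)"
    by (intro nn_integral_cong) (auto simp: g_def \<Lambda>''_def indicator_def)
  also have "\<dots> = (\<integral>\<^sup>+w. indicator {w \<in> \<Lambda>''. X t w \<in> E_int S \<and> (\<forall>(t, B)\<in>set l. X t w \<in> B \<inter> E_int S)} w * \<rho> (X (last (t # map fst l)) w) \<partial>P x)"
    using Cons.prems p st \<Lambda>'' by (intro Cons.IH) (auto intro: less_imp_le)
  also have "\<dots> = (\<integral>\<^sup>+w. indicator {w \<in> \<Lambda>. X s w \<in> E_int S \<and> (\<forall>(t, B)\<in>set (p # l). X t w \<in> B \<inter> E_int S)} w * \<rho> (X (last (s # map fst (p # l))) w) \<partial>P x)"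
    by (intro nn_integral_cong arg_cong2[where f="(*)"]) (auto simp: p \<Lambda>'_def \<Lambda>''_def indicator_def)
  finally show ?case .
qed

text \<open>The case \<open>s = 0\<close> with the whole space as past, where \<open>X 0 = x\<close>
  almost surely. A last time must exist: \<open>fdd\<close> of the empty list is 1 and carries no
  factor \<open>\<rho>\<close>.\<close>

lemma fdd_doob:
  assumes l: "sorted_wrt (<) (map fst l)" "\<And>t B. (t, B) \<in> set l \<Longrightarrow> 0 \<le> t \<and> B \<in> sets (E_borel S)" "l \<noteq> []"
    and x: "x \<in> E_int S"
  shows "\<rho> x * fdd (doob_kernel S P X \<rho>) x 0 l =
    (\<integral>\<^sup>+w. indicator {w \<in> space M. \<forall>(t, B)\<in>set l. X t w \<in> B \<inter> E_int S} w * \<rho> (X (last (map fst l)) w) \<partial>P x)"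
proof -
  have xE: "x \<in> E_space S" using x E_int_subset by blast
  interpret Px: prob_space "P x" using prob_P[OF xE] .
  let ?fd = "fdd (doob_kernel S P X \<rho>)"
  have "\<rho> x * ?fd x 0 l = (\<integral>\<^sup>+w. \<rho> x * ?fd x 0 l \<partial>P x)" by (simp add: Px.emeasure_space_1)
  also have "\<dots> = (\<integral>\<^sup>+w. indicator (space M) w * (indicator (E_int S) (X 0 w) * \<rho> (X 0 w) * ?fd (X 0 w) 0 l) \<partial>P x)"
  proof (rule nn_integral_cong_AE)
    show "AE w in P x. \<rho> x * ?fd x 0 l = indicator (space M) w * (indicator (E_int S) (X 0 w) * \<rho> (X 0 w) * ?fd (X 0 w) 0 l)"
      using normal[OF xE] AE_space by eventually_elim (use x xE in simp)
  qed
  also have "\<dots> = (\<integral>\<^sup>+w. indicator {w \<in> space M. X 0 w \<in> E_int S \<and> (\<forall>(t, B)\<in>set l. X t w \<in> B \<inter> E_int S)} w * \<rho> (X (last (0 # map fst l)) w) \<partial>P x)"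
    using l xE sets.top[of "F (ennreal 0)"] by (intro fdd_doob_Markov) auto
  also have "\<dots> = (\<integral>\<^sup>+w. indicator {w \<in> space M. \<forall>(t, B)\<in>set l. X t w \<in> B \<inter> E_int S} w * \<rho> (X (last (map fst l)) w) \<partial>P x)"
  proof (rule nn_integral_cong_AE)
    show "AE w in P x. indicator {w \<in> space M. X 0 w \<in> E_int S \<and> (\<forall>(t, B)\<in>set l. X t w \<in> B \<inter> E_int S)} w * \<rho> (X (last (0 # map fst l)) w)
        = indicator {w \<in> space M. \<forall>(t, B)\<in>set l. X t w \<in> B \<inter> E_int S} w * \<rho> (X (last (map fst l)) w)"
      using normal[OF xE] AE_space by eventually_elim (use x l(3) in \<open>simp add: indicator_def\<close>)
  qed
  finally show ?thesis .
qed

lemma fdd_doob_dead: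
  assumes l: "sorted_wrt (<) (map fst l)" "\<And>t B. (t, B) \<in> set l \<Longrightarrow> 0 \<le> t \<and> B \<in> sets (E_borel S)" "l \<noteq> []"
    and x: "x \<in> E_space S" "x \<notin> E_int S"
  shows "fdd (doob_kernel S P X \<rho>) x 0 l = 0"
proof -
  obtain t B l' where l': "l = (t, B) # l'" using l(3) by (cases l) auto
  have "(\<lambda>z. indicator B z * fdd (doob_kernel S P X \<rho>) z t l') \<in> borel_measurable (E_borel S)"
    using l l' by (intro borel_measurable_times_ennreal borel_measurable_indicator fdd_doob_measurable) (auto intro: less_imp_le)
  then show ?thesis unfolding l' fdd.simps using l(2)[of t B] l' x by (subst nn_integral_doob_kernel_dead) auto
qed

end

end

section \<open>Processes with the inversion property\<close>

locale inversion_process = standard_process S M F \<theta> P X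
  for S :: "'a::euclidean_space set" and M :: "'w measure" and F \<theta> P X +
  fixes I :: "'a option \<Rightarrow> 'a option" and h :: "'a option \<Rightarrow> ennreal" and v :: "'a option \<Rightarrow> real"
  assumes IP: "has_IP S P X I h v"
    and continuous: "continuous_characteristics S I h"
begin

lemma I_space: "x \<in> E_space S \<Longrightarrow> I x \<in> E_space S" and I_I: "x \<in> E_space S \<Longrightarrow> I (I x) = x"
  using IP by (auto simp: has_IP_def)

lemma h_measurable [measurable]: "h \<in> borel_measurable (E_borel S)"
  using IP by (auto simp: has_IP_def excessive_def)

lemma h_pos: "x \<in> E_int S \<Longrightarrow> 0 < h x \<and> h x < \<infinity>"
  using IP by (auto simp: has_IP_def)

lemma v_pos: "\<forall>x\<in>E_int S. 0 < v x"
  and v_continuous: "continuous_map (subtopology (E_top S) (E_int S)) euclideanreal v"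
  using IP by (auto simp: has_IP_def)

lemma IP_law: "x \<in> E_space S \<Longrightarrow>
    has_law S (P x) (\<lambda>t w. I (X (time_change S v X t w) w)) (clock S v X \<infinity>) (doob_kernel S P X h) (I x)"
  using IP unfolding has_IP_def by blast

text \<open>Test the inversion property at time \<open>0\<close>. A process started at a dead point
  has almost surely zero clock, so its inversion is never alive, whereas the Doob transform started
  at an alive \<open>I x\<close> is alive at time \<open>0\<close> with probability 1.\<close>

lemma I_dead:
  assumes x: "x \<in> E_space S" "x \<notin> E_int S"
  shows "I x \<notin> E_int S"
proof
  assume Ix: "I x \<in> E_int S"
  have IxE: "I x \<in> E_space S" using I_space x by blast
  let ?l = "[(0, E_space S)] :: (real \<times> 'a option set) list"
  have E: "E_space S \<in> sets (E_borel S)" using sets.top[of "E_borel S"] by simp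
  let ?A = "{w \<in> space (P x). \<forall>(t, B)\<in>set ?l. ennreal t < clock S v X \<infinity> w \<and> I (X (time_change S v X t w) w) \<in> B}"
  have "?A \<subseteq> {w \<in> space M. X 0 w \<in> E_int S}"
  proof
    fix w assume w: "w \<in> ?A"
    then have wM: "w \<in> space M" using x by simp
    have "X 0 w \<in> E_int S"
    proof (rule ccontr)
      assume "X 0 w \<notin> E_int S"
      then have "X s w \<notin> E_int S" if "0 \<le> s" for s using absorbed[of 0 s w] wM that by simp
      then have "{s. 0 \<le> s \<and> ennreal s < min \<infinity> (lifetime S X w)} = {}"
        using less_lifetime_iff[where Z=X and w=w, OF killed_rc_X[OF wM]] by auto
      then have "clock S v X \<infinity> w = 0" unfolding clock_def by simp
      then show False using w by simp
    qed
    then show "w \<in> {w \<in> space M. X 0 w \<in> E_int S}" using wM by simp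
  qed
  moreover have "{w \<in> space M. X 0 w \<in> E_int S} \<in> sets (P x)"
    using measurable_sets[OF measurable_X_P[of 0 x] E_int_sets] x by (simp add: vimage_def Int_def conj_commute)
  ultimately have "emeasure (P x) ?A \<le> emeasure (P x) {w \<in> space M. X 0 w \<in> E_int S}"
    by (rule emeasure_mono)
  also have "\<dots> = 0"
  proof -
    have "AE w in P x. w \<notin> {w \<in> space M. X 0 w \<in> E_int S}"
      using dead_from_start[OF x order_refl] by eventually_elim simp
    then show ?thesis
      using \<open>{w \<in> space M. X 0 w \<in> E_int S} \<in> sets (P x)\<close> by (simp add: AE_iff_null_sets null_setsD1)
  qed
  finally have "emeasure (P x) ?A = 0" by simp
  moreover have "emeasure (P x) ?A = fdd (doob_kernel S P X h) (I x) 0 ?l"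
    using IP_law[OF x(1)] E unfolding has_law_def by (elim allE[of _ ?l]) auto
  ultimately have z: "h (I x) * fdd (doob_kernel S P X h) (I x) 0 ?l = 0" by simp
  interpret Px: prob_space "P (I x)" using prob_P[OF IxE] .
  have "h (I x) * fdd (doob_kernel S P X h) (I x) 0 ?l =
     (\<integral>\<^sup>+w. indicator {w \<in> space M. \<forall>(t, B)\<in>set ?l. X t w \<in> B \<inter> E_int S} w * h (X (last (map fst ?l)) w) \<partial>P (I x))"
    using E Ix h_pos by (intro fdd_doob) auto
  also have "\<dots> = (\<integral>\<^sup>+w. h (I x) \<partial>P (I x))"
  proof (rule nn_integral_cong_AE)
    show "AE w in P (I x). indicator {w \<in> space M. \<forall>(t, B)\<in>set ?l. X t w \<in> B \<inter> E_int S} w * h (X (last (map fst ?l)) w) = h (I x)"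
      using normal[OF IxE] AE_space by eventually_elim (use Ix IxE in simp)
  qed
  also have "\<dots> = h (I x)" by (simp add: Px.emeasure_space_1)
  finally show False using z h_pos[OF Ix] by simp
qed

lemma I_E_int:
  assumes "x \<in> E_int S"
  shows "I x \<in> E_int S"
proof (rule ccontr)
  assume *: "I x \<notin> E_int S"
  have x: "x \<in> E_space S" using assms E_int_subset by blast
  show False using I_dead[OF I_space[OF x] *] I_I[OF x] assms by simp
qed

section \<open>Euclidean coordinates for the state space, the inversion and the paths\<close>

definition G :: "'a set" where "G = alive_set S"
definition c :: "'a \<Rightarrow> ennreal" where "c = inverse_speed S v"
definition J :: "'a \<Rightarrow> 'a" where "J x = (if x \<in> G then alive_point S (I (Some x)) else 0)"
definition y :: "real \<Rightarrow> 'w \<Rightarrow> 'a" where "y t w = alive_point S (X t w)"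

lemma open_G': "open G" and zero_G: "0 \<notin> G"
  by (auto simp: G_def open_alive_set zero_notin_alive_set)

lemma Some_G: "Some x \<in> E_int S \<longleftrightarrow> x \<in> G"
  by (simp add: G_def)

lemma Some_G_space: "x \<in> G \<Longrightarrow> Some x \<in> E_space S"
  using E_int_subset Some_G by blast

lemma Some_J: "x \<in> G \<Longrightarrow> Some (J x) = I (Some x)"
  using Some_alive_point[OF I_E_int[of "Some x"]] by (simp add: J_def G_def)

lemma y_alive: "y t w \<in> G \<longleftrightarrow> X t w \<in> E_int S"
  by (simp add: y_def G_def)

lemma Some_y: "X t w \<in> E_int S \<Longrightarrow> Some (y t w) = X t w"
  by (simp add: y_def Some_alive_point)

sublocale inverted_domain G c J
proof -
  interpret killed_domain G c
    unfolding G_def c_def using v_continuous v_pos by (rule killed_domain_inverse_speed)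
  have J_G: "J x \<in> G" if "x \<in> G" for x
    using that I_E_int[of "Some x"] by (simp add: J_def G_def)
  have "continuous_map (subtopology (E_top S) (E_int S)) (E_top S) I"
    using continuous by (simp add: continuous_characteristics_def)
  then have "continuous_map (subtopology (E_top S) (E_int S)) (subtopology (E_top S) (E_int S)) I"
    using I_E_int by (auto simp: continuous_map_in_subtopology)
  from continuous_on_alive[OF continuous_map_compose[OF this continuous_map_alive_point]]
  have ct: "continuous_on G (\<lambda>x. alive_point S (I (Some x)))" by (simp add: G_def)
  show "inverted_domain G c J"
  proof
    show "J x \<in> G" if "x \<in> G" for x using J_G[OF that] .
    show "J (J x) = x" if "x \<in> G" for x
    proof -
      have "Some (J (J x)) = I (I (Some x))" using Some_J[OF that] Some_J[OF J_G[OF that]] by simp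
      then show ?thesis using I_I Some_G_space[OF that] by simp
    qed
    show "continuous_on G J" using ct by (rule continuous_on_eq) (simp add: J_def)
    show "J \<in> borel_measurable borel"
      using ct unfolding J_def G_def by (rule borel_measurable_alive)
  qed
qed

lemma rc_y: "w \<in> space M \<Longrightarrow> rc_path G (\<lambda>t. y t w)"
  unfolding y_def G_def by (intro killed_rc_path killed_rc_X)

lemma killed_path_y: "w \<in> space M \<Longrightarrow> killed_path G c (\<lambda>t. y t w)"
  using rc_y by unfold_locales

lemma y_measurable_F: "0 \<le> s \<Longrightarrow> s \<le> t \<Longrightarrow> y s \<in> borel_measurable (F (ennreal t))"
  unfolding y_def[abs_def] using measurable_X_F by measurable

lemma y_measurable: "0 \<le> t \<Longrightarrow> y t \<in> borel_measurable M"
  unfolding y_def[abs_def] by measurable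

lemma y_measurable_P: "0 \<le> t \<Longrightarrow> x \<in> E_space S \<Longrightarrow> y t \<in> borel_measurable (P x)"
  using y_measurable measurable_cong_sets[OF sets_P refl] by blast

lemma path_clock_finite_on_compact:
  assumes w: "w \<in> space M" and C: "compact C" "C \<subseteq> G" and s: "0 \<le> s" "\<And>u. 0 \<le> u \<Longrightarrow> u \<le> s \<Longrightarrow> y u w \<in> C"
  shows "path_clock c (\<lambda>t. y t w) s < \<infinity>"
proof -
  interpret killed_path G c "\<lambda>t. y t w" using killed_path_y[OF w] .
  have "C \<noteq> {}" using s by auto
  then obtain x where x: "x \<in> C" "\<And>z. z \<in> C \<Longrightarrow> c z \<le> c x"
    using continuous_attains_sup[OF C(1) _ continuous_on_subset[OF c_continuous C(2)]] by blast
  have "path_clock c (\<lambda>t. y t w) s = (\<integral>\<^sup>+r. indicator {0..} r * c (y r w) * indicator {..<s} r \<partial>lborel)"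
    unfolding path_clock_def by (rule emeasure_occupation) simp
  also have "\<dots> \<le> (\<integral>\<^sup>+r. c x * indicator {0..s} r \<partial>lborel)"
    using x(2) s by (intro nn_integral_mono) (auto simp: indicator_def)
  also have "\<dots> = c x * ennreal s" using s by (subst nn_integral_cmult_indicator) auto
  also have "\<dots> < \<infinity>" using c_finite[of x] x C by (auto simp: ennreal_mult_less_top)
  finally show ?thesis .
qed

text \<open>Quasi-left-continuity along the exit times from an exhausting sequence of compact sets shows
  that a path stays in a compact subset of \<open>G\<close> up to any time before its lifetime.\<close>

lemma AE_compact_range:
  assumes x: "x \<in> E_space S"
  shows "AE w in P x. \<forall>s\<ge>0. y s w \<in> G \<longrightarrow> (\<exists>C. compact C \<and> C \<subseteq> G \<and> (\<forall>u. 0 \<le> u \<and> u \<le> s \<longrightarrow> y u w \<in> C))"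
proof -
  obtain C :: "nat \<Rightarrow> 'a set" where C: "\<And>n. compact (C n)" "\<And>n. C n \<subseteq> G" "\<And>n. C n \<subseteq> interior (C (Suc n))" "(\<Union>n. C n) = G"
    using open_Union_compact_subsets[OF open_G'] by metis
  have Cmono: "C m \<subseteq> C n" if "m \<le> n" for m n
    using lift_Suc_mono_le[of C m n] C(3) interior_subset that by (metis subset_trans)
  \<comment> \<open>Exit times from \<open>C n\<close> read off at rational times, which keeps the
    events countable; right-continuity of the path and closedness of \<open>C n\<close> recover the
    real times below.\<close>
  define T where "T n w = Inf {ennreal q |q. q \<in> \<rat> \<and> 0 \<le> q \<and> y q w \<notin> C n}" for n w
  have T_less: "T n w < ennreal r \<longleftrightarrow> (\<exists>q\<in>\<rat>. 0 \<le> q \<and> q < r \<and> y q w \<notin> C n)" for n w r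
    unfolding T_def Inf_less_iff by (auto simp: ennreal_less_iff)
  have T_stop: "stopping_time F (T n)" for n
  proof
    fix t :: ennreal
    show "Measurable.pred (F t) (\<lambda>w. T n w \<le> t)"
    proof (cases t)
      case (real t')
      \<comment> \<open>Right-continuity of the filtration reduces the claim to every later
        \<open>F s\<close>. There it holds because the event is decided by the path before
        \<open>s0\<close>, for any \<open>s0\<close> strictly beyond \<open>t\<close>.\<close>
      have "{w \<in> space M. T n w \<le> t} \<in> sets (F s)" if "s \<in> {t<..}" for s
      proof -
        have "t < s" using that by simp
        then obtain s' where s': "t < s'" "s' < s" using dense[of t s] by blast
        then obtain s0 where s0: "s' = ennreal s0" "0 \<le> s0" by (cases s') auto
        have lt: "t' < s0" using s' s0 real by (simp add: ennreal_less_iff)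
        have eq: "T n w \<le> t \<longleftrightarrow> (\<forall>r\<in>\<rat>. t' < r \<and> r < s0 \<longrightarrow> (\<exists>q\<in>\<rat>. 0 \<le> q \<and> q < r \<and> y q w \<notin> C n))" for w
        proof
          assume *: "T n w \<le> t"
          show "\<forall>r\<in>\<rat>. t' < r \<and> r < s0 \<longrightarrow> (\<exists>q\<in>\<rat>. 0 \<le> q \<and> q < r \<and> y q w \<notin> C n)"
          proof (intro ballI impI)
            fix r assume r: "t' < r \<and> r < s0"
            have "t < ennreal r" using r real by (simp add: ennreal_less_iff)
            with * have "T n w < ennreal r" by simp
            then show "\<exists>q\<in>\<rat>. 0 \<le> q \<and> q < r \<and> y q w \<notin> C n" by (simp add: T_less)
          qed
        next
          assume *: "\<forall>r\<in>\<rat>. t' < r \<and> r < s0 \<longrightarrow> (\<exists>q\<in>\<rat>. 0 \<le> q \<and> q < r \<and> y q w \<notin> C n)"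
          show "T n w \<le> t"
          proof (rule ccontr)
            assume "\<not> ?thesis"
            then have "t < min (T n w) s'" using s' by simp
            then obtain u where u: "t < u" "u < min (T n w) s'" using dense by blast
            then obtain u' where u': "u = ennreal u'" "0 \<le> u'" by (cases u) auto
            then have "t' < u'" "u' < s0" using u real s0 by (simp_all add: ennreal_less_iff)
            obtain r where r: "r \<in> \<rat>" "t' < r" "r < u'" using Rats_dense_in_real[OF \<open>t' < u'\<close>] by blast
            then have "T n w < ennreal r" using * \<open>u' < s0\<close> by (simp add: T_less)
            also have "ennreal r \<le> ennreal u'" using r by (intro ennreal_leI) simp
            finally have "T n w < u" using u' by simp
            moreover have "u < T n w" using u by simp
            ultimately show False by (rule less_asym)
          qed
        qed
        have yq: "{w \<in> space (F s). y q w \<notin> C n} \<in> sets (F s)" if q: "0 \<le> q" "q < s0" for q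
        proof -
          have "y q \<in> borel_measurable (F (ennreal s0))" using q by (intro y_measurable_F) auto
          then have "y q -` (- C n) \<inter> space (F (ennreal s0)) \<in> sets (F (ennreal s0))"
            by (rule measurable_sets) (use C(1)[of n] in \<open>auto simp: compact_imp_closed\<close>)
          moreover have "sets (F (ennreal s0)) \<subseteq> sets (F s)" using s' s0 by (intro sets_F_mono) auto
          ultimately show ?thesis by (auto simp: vimage_def Int_def conj_commute)
        qed
        have "{w \<in> space (F s). \<forall>r\<in>\<rat> \<inter> {t'<..<s0}. \<exists>q\<in>\<rat> \<inter> {0..<r}. y q w \<notin> C n} \<in> sets (F s)"
          by (intro sets.sets_Collect_countable_All' sets.sets_Collect_countable_Ex' countable_Int1 countable_rat yq) auto
        also have "{w \<in> space (F s). \<forall>r\<in>\<rat> \<inter> {t'<..<s0}. \<exists>q\<in>\<rat> \<inter> {0..<r}. y q w \<notin> C n} = {w \<in> space M. T n w \<le> t}"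
          unfolding eq by (simp add: Ball_def Bex_def imp_conjL)
        finally show ?thesis .
      qed
      then have "{w \<in> space M. T n w \<le> t} \<in> sets (F t)"
        using F_right_continuous[of t] real by auto
      then show ?thesis by (simp add: pred_def)
    qed simp
  qed
  have T_inc: "incseq (\<lambda>n. T n w)" for w
  proof (rule monoI)
    fix m n :: nat assume "m \<le> n"
    then show "T m w \<le> T n w" unfolding T_def using Cmono[of m n] by (intro Inf_superset_mono) auto
  qed
  have "AE w in P x. (SUP n. T n w) < lifetime S X w \<longrightarrow>
            limitin (E_top S) (\<lambda>n. X (enn2real (T n w)) w) (X (enn2real (SUP n. T n w)) w) sequentially"
    using T_stop T_inc x by (intro quasi_left_continuous) auto
  with AE_space show ?thesis
  proof eventually_elim
    case (elim w)
    then have w: "w \<in> space M" using x by simp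
    interpret killed_path G c "\<lambda>t. y t w" using killed_path_y[OF w] .
    \<comment> \<open>If the exit times accumulated at an alive time \<open>\<tau>\<close>,
      quasi-left-continuity would put \<open>y (t n) w\<close> into the interior of a fixed
      \<open>C (Suc m)\<close>, hence of \<open>C n\<close>, for large \<open>n\<close>;
      right-continuity at \<open>t n\<close> would then keep the path in \<open>C n\<close> beyond
      its own exit time.\<close>
    have "\<not> (SUP n. T n w) < lifetime S X w"
    proof
      assume *: "(SUP n. T n w) < lifetime S X w"
      then obtain \<tau> where \<tau>: "(SUP n. T n w) = ennreal \<tau>" "0 \<le> \<tau>" by (cases "SUP n. T n w") auto
      have al: "X \<tau> w \<in> E_int S"
        using less_lifetime_iff[where Z=X and w=w, OF killed_rc_X[OF w] \<tau>(2)] * \<tau> by simp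
      define t where "t n = enn2real (T n w)" for n
      have t: "T n w = ennreal (t n)" "0 \<le> t n" for n
      proof -
        have "T n w \<le> ennreal \<tau>" unfolding \<tau>(1)[symmetric] by (rule SUP_upper) simp
        then have "T n w < \<infinity>" by (rule order_le_less_trans) simp
        then show "T n w = ennreal (t n)" by (simp add: t_def)
        show "0 \<le> t n" by (simp add: t_def)
      qed
      have "limitin (E_top S) (\<lambda>n. X (t n) w) (X \<tau> w) sequentially"
        using elim * \<tau> by (simp add: t_def)
      then have lim: "(\<lambda>n. y (t n) w) \<longlonglongrightarrow> y \<tau> w" using limitin_alive_point[OF _ al] by (simp add: y_def)
      have "y \<tau> w \<in> G" using al by (simp add: y_alive)
      then obtain m where "y \<tau> w \<in> C m" using C(4) by blast
      then have "y \<tau> w \<in> interior (C (Suc m))" using C(3) by blast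
      then have "\<forall>\<^sub>F n in sequentially. y (t n) w \<in> interior (C (Suc m))"
        using lim by (auto intro: topological_tendstoD)
      then obtain n where n: "Suc m \<le> n" "y (t n) w \<in> interior (C (Suc m))"
        unfolding eventually_sequentially by (meson le_cases order_trans)
      then have "y (t n) w \<in> interior (C n)" using interior_mono[OF Cmono[OF n(1)]] by blast
      then obtain e where e: "e > 0" "\<forall>s. t n \<le> s \<and> s < t n + e \<longrightarrow> y s w \<in> interior (C n)"
        using right_nhd[OF t(2)] open_interior by blast
      have "ennreal (t n) < ennreal (t n + e)" using e t(2)[of n] by (simp add: ennreal_less_iff)
      then have "T n w < ennreal (t n + e)" by (simp add: t)
      then obtain q where q: "q \<in> \<rat>" "0 \<le> q" "q < t n + e" "y q w \<notin> C n" by (auto simp: T_less)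
      have "T n w \<le> ennreal q" unfolding T_def using q by (intro Inf_lower) auto
      then have "t n \<le> q" using t q by simp
      then show False using e(2) q interior_subset by blast
    qed
    then have L: "lifetime S X w \<le> (SUP n. T n w)" by simp
    show ?case
    proof (intro allI impI)
      fix s assume s: "0 \<le> s" "y s w \<in> G"
      have "ennreal s < lifetime S X w"
        using less_lifetime_iff[where Z=X and w=w, OF killed_rc_X[OF w] s(1)] s by (simp add: y_alive)
      then have "ennreal s < (SUP n. T n w)" using L by simp
      then obtain n where n: "ennreal s < T n w" by (auto simp: less_SUP_iff)
      have "y u w \<in> C n" if u: "0 \<le> u" "u \<le> s" for u
      proof -
        have "ennreal u < T n w" using order_le_less_trans[OF ennreal_leI[OF u(2)] n] .
        then obtain r where r: "ennreal u < r" "r < T n w" using dense by blast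
        then obtain r' where r': "r = ennreal r'" "0 \<le> r'" by (cases r) auto
        have "u < r'" using r r' u by (simp add: ennreal_less_iff)
        have "\<forall>\<^sub>F k in sequentially. dyadic_up k u < r'"
          using filterlim_compose[OF filterlim_ident, of "\<lambda>k. dyadic_up k u"] dyadic_up_at_right[of u] \<open>u < r'\<close>
          by (auto simp: filterlim_at intro: order_tendstoD)
        moreover have "y (dyadic_up k u) w \<in> C n" if "dyadic_up k u < r'" for k
        proof (rule ccontr)
          assume "y (dyadic_up k u) w \<notin> C n"
          moreover have "dyadic_up k u \<in> \<rat>" "0 \<le> dyadic_up k u"
            using dyadic_up_gt[of u k] u by (auto simp: dyadic_up_def)
          ultimately have "T n w < ennreal r'" unfolding T_less using that by blast
          then show False using r r' by simp
        qed
        ultimately have "\<forall>\<^sub>F k in sequentially. y (dyadic_up k u) w \<in> C n" by (rule eventually_mono) auto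
        then show ?thesis
          using Lim_in_closed_set[OF compact_imp_closed[OF C(1)] _ _ rc_path_dyadic_tendsto[OF rc u(1)]] by simp
      qed
      then show "\<exists>C. compact C \<and> C \<subseteq> G \<and> (\<forall>u. 0 \<le> u \<and> u \<le> s \<longrightarrow> y u w \<in> C)"
        using C by blast
    qed
  qed
qed

text \<open>On a compact subset of \<open>G\<close> the function \<open>c\<close> is bounded, so by
  \<open>AE_compact_range\<close> the clock is finite as long as the path lives.\<close>

lemma AE_finite_clock:
  assumes x: "x \<in> E_space S"
  shows "AE w in P x. inverted_finite_path G c J (\<lambda>t. y t w)"
  using AE_compact_range[OF x] AE_space
proof eventually_elim
  case (elim w)
  then have w: "w \<in> space M" using x by simp
  interpret killed_path G c "\<lambda>t. y t w" using killed_path_y[OF w] .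
  show ?case
  proof
    fix s assume s: "0 \<le> s" "y s w \<in> G"
    then obtain C where C: "compact C" "C \<subseteq> G" "\<forall>u. 0 \<le> u \<and> u \<le> s \<longrightarrow> y u w \<in> C" using elim by blast
    then show "path_clock c (\<lambda>t. y t w) s < \<infinity>"
      using s by (intro path_clock_finite_on_compact[OF w C(1,2)]) auto
  qed
qed

end

lemma last_sorted_list_of_set:
  fixes K :: "'b::linorder set"
  assumes "finite K" "K \<noteq> {}"
  shows "last (sorted_list_of_set K) = Max K"
proof (rule Max_eqI[symmetric])
  have ne: "sorted_list_of_set K \<noteq> []" using assms by simp
  show "last (sorted_list_of_set K) \<in> K" using last_in_set[OF ne] assms by simp
  fix k assume "k \<in> K"
  then have "k \<in> set (sorted_list_of_set K)" using assms by simp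
  then obtain i where i: "i < length (sorted_list_of_set K)" "sorted_list_of_set K ! i = k" by (auto simp: in_set_conv_nth)
  have "sorted_list_of_set K ! i \<le> sorted_list_of_set K ! (length (sorted_list_of_set K) - 1)"
    using i by (intro sorted_nth_mono) auto
  then show "k \<le> last (sorted_list_of_set K)" using i ne by (simp add: last_conv_nth)
qed (use assms in simp)

section \<open>The inverted path and its law\<close>

context inversion_process
begin

text \<open>The inverted path of the inversion property in Euclidean coordinates, with value
  \<open>0\<close> once the clock has run out.\<close>

definition W :: "real \<Rightarrow> 'w \<Rightarrow> 'a" where "W t w = time_changed c J (\<lambda>s. y s w) t"

definition H :: "'a \<Rightarrow> ennreal" where "H u = (if u \<in> G then h (Some u) else 0)"

lemma H_measurable [measurable]: "H \<in> borel_measurable borel"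
  unfolding H_def G_def by (rule measurable_on_alive) measurable

lemma H_pos: "u \<in> G \<Longrightarrow> 0 < H u" and H_finite: "u \<in> G \<Longrightarrow> H u < \<infinity>"
  using h_pos[of "Some u"] by (auto simp: H_def G_def)

lemma H_y: "X t w \<in> E_int S \<Longrightarrow> H (y t w) = h (X t w)"
  using Some_y y_alive by (simp add: H_def)

lemma W_measurable: "0 \<le> t \<Longrightarrow> W t \<in> borel_measurable M"
  unfolding W_def[abs_def] using y_measurable rc_y by (rule time_changed_rc_measurable)

lemma W_measurable_P: "0 \<le> t \<Longrightarrow> x \<in> E_space S \<Longrightarrow> W t \<in> borel_measurable (P x)"
  using W_measurable measurable_cong_sets[OF sets_P refl] by blast

lemma rc_W: "w \<in> space M \<Longrightarrow> rc_path G (\<lambda>t. W t w)"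
proof -
  assume w: "w \<in> space M"
  interpret killed_path G c "\<lambda>t. y t w" using killed_path_y[OF w] .
  interpret inverted_path G c J "\<lambda>t. y t w" by unfold_locales
  show ?thesis unfolding W_def by (rule rc_time_changed)
qed

lemma rc_path_range: "rc_path G z \<Longrightarrow> 0 \<le> t \<Longrightarrow> z t \<in> insert 0 G"
  unfolding rc_path_def by auto

lemma W_range: "w \<in> space M \<Longrightarrow> 0 \<le> t \<Longrightarrow> W t w \<in> insert 0 G"
  using rc_path_range[OF rc_W] .

lemma rc_path_alive_before:
  assumes "rc_path G z" "0 \<le> s" "s \<le> t" "z t \<in> G"
  shows "z s \<in> G"
proof -
  interpret killed_path G c z using assms(1) by unfold_locales
  show ?thesis using alive_before assms by blast
qed

lemma W_event:
  assumes "w \<in> space M" "0 \<le> t"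
  shows "ennreal t < clock S v X \<infinity> w \<and> I (X (time_change S v X t w) w) \<in> B \<longleftrightarrow> W t w \<in> {x \<in> G. Some x \<in> B}"
  using time_changed_event[where Z=X and w=w and I=I and J=J and B=B, OF v_continuous v_pos killed_rc_X[OF assms(1)] I_E_int assms(2)]
  by (simp add: W_def c_def G_def y_def[abs_def] J_def)

definition cylinder_list :: "real set \<Rightarrow> (real \<Rightarrow> 'a set) \<Rightarrow> (real \<times> 'a option set) list" where
  "cylinder_list K A = map (\<lambda>i. (i, Some ` A i)) (sorted_list_of_set K)"

context
  fixes K :: "real set" and A :: "real \<Rightarrow> 'a set"
  assumes K: "finite K" "K \<subseteq> {0..}" and A: "\<And>i. i \<in> K \<Longrightarrow> A i \<in> sets borel \<and> A i \<subseteq> G"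
begin

lemma fst_cylinder_list: "map fst (cylinder_list K A) = sorted_list_of_set K"
  by (simp add: cylinder_list_def o_def)

lemma set_cylinder_list: "set (cylinder_list K A) = (\<lambda>i. (i, Some ` A i)) ` K"
  using K by (simp add: cylinder_list_def)

lemma cylinder_list:
  "sorted_wrt (<) (map fst (cylinder_list K A))"
  "(t, B) \<in> set (cylinder_list K A) \<Longrightarrow> 0 \<le> t \<and> B \<in> sets (E_borel S)"
  using K A Some_image_sets[of _ S] unfolding fst_cylinder_list set_cylinder_list
  by (auto simp: G_def subset_iff)

lemma cylinder_event_X: "(\<forall>(t, B)\<in>set (cylinder_list K A). X t w \<in> B \<inter> E_int S) \<longleftrightarrow> (\<forall>i\<in>K. y i w \<in> A i)"
proof -
  have "X i w \<in> Some ` A i \<inter> E_int S \<longleftrightarrow> y i w \<in> A i" if "i \<in> K" for i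
  proof
    assume "y i w \<in> A i"
    then have "X i w \<in> E_int S" using A[OF that] y_alive by blast
    then show "X i w \<in> Some ` A i \<inter> E_int S" using Some_y[of i w] \<open>y i w \<in> A i\<close> by (metis IntI imageI)
  next
    assume "X i w \<in> Some ` A i \<inter> E_int S"
    then show "y i w \<in> A i" using A[OF that] by (auto simp: y_def G_def)
  qed
  then show ?thesis unfolding set_cylinder_list by auto
qed

lemma W_cylinder_fdd:
  assumes x: "x \<in> G"
  shows "emeasure (P (Some x)) {w \<in> space M. \<forall>i\<in>K. W i w \<in> A i} = fdd (doob_kernel S P X h) (Some (J x)) 0 (cylinder_list K A)"
proof -
  have xE: "Some x \<in> E_space S" using Some_G_space[OF x] .
  let ?l = "cylinder_list K A"
  have "{w \<in> space M. \<forall>i\<in>K. W i w \<in> A i} =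
      {w \<in> space (P (Some x)). \<forall>(t, B)\<in>set ?l. ennreal t < clock S v X \<infinity> w \<and> I (X (time_change S v X t w) w) \<in> B}"
  proof -
    have "(\<forall>(t, B)\<in>set ?l. ennreal t < clock S v X \<infinity> w \<and> I (X (time_change S v X t w) w) \<in> B) \<longleftrightarrow> (\<forall>i\<in>K. W i w \<in> A i)"
      if w: "w \<in> space M" for w
    proof -
      have "(\<forall>(t, B)\<in>set ?l. ennreal t < clock S v X \<infinity> w \<and> I (X (time_change S v X t w) w) \<in> B) \<longleftrightarrow>
          (\<forall>i\<in>K. W i w \<in> {x \<in> G. Some x \<in> Some ` A i})"
        unfolding set_cylinder_list using W_event[OF w] K(2) by (auto simp: subset_iff)
      also have "\<dots> \<longleftrightarrow> (\<forall>i\<in>K. W i w \<in> A i)" using A by blast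
      finally show ?thesis .
    qed
    then show ?thesis using xE by auto
  qed
  then have "emeasure (P (Some x)) {w \<in> space M. \<forall>i\<in>K. W i w \<in> A i} = fdd (doob_kernel S P X h) (I (Some x)) 0 ?l"
    using IP_law[OF xE] cylinder_list unfolding has_law_def by auto
  then show ?thesis using Some_J[OF x] by simp
qed

text \<open>The inversion property at \<open>x\<close> identifies the cylinder with an
  \<open>fdd\<close> of the Doob transform started at \<open>J x\<close>, and
  \<open>fdd_doob\<close> expresses that through \<open>X\<close>; multiplying by
  \<open>H (J x)\<close> clears the denominator.\<close>

lemma W_cylinder:
  assumes x: "x \<in> G" and ne: "K \<noteq> {}"
  shows "H (J x) * emeasure (P (Some x)) {w \<in> space M. \<forall>i\<in>K. W i w \<in> A i} =
    (\<integral>\<^sup>+w. indicator {w \<in> space M. \<forall>i\<in>K. y i w \<in> A i} w * h (X (Max K) w) \<partial>P (Some (J x)))"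
proof -
  have "h (Some (J x)) * fdd (doob_kernel S P X h) (Some (J x)) 0 (cylinder_list K A) =
     (\<integral>\<^sup>+w. indicator {w \<in> space M. \<forall>(t, B)\<in>set (cylinder_list K A). X t w \<in> B \<inter> E_int S} w * h (X (last (map fst (cylinder_list K A))) w) \<partial>P (Some (J x)))"
    using cylinder_list ne K J_in[OF x] h_pos by (intro fdd_doob) (auto simp: G_def cylinder_list_def)
  then show ?thesis
    using J_in[OF x] unfolding cylinder_event_X fst_cylinder_list last_sorted_list_of_set[OF K(1) ne] W_cylinder_fdd[OF x]
    by (simp add: H_def)
qed

end

text \<open>On survival up to \<open>t\<close>, the Doob transform has density
  \<open>H (y t w) / H (J x)\<close> with respect to \<open>X\<close>. Comparing the finite measures
  \<open>N1\<close> and \<open>N2\<close> on cylinders carries this from finitely many times to all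
  path functionals up to \<open>t\<close>.\<close>

lemma nn_integral_W:
  assumes x: "x \<in> G" and t: "0 \<le> t" and \<Phi>: "\<Phi> \<in> borel_measurable (PiM {0..t} (\<lambda>_. borel))"
  shows "H (J x) * (\<integral>\<^sup>+w. indicator G (W t w) * \<Phi> (\<lambda>u\<in>{0..t}. W u w) \<partial>P (Some x)) =
    (\<integral>\<^sup>+w. H (y t w) * \<Phi> (\<lambda>u\<in>{0..t}. y u w) \<partial>P (Some (J x)))"
proof -
  have xE: "Some x \<in> E_space S" "Some (J x) \<in> E_space S" using Some_G_space x J_in by auto
  interpret Px: prob_space "P (Some x)" using prob_P xE by auto
  have G[measurable]: "G \<in> sets borel" using open_G by auto
  have mW[measurable]: "W u \<in> borel_measurable (P (Some x))" if "u \<in> {0..t}" for u using W_measurable_P xE that by auto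
  have my[measurable]: "y u \<in> borel_measurable (P (Some (J x)))" if "u \<in> {0..t}" for u using y_measurable_P xE that by auto
  have [measurable]: "W t \<in> borel_measurable (P (Some x))" "y t \<in> borel_measurable (P (Some (J x)))" using mW my t by auto
  define N1 where "N1 = density (P (Some x)) (\<lambda>w. H (J x) * indicator G (W t w))"
  define N2 where "N2 = density (P (Some (J x))) (\<lambda>w. H (y t w))"
  have sp: "space N1 = space M" "space N2 = space M" using xE by (simp_all add: N1_def N2_def)
  have cyl: "emeasure N1 {w \<in> space N1. \<forall>i\<in>K. W i w \<in> A i} = emeasure N2 {w \<in> space N2. \<forall>i\<in>K. y i w \<in> A i}"
    if K: "finite K" "K \<subseteq> {0..t}" and A: "\<And>i. i \<in> K \<Longrightarrow> A i \<in> sets borel \<and> A i \<subseteq> G" for K A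
  proof -
    \<comment> \<open>Adjoining \<open>t\<close> with target \<open>G\<close> makes \<open>t\<close>
      the last time and demands survival up to it, as \<open>N1\<close> and \<open>N2\<close> both
      do; a constraint at \<open>t\<close> already present is kept.\<close>
    define A' where "A' i = (if i \<in> K then A i else G)" for i
    have A': "A' i \<in> sets borel \<and> A' i \<subseteq> G" for i using A G by (auto simp: A'_def)
    have Mx: "Max (insert t K) = t" using K t by (intro Max_eqI) auto
    have m1: "{w \<in> space M. \<forall>i\<in>K. W i w \<in> A i} \<in> sets (P (Some x))"
      using K A mW xE by (subst space_P[OF xE(1), symmetric]) (intro sets.sets_Collect_finite_All measurable_sets_Collect[OF mW]; auto)
    have m2: "{w \<in> space M. \<forall>i\<in>K. y i w \<in> A i} \<in> sets (P (Some (J x)))"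
      using K A my xE by (subst space_P[OF xE(2), symmetric]) (intro sets.sets_Collect_finite_All measurable_sets_Collect[OF my]; auto)
    have m3: "{w \<in> space M. \<forall>i\<in>insert t K. W i w \<in> A' i} \<in> sets (P (Some x))"
      using K A' mW xE t by (subst space_P[OF xE(1), symmetric]) (intro sets.sets_Collect_finite_All measurable_sets_Collect[OF mW]; auto)
    have "emeasure N1 {w \<in> space N1. \<forall>i\<in>K. W i w \<in> A i} =
        (\<integral>\<^sup>+w. H (J x) * indicator G (W t w) * indicator {w \<in> space M. \<forall>i\<in>K. W i w \<in> A i} w \<partial>P (Some x))"
      unfolding sp unfolding N1_def using m1 by (subst emeasure_density) auto
    also have "\<dots> = (\<integral>\<^sup>+w. H (J x) * indicator {w \<in> space M. \<forall>i\<in>insert t K. W i w \<in> A' i} w \<partial>P (Some x))"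
      using A by (intro nn_integral_cong) (auto simp: A'_def indicator_def)
    also have "\<dots> = H (J x) * emeasure (P (Some x)) {w \<in> space M. \<forall>i\<in>insert t K. W i w \<in> A' i}"
      using m3 by (rule nn_integral_cmult_indicator)
    also have "\<dots> = (\<integral>\<^sup>+w. indicator {w \<in> space M. \<forall>i\<in>insert t K. y i w \<in> A' i} w * h (X (Max (insert t K)) w) \<partial>P (Some (J x)))"
      using x K t A' by (intro W_cylinder) auto
    also have "\<dots> = (\<integral>\<^sup>+w. H (y t w) * indicator {w \<in> space M. \<forall>i\<in>K. y i w \<in> A i} w \<partial>P (Some (J x)))"
    proof (rule nn_integral_cong)
      fix w
      show "indicator {w \<in> space M. \<forall>i\<in>insert t K. y i w \<in> A' i} w * h (X (Max (insert t K)) w) =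
         H (y t w) * indicator {w \<in> space M. \<forall>i\<in>K. y i w \<in> A i} w"
      proof (cases "y t w \<in> G")
        case True
        then show ?thesis using H_y[of t w] A unfolding Mx by (auto simp: A'_def indicator_def y_alive)
      next
        case False
        then show ?thesis using A'[of t] by (auto simp: H_def indicator_def)
      qed
    qed
    also have "\<dots> = emeasure N2 {w \<in> space N2. \<forall>i\<in>K. y i w \<in> A i}"
      unfolding sp unfolding N2_def using m2 by (subst emeasure_density) auto
    finally show ?thesis .
  qed
  have fin1: "finite_measure N1"
  proof (rule finite_measureI)
    have "emeasure N1 (space N1) = (\<integral>\<^sup>+w. H (J x) * indicator G (W t w) * indicator (space (P (Some x))) w \<partial>P (Some x))"
      unfolding N1_def space_density by (rule emeasure_density) auto
    also have "\<dots> \<le> (\<integral>\<^sup>+w. H (J x) \<partial>P (Some x))" by (intro nn_integral_mono) (auto simp: indicator_def)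
    also have "\<dots> < \<infinity>" using H_finite[OF J_in[OF x]] by (simp add: Px.emeasure_space_1)
    finally show "emeasure N1 (space N1) \<noteq> \<infinity>" by simp
  qed
  have fin2: "finite_measure N2"
  proof (rule finite_measureI)
    \<comment> \<open>The cylinder without constraints compares the total masses.\<close>
    have "emeasure N1 {w \<in> space N1. \<forall>i\<in>{}. W i w \<in> {}} = emeasure N2 {w \<in> space N2. \<forall>i\<in>{}. y i w \<in> {}}"
      by (rule cyl) auto
    then show "emeasure N2 (space N2) \<noteq> \<infinity>"
      using finite_measure.emeasure_finite[OF fin1, of "space N1"] by simp
  qed
  have eq: "distr N1 (PiM {0..t} (\<lambda>_. borel)) (\<lambda>w. \<lambda>i\<in>{0..t}. W i w) = distr N2 (PiM {0..t} (\<lambda>_. borel)) (\<lambda>w. \<lambda>i\<in>{0..t}. y i w)"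
  proof (rule distr_eq_of_alive_cylinders[OF fin1 fin2 G zero_G])
    show "W i \<in> borel_measurable N1" "y i \<in> borel_measurable N2" if "i \<in> {0..t}" for i
      using mW[OF that] my[OF that] by (simp_all add: N1_def N2_def)
    show "W i w \<in> insert 0 G" if "i \<in> {0..t}" "w \<in> space N1" for i w using W_range that sp by auto
    show "y i w \<in> insert 0 G" if "i \<in> {0..t}" "w \<in> space N2" for i w
      using rc_path_range[OF rc_y] that sp by auto
  qed (rule cyl)
  have r1: "(\<lambda>w. \<lambda>i\<in>{0..t}. W i w) \<in> measurable (P (Some x)) (PiM {0..t} (\<lambda>_. borel))"
    using mW by (rule measurable_restrict)
  have r2: "(\<lambda>w. \<lambda>i\<in>{0..t}. y i w) \<in> measurable (P (Some (J x))) (PiM {0..t} (\<lambda>_. borel))"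
    using my by (rule measurable_restrict)
  note [measurable] = measurable_compose[OF r1 \<Phi>] measurable_compose[OF r2 \<Phi>]
  have "(\<integral>\<^sup>+\<eta>. \<Phi> \<eta> \<partial>distr N1 (PiM {0..t} (\<lambda>_. borel)) (\<lambda>w. \<lambda>i\<in>{0..t}. W i w)) = (\<integral>\<^sup>+w. H (J x) * (indicator G (W t w) * \<Phi> (\<lambda>u\<in>{0..t}. W u w)) \<partial>P (Some x))"
    using r1 \<Phi> by (subst nn_integral_distr) (simp_all add: N1_def nn_integral_density mult.assoc)
  moreover have "(\<integral>\<^sup>+\<eta>. \<Phi> \<eta> \<partial>distr N2 (PiM {0..t} (\<lambda>_. borel)) (\<lambda>w. \<lambda>i\<in>{0..t}. y i w)) = (\<integral>\<^sup>+w. H (y t w) * \<Phi> (\<lambda>u\<in>{0..t}. y u w) \<partial>P (Some (J x)))"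
    using r2 \<Phi> by (subst nn_integral_distr) (simp_all add: N2_def nn_integral_density)
  ultimately show ?thesis
    unfolding eq[symmetric] by (subst nn_integral_cmult[symmetric]) simp_all
qed

end

section \<open>Green functionals\<close>

context inversion_process
begin

text \<open>Every time before \<open>t\<close> is a limit from the right of rational times before
  \<open>t\<close>, and \<open>B\<close> is closed. The endpoint is tested separately, its
  approximations from the right lying beyond \<open>t\<close>.\<close>

lemma stays_iff_rational:
  assumes rc: "rc_path G z" and B: "closed B" "B \<subseteq> G" and t: "0 \<le> t"
  shows "stays B z t \<longleftrightarrow> z t \<in> B \<and> (\<forall>q\<in>\<rat>. 0 \<le> q \<and> q < t \<longrightarrow> z q \<in> B)"
proof
  assume *: "z t \<in> B \<and> (\<forall>q\<in>\<rat>. 0 \<le> q \<and> q < t \<longrightarrow> z q \<in> B)"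
  show "stays B z t"
    unfolding stays_def
  proof
    fix u assume u: "u \<in> {0..t}"
    show "z u \<in> B"
    proof (cases "u = t")
      case False
      then have "u < t" using u by simp
      have "(\<lambda>n. dyadic_up n u) \<longlonglongrightarrow> u" using dyadic_up_at_right[of u] by (simp add: filterlim_at)
      then have "\<forall>\<^sub>F n in sequentially. dyadic_up n u < t" using \<open>u < t\<close> by (rule order_tendstoD)
      then have "\<forall>\<^sub>F n in sequentially. z (dyadic_up n u) \<in> B"
      proof eventually_elim
        case (elim n)
        have "dyadic_up n u \<in> \<rat>" "0 \<le> dyadic_up n u" using dyadic_up_gt[of u n] u by (auto simp: dyadic_up_def)
        then show ?case using * elim by blast
      qed
      then show ?thesis
        using Lim_in_closed_set[OF B(1) _ _ rc_path_dyadic_tendsto[OF rc, of u]] u by simp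
    qed (use * in simp)
  qed
qed (use t in \<open>auto simp: stays_def\<close>)

lemma stays_jointly_measurable:
  assumes z: "\<And>t. 0 \<le> t \<Longrightarrow> z t \<in> borel_measurable N" "\<And>w. w \<in> space N \<Longrightarrow> rc_path G (\<lambda>t. z t w)"
    and B: "closed B" "B \<subseteq> G" and f: "f \<in> borel_measurable borel"
  shows "(\<lambda>(w, s). indicator {s. 0 \<le> s \<and> stays B (\<lambda>u. z u w) s} s * (f (z s w) :: ennreal)) \<in> borel_measurable (N \<Otimes>\<^sub>M borel)"
proof -
  have [measurable]: "B \<in> sets borel" using B by simp
  have [measurable]: "(\<lambda>x. if 0 \<le> snd x then z (snd x) (fst x) else 0) \<in> borel_measurable (N \<Otimes>\<^sub>M borel)"
    using rc_process_jointly_measurable[OF z] by (simp add: case_prod_beta)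
  have [measurable]: "(\<lambda>x. z q (fst x)) \<in> borel_measurable (N \<Otimes>\<^sub>M borel)" if "q \<in> \<rat> \<inter> {0..}" for q :: real
    using z(1)[of q] that by (intro measurable_compose[OF measurable_fst]) auto
  have "Measurable.pred (N \<Otimes>\<^sub>M (borel :: real measure)) (\<lambda>x. \<forall>q\<in>\<rat> \<inter> {0..}. q < snd x \<longrightarrow> z q (fst x) \<in> B)"
    by (rule measurable_pred_countable) (auto intro!: countable_Int1 countable_rat)
  then have [measurable]: "{x \<in> space (N \<Otimes>\<^sub>M (borel :: real measure)). \<forall>q\<in>\<rat> \<inter> {0..}. q < snd x \<longrightarrow> z q (fst x) \<in> B} \<in> sets (N \<Otimes>\<^sub>M borel)"
    by (simp add: pred_def)
  note [measurable] = f
  have "(\<lambda>x. indicator {x \<in> space (N \<Otimes>\<^sub>M (borel :: real measure)). \<forall>q\<in>\<rat> \<inter> {0..}. q < snd x \<longrightarrow> z q (fst x) \<in> B} x *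
      (indicator {0..} (snd x) * (indicator B (if 0 \<le> snd x then z (snd x) (fst x) else 0) * f (if 0 \<le> snd x then z (snd x) (fst x) else 0))))
      \<in> borel_measurable (N \<Otimes>\<^sub>M borel)"
    by measurable
  then show ?thesis
  proof (rule measurable_cong[THEN iffD1, rotated])
    fix x assume x: "x \<in> space (N \<Otimes>\<^sub>M (borel :: real measure))"
    then have "rc_path G (\<lambda>t. z t (fst x))" using z(2) by (auto simp: space_pair_measure)
    from stays_iff_rational[OF this B, of "snd x"] x
    show "indicator {x \<in> space (N \<Otimes>\<^sub>M (borel :: real measure)). \<forall>q\<in>\<rat> \<inter> {0..}. q < snd x \<longrightarrow> z q (fst x) \<in> B} x *
      (indicator {0..} (snd x) * (indicator B (if 0 \<le> snd x then z (snd x) (fst x) else 0) * f (if 0 \<le> snd x then z (snd x) (fst x) else 0))) =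
      (case x of (w, s) \<Rightarrow> indicator {s. 0 \<le> s \<and> stays B (\<lambda>u. z u w) s} s * f (z s w))"
      by (cases x) (auto simp: indicator_def)
  qed
qed

lemma y_measurable_Some: "0 \<le> t \<Longrightarrow> x \<in> G \<Longrightarrow> y t \<in> borel_measurable (P (Some x))"
  and W_measurable_Some: "0 \<le> t \<Longrightarrow> x \<in> G \<Longrightarrow> W t \<in> borel_measurable (P (Some x))"
  using y_measurable_P W_measurable_P Some_G_space by auto

lemma space_Some [simp]: "x \<in> G \<Longrightarrow> space (P (Some x)) = space M"
  using Some_G_space by simp

lemma sigma_finite_P: "x \<in> G \<Longrightarrow> pair_sigma_finite (P (Some x)) (lborel :: real measure)"
proof -
  assume "x \<in> G"
  then interpret prob_space "P (Some x)" using prob_P Some_G_space by blast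
  show ?thesis by unfold_locales
qed

text \<open>The Green functional of the process killed on leaving \<open>B\<close>. Contrary to the semigroup, it
  transforms under a time change by a mere factor in the integrand.\<close>

definition green :: "'a set \<Rightarrow> ('a \<Rightarrow> ennreal) \<Rightarrow> 'a \<Rightarrow> ennreal" where
  "green B f x = (\<integral>\<^sup>+w. \<integral>\<^sup>+s. indicator {s. 0 \<le> s \<and> stays B (\<lambda>u. y u w) s} s * f (y s w) \<partial>lborel \<partial>P (Some x))"

lemma green_cong: "(\<And>u. u \<in> B \<Longrightarrow> f u = g u) \<Longrightarrow> green B f x = green B g x"
  unfolding green_def by (intro nn_integral_cong) (auto simp: indicator_def stays_def)

text \<open>Tonelli; joint measurability comes from the rational description of staying in a closed
  set.\<close>

lemma nn_integral_stays_swap: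
  assumes z: "\<And>t. 0 \<le> t \<Longrightarrow> z t \<in> borel_measurable (P (Some x))" "\<And>w. w \<in> space M \<Longrightarrow> rc_path G (\<lambda>t. z t w)"
    and x: "x \<in> G" and B: "closed B" "B \<subseteq> G" and f: "f \<in> borel_measurable borel"
  shows "(\<integral>\<^sup>+w. \<integral>\<^sup>+s. indicator {s. 0 \<le> s \<and> stays B (\<lambda>u. z u w) s} s * (f (z s w) :: ennreal) \<partial>lborel \<partial>P (Some x)) =
    (\<integral>\<^sup>+s. indicator {0..} s * (\<integral>\<^sup>+w. indicator {w. stays B (\<lambda>u. z u w) s} w * f (z s w) \<partial>P (Some x)) \<partial>lborel)"
proof -
  interpret pair_sigma_finite "P (Some x)" "lborel :: real measure" using sigma_finite_P[OF x] .
  have m: "(\<lambda>(w, s). indicator {s. 0 \<le> s \<and> stays B (\<lambda>u. z u w) s} s * f (z s w)) \<in> borel_measurable (P (Some x) \<Otimes>\<^sub>M lborel)"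
    using stays_jointly_measurable[where N="P (Some x)", OF z(1) _ B f] z(2) x by simp
  have "(\<integral>\<^sup>+w. \<integral>\<^sup>+s. indicator {s. 0 \<le> s \<and> stays B (\<lambda>u. z u w) s} s * f (z s w) \<partial>lborel \<partial>P (Some x)) =
      (\<integral>\<^sup>+s. \<integral>\<^sup>+w. indicator {s. 0 \<le> s \<and> stays B (\<lambda>u. z u w) s} s * f (z s w) \<partial>P (Some x) \<partial>lborel)"
    using Fubini'[OF m] by simp
  also have "\<dots> = (\<integral>\<^sup>+s. indicator {0..} s * (\<integral>\<^sup>+w. indicator {w. stays B (\<lambda>u. z u w) s} w * f (z s w) \<partial>P (Some x)) \<partial>lborel)"
  proof (rule nn_integral_cong)
    fix s :: real
    show "(\<integral>\<^sup>+w. indicator {s. 0 \<le> s \<and> stays B (\<lambda>u. z u w) s} s * f (z s w) \<partial>P (Some x)) =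
      indicator {0..} s * (\<integral>\<^sup>+w. indicator {w. stays B (\<lambda>u. z u w) s} w * f (z s w) \<partial>P (Some x))"
      by (cases "0 \<le> s") (auto intro!: nn_integral_cong simp: indicator_def)
  qed
  finally show ?thesis .
qed

lemma compact_JB: "compact B \<Longrightarrow> B \<subseteq> G \<Longrightarrow> compact (J ` B)"
  by (rule compact_continuous_image[OF continuous_on_subset[OF J_continuous]])

text \<open>Substitution turns the integral along \<open>y\<close> into one along \<open>W\<close>;
  at each fixed time \<open>nn_integral_W\<close> then replaces \<open>W\<close> from
  \<open>x\<close> by \<open>y\<close> from \<open>J x\<close>, leaving the density
  \<open>H\<close>.\<close>

lemma green_inversion:
  assumes x: "x \<in> G" and B: "compact B" "B \<subseteq> G" and f[measurable]: "f \<in> borel_measurable borel"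
  shows "H (J x) * green B (\<lambda>u. f (J u) * c u) x = green (J ` B) (\<lambda>u. f u * H u) (J x)"
proof -
  have JB: "closed (J ` B)" "J ` B \<subseteq> G" using compact_JB[OF B] B J_in by (auto simp: compact_imp_closed)
  have xE: "Some x \<in> E_space S" using Some_G_space[OF x] .
  have "green B (\<lambda>u. f (J u) * c u) x =
     (\<integral>\<^sup>+w. \<integral>\<^sup>+s. indicator {s. 0 \<le> s \<and> stays (J ` B) (\<lambda>u. W u w) s} s * f (W s w) \<partial>lborel \<partial>P (Some x))"
    unfolding green_def
  proof (rule nn_integral_cong_AE)
    show "AE w in P (Some x). (\<integral>\<^sup>+s. indicator {s. 0 \<le> s \<and> stays B (\<lambda>u. y u w) s} s * (f (J (y s w)) * c (y s w)) \<partial>lborel) =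
       (\<integral>\<^sup>+s. indicator {s. 0 \<le> s \<and> stays (J ` B) (\<lambda>u. W u w) s} s * f (W s w) \<partial>lborel)"
      using AE_finite_clock[OF xE]
    proof eventually_elim
      case (elim w)
      then interpret inverted_finite_path G c J "\<lambda>t. y t w" .
      show ?case using nn_integral_stays_time_changed[OF f B(2)] by (simp add: W_def[abs_def])
    qed
  qed
  also have "\<dots> = (\<integral>\<^sup>+s. indicator {0..} s * (\<integral>\<^sup>+w. indicator {w. stays (J ` B) (\<lambda>u. W u w) s} w * f (W s w) \<partial>P (Some x)) \<partial>lborel)"
    using W_measurable_Some rc_W x JB f by (intro nn_integral_stays_swap) auto
  finally have *: "H (J x) * green B (\<lambda>u. f (J u) * c u) x =
      H (J x) * (\<integral>\<^sup>+s. indicator {0..} s * (\<integral>\<^sup>+w. indicator {w. stays (J ` B) (\<lambda>u. W u w) s} w * f (W s w) \<partial>P (Some x)) \<partial>lborel)"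
    by simp
  have step: "H (J x) * (\<integral>\<^sup>+w. indicator {w. stays (J ` B) (\<lambda>u. W u w) s} w * f (W s w) \<partial>P (Some x)) =
      (\<integral>\<^sup>+w. indicator {w. stays (J ` B) (\<lambda>u. y u w) s} w * (f (y s w) * H (y s w)) \<partial>P (Some (J x)))"
    if s: "0 \<le> s" for s
  proof -
    let ?P = "PiM {0..s} (\<lambda>_. borel :: 'a measure)"
    \<comment> \<open>Staying in the image of \<open>B\<close> up to \<open>s\<close>, together with
      the value of \<open>f\<close> at \<open>s\<close>, as a functional of countably many
      coordinates.\<close>
    define \<Phi> :: "(real \<Rightarrow> 'a) \<Rightarrow> ennreal" where
      "\<Phi> \<eta> = indicator {\<eta> \<in> space ?P. \<forall>q\<in>\<rat> \<inter> {0..<s}. \<eta> q \<in> J ` B} \<eta> * (indicator (J ` B) (\<eta> s) * f (\<eta> s))" for \<eta>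
    have comp: "(\<lambda>\<eta>. \<eta> q) \<in> borel_measurable ?P" if "q \<in> {0..s}" for q
      using that by (rule measurable_component_singleton)
    have [measurable]: "J ` B \<in> sets borel" using JB by simp
    have [measurable]: "(\<lambda>\<eta>. \<eta> s) \<in> borel_measurable ?P" using comp s by simp
    have "{\<eta> \<in> space ?P. \<forall>q\<in>\<rat> \<inter> {0..<s}. \<eta> q \<in> J ` B} \<in> sets ?P"
      using JB by (intro sets.sets_Collect_countable_All' countable_Int1 countable_rat measurable_sets_Collect[OF comp]) auto
    then have [measurable]: "\<Phi> \<in> borel_measurable ?P" unfolding \<Phi>_def[abs_def] by measurable
    have \<Phi>: "\<Phi> (\<lambda>u\<in>{0..s}. z u) = indicator {z. stays (J ` B) z s} z * f (z s)" if "rc_path G z" for z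
    proof -
      have "(\<lambda>u\<in>{0..s}. z u) \<in> space ?P" by (simp add: space_PiM)
      then have "\<Phi> (\<lambda>u\<in>{0..s}. z u) = (if z s \<in> J ` B \<and> (\<forall>q\<in>\<rat>. 0 \<le> q \<and> q < s \<longrightarrow> z q \<in> J ` B) then f (z s) else 0)"
        using s by (auto simp: \<Phi>_def indicator_def)
      then show ?thesis using stays_iff_rational[OF that JB s] by (simp add: indicator_def)
    qed
    have "(\<integral>\<^sup>+w. indicator {w. stays (J ` B) (\<lambda>u. W u w) s} w * f (W s w) \<partial>P (Some x)) =
        (\<integral>\<^sup>+w. indicator G (W s w) * \<Phi> (\<lambda>u\<in>{0..s}. W u w) \<partial>P (Some x))"
    proof (rule nn_integral_cong)
      fix w assume "w \<in> space (P (Some x))"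
      then have "\<Phi> (\<lambda>u\<in>{0..s}. W u w) = indicator {z. stays (J ` B) z s} (\<lambda>u. W u w) * f (W s w)"
        using x by (intro \<Phi> rc_W) simp
      then show "indicator {w. stays (J ` B) (\<lambda>u. W u w) s} w * f (W s w) = indicator G (W s w) * \<Phi> (\<lambda>u\<in>{0..s}. W u w)"
        using JB s by (auto simp: indicator_def stays_def intro!: bexI[of _ s])
    qed
    also have "H (J x) * \<dots> = (\<integral>\<^sup>+w. H (y s w) * \<Phi> (\<lambda>u\<in>{0..s}. y u w) \<partial>P (Some (J x)))"
      using x s by (intro nn_integral_W) auto
    also have "\<dots> = (\<integral>\<^sup>+w. indicator {w. stays (J ` B) (\<lambda>u. y u w) s} w * (f (y s w) * H (y s w)) \<partial>P (Some (J x)))"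
    proof (rule nn_integral_cong)
      fix w assume "w \<in> space (P (Some (J x)))"
      then have "\<Phi> (\<lambda>u\<in>{0..s}. y u w) = indicator {z. stays (J ` B) z s} (\<lambda>u. y u w) * f (y s w)"
        using x J_in by (intro \<Phi> rc_y) simp
      then show "H (y s w) * \<Phi> (\<lambda>u\<in>{0..s}. y u w) = indicator {w. stays (J ` B) (\<lambda>u. y u w) s} w * (f (y s w) * H (y s w))"
        by (simp add: indicator_def mult.commute)
    qed
    finally show ?thesis .
  qed
  interpret pair_sigma_finite "P (Some x)" "lborel :: real measure" using sigma_finite_P[OF x] .
  have meas: "(\<lambda>s. indicator {0..} s * (\<integral>\<^sup>+w. indicator {w. stays (J ` B) (\<lambda>u. W u w) s} w * f (W s w) \<partial>P (Some x))) \<in> borel_measurable lborel"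
  proof -
    have m: "(\<lambda>(w, s). indicator {s. 0 \<le> s \<and> stays (J ` B) (\<lambda>u. W u w) s} s * f (W s w)) \<in> borel_measurable (P (Some x) \<Otimes>\<^sub>M lborel)"
      using stays_jointly_measurable[where N="P (Some x)" and z=W, OF W_measurable_Some _ JB f] rc_W x by simp
    have "(\<lambda>s. \<integral>\<^sup>+w. indicator {s. 0 \<le> s \<and> stays (J ` B) (\<lambda>u. W u w) s} s * f (W s w) \<partial>P (Some x)) \<in> borel_measurable lborel"
      using measurable_pair_swap[OF m] by (intro M1.borel_measurable_nn_integral) simp
    also have "(\<lambda>s. \<integral>\<^sup>+w. indicator {s. 0 \<le> s \<and> stays (J ` B) (\<lambda>u. W u w) s} s * f (W s w) \<partial>P (Some x)) =
       (\<lambda>s. indicator {0..} s * (\<integral>\<^sup>+w. indicator {w. stays (J ` B) (\<lambda>u. W u w) s} w * f (W s w) \<partial>P (Some x)))"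
    proof
      fix s :: real
      show "(\<integral>\<^sup>+w. indicator {s. 0 \<le> s \<and> stays (J ` B) (\<lambda>u. W u w) s} s * f (W s w) \<partial>P (Some x)) =
        indicator {0..} s * (\<integral>\<^sup>+w. indicator {w. stays (J ` B) (\<lambda>u. W u w) s} w * f (W s w) \<partial>P (Some x))"
        by (cases "0 \<le> s") (auto intro!: nn_integral_cong simp: indicator_def)
    qed
    finally show ?thesis .
  qed
  have "H (J x) * (\<integral>\<^sup>+s. indicator {0..} s * (\<integral>\<^sup>+w. indicator {w. stays (J ` B) (\<lambda>u. W u w) s} w * f (W s w) \<partial>P (Some x)) \<partial>lborel)
     = (\<integral>\<^sup>+s. H (J x) * (indicator {0..} s * (\<integral>\<^sup>+w. indicator {w. stays (J ` B) (\<lambda>u. W u w) s} w * f (W s w) \<partial>P (Some x))) \<partial>lborel)"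
    using meas by (rule nn_integral_cmult[symmetric])
  also have "\<dots> = (\<integral>\<^sup>+s. indicator {0..} s * (\<integral>\<^sup>+w. indicator {w. stays (J ` B) (\<lambda>u. y u w) s} w * (f (y s w) * H (y s w)) \<partial>P (Some (J x))) \<partial>lborel)"
  proof (rule nn_integral_cong)
    fix s :: real
    show "H (J x) * (indicator {0..} s * (\<integral>\<^sup>+w. indicator {w. stays (J ` B) (\<lambda>u. W u w) s} w * f (W s w) \<partial>P (Some x))) =
      indicator {0..} s * (\<integral>\<^sup>+w. indicator {w. stays (J ` B) (\<lambda>u. y u w) s} w * (f (y s w) * H (y s w)) \<partial>P (Some (J x)))"
      using step[of s] by (cases "0 \<le> s") auto
  qed
  also have "\<dots> = green (J ` B) (\<lambda>u. f u * H u) (J x)"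
    unfolding green_def using y_measurable_Some rc_y x J_in JB
    by (intro nn_integral_stays_swap[where f="\<lambda>u. f u * H u", symmetric]) auto
  finally show ?thesis using * by simp
qed

text \<open>Inverting at \<open>x\<close> and then at \<open>J x\<close> returns to the same set
  \<open>B\<close> and the same starting point, but the weights \<open>c\<close> and
  \<open>H\<close> collected on the way remain in the integrand.\<close>

lemma green_double_inversion:
  assumes x: "x \<in> G" and B: "compact B" "B \<subseteq> G" and f[measurable]: "f \<in> borel_measurable borel"
  shows "H x * H (J x) * green B f x = green B (\<lambda>u. f u * (H u * H (J u) / (c u * c (J u)))) x"
proof -
  have JB: "compact (J ` B)" "J ` B \<subseteq> G" using compact_JB[OF B] B J_in by auto
  have JJB: "J ` J ` B = B" using B(2) J_J by (force simp: image_image)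
  have cancel: "a / c u * c u = a" if "u \<in> G" for a u
    using c_pos[OF that] c_finite[OF that] by (simp add: ennreal_divide_times ennreal_divide_self mult_divide_eq_ennreal)
  \<comment> \<open>Chosen so that on \<open>G\<close> one has \<open>f1 (J u) * c u = f u\<close>
    and \<open>f2 (J u) * c u = f1 u * H u\<close>, the forms in which the two inversions
    apply.\<close>
  define f1 where "f1 u = f (J u) / c (J u)" for u
  define f2 where "f2 u = f1 (J u) * H (J u) / c (J u)" for u
  have [measurable]: "f1 \<in> borel_measurable borel" "f2 \<in> borel_measurable borel" unfolding f1_def[abs_def] f2_def[abs_def] by measurable
  have "H (J x) * green B f x = H (J x) * green B (\<lambda>u. f1 (J u) * c u) x"
    using B J_J cancel by (intro arg_cong2[where f="(*)"] green_cong) (auto simp: f1_def)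
  also have "\<dots> = green (J ` B) (\<lambda>u. f1 u * H u) (J x)" using x B by (rule green_inversion) measurable
  also have "\<dots> = green (J ` B) (\<lambda>u. f2 (J u) * c u) (J x)"
    using JB J_J cancel J_in by (intro green_cong) (auto simp: f2_def)
  finally have "H x * (H (J x) * green B f x) = H (J (J x)) * green (J ` B) (\<lambda>u. f2 (J u) * c u) (J x)"
    using J_J[OF x] by simp
  also have "\<dots> = green (J ` J ` B) (\<lambda>u. f2 u * H u) (J (J x))"
    using J_in[OF x] JB by (rule green_inversion) measurable
  also have "\<dots> = green B (\<lambda>u. f u * (H u * H (J u) / (c u * c (J u)))) x"
    unfolding JJB J_J[OF x]
  proof (rule green_cong)
    fix u assume "u \<in> B"
    then have u: "u \<in> G" "J u \<in> G" using B J_in by auto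
    have inv: "inverse (c u * c (J u)) = inverse (c u) * inverse (c (J u))"
      using c_finite u by (intro ennreal_inverse_mult) auto
    show "f2 u * H u = f u * (H u * H (J u) / (c u * c (J u)))"
      unfolding f2_def f1_def divide_ennreal_def inv J_J[OF u(1)] by (simp add: mult_ac)
  qed
  finally show ?thesis by (simp add: mult.assoc)
qed


section \<open>Real-valued characteristics, hitting events and the identity for
  \<open>v\<close>\<close>

definition h_real :: "'a \<Rightarrow> real" where "h_real u = enn2real (H u)"

lemma H_eq: "u \<in> G \<Longrightarrow> H u = ennreal (h_real u)" and h_real_pos: "u \<in> G \<Longrightarrow> 0 < h_real u"
  using H_pos[of u] H_finite[of u] by (auto simp: h_real_def enn2real_positive_iff)

lemma h_real_continuous: "continuous_on G h_real"
proof -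
  have "continuous_on (alive_set S) (\<lambda>x. h (Some x))"
    using continuous by (intro continuous_on_alive) (simp add: continuous_characteristics_def)
  then have H: "continuous_on G H"
    unfolding G_def by (rule continuous_on_eq) (simp add: H_def G_def)
  show ?thesis
    unfolding continuous_on_def
  proof
    fix u assume u: "u \<in> G"
    have "(H \<longlongrightarrow> H u) (at u within G)" using H u unfolding continuous_on_def by blast
    then have "(H \<longlongrightarrow> ennreal (h_real u)) (at u within G)" by (simp only: H_eq[OF u])
    then show "(h_real \<longlongrightarrow> h_real u) (at u within G)"
      unfolding h_real_def[abs_def] by (rule tendsto_enn2real) simp
  qed
qed

lemma c_eq: "u \<in> G \<Longrightarrow> c u = ennreal (inverse (v (Some u)))" and v_Some_pos: "u \<in> G \<Longrightarrow> 0 < v (Some u)"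
  using v_pos by (auto simp: c_def inverse_speed_def G_def)

lemma v_Some_continuous: "continuous_on G (\<lambda>u. v (Some u))"
  unfolding G_def using v_continuous by (rule continuous_on_alive)

text \<open>An open set once visited is occupied for a short time by right-continuity, and that time
  interval contains a rational.\<close>

lemma hits_iff_rational:
  assumes "rc_path G z" "open V"
  shows "(\<exists>t\<ge>0. z t \<in> V) \<longleftrightarrow> (\<exists>q\<in>\<rat> \<inter> {0..}. z q \<in> V)"
proof
  interpret killed_path G c z using assms(1) by unfold_locales
  assume "\<exists>t\<ge>0. z t \<in> V"
  then obtain t where t: "0 \<le> t" "z t \<in> V" by blast
  obtain e where e: "e > 0" "\<forall>s. t \<le> s \<and> s < t + e \<longrightarrow> z s \<in> V" using right_nhd[OF t assms(2)] by blast
  obtain q where q: "q \<in> \<rat>" "t < q" "q < t + e" using Rats_dense_in_real[of t "t + e"] e by auto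
  then have "z q \<in> V" using e(2) by simp
  then show "\<exists>q\<in>\<rat> \<inter> {0..}. z q \<in> V" using q t(1) by (intro bexI[of _ q]) auto
qed auto

lemma hits_sets:
  assumes "\<And>t. 0 \<le> t \<Longrightarrow> z t \<in> borel_measurable N" "\<And>w. w \<in> space N \<Longrightarrow> rc_path G (\<lambda>t. z t w)" "open V"
  shows "{w \<in> space N. \<exists>t\<ge>0. z t w \<in> V} \<in> sets N"
proof -
  have "{w \<in> space N. \<exists>q\<in>\<rat> \<inter> {0..}. z q w \<in> V} \<in> sets N"
    using assms by (intro sets.sets_Collect_countable_Ex' countable_Int1 countable_rat measurable_sets_Collect[OF assms(1)]) auto
  moreover have "{w \<in> space N. \<exists>q\<in>\<rat> \<inter> {0..}. z q w \<in> V} = {w \<in> space N. \<exists>t\<ge>0. z t w \<in> V}"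
    using hits_iff_rational[OF assms(2,3)] by blast
  ultimately show ?thesis by simp
qed

lemma hits_pos:
  assumes x: "x \<in> G" and V: "open V" "V \<subseteq> G" "V \<noteq> {}"
  shows "0 < emeasure (P (Some x)) {w \<in> space M. \<exists>t\<ge>0. y t w \<in> V}"
proof -
  have "0 < emeasure (P (Some x)) {w \<in> space M. \<exists>t\<ge>0. X t w \<in> Some ` V}"
    using x V by (intro irreducible openin_E_top_image) (auto simp: G_def)
  also have "{w \<in> space M. \<exists>t\<ge>0. X t w \<in> Some ` V} = {w \<in> space M. \<exists>t\<ge>0. y t w \<in> V}"
  proof -
    have "X t w \<in> Some ` V \<longleftrightarrow> y t w \<in> V" for t w
    proof
      assume *: "y t w \<in> V"
      then have "X t w = Some (y t w)" using Some_y y_alive V by (metis subsetD)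
      then show "X t w \<in> Some ` V" using * by simp
    qed (use V in \<open>auto simp: y_def G_def\<close>)
    then show ?thesis by simp
  qed
  finally show ?thesis .
qed

text \<open>The witness is \<open>f u = P_u(X_\<tau> \<in> V)\<close> with
  \<open>V = G - cball x r\<close>. By the Markov property its Green integral is the mean length of
  the set of times \<open>s\<close> such that the path stays in the ball up to \<open>s\<close> and
  is in \<open>V\<close> at \<open>s + \<tau>\<close>. Two such times differ by at most
  \<open>\<tau>\<close>, so the length is at most \<open>\<tau>\<close>.\<close>

lemma green_finite_positive:
  assumes x: "x \<in> G" and r: "0 < r" and B: "cball x r \<subseteq> G" and ne: "G - cball x r \<noteq> {}"
  shows "\<exists>f. f \<in> borel_measurable borel \<and> 0 < green (cball x r) f x \<and> green (cball x r) f x < \<infinity>"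
proof -
  let ?B = "cball x r" and ?P = "P (Some x)"
  define V where "V = G - ?B"
  have V: "open V" "V \<subseteq> G" "V \<noteq> {}" using ne open_G by (auto simp: V_def)
  have xE: "Some x \<in> E_space S" using Some_G_space[OF x] .
  interpret Px: prob_space ?P using prob_P[OF xE] .
  have Vb[measurable]: "V \<in> sets borel" using V by auto
  have SV: "Some ` V \<in> sets (E_borel S)" using V by (intro Some_image_sets) (auto simp: G_def)
  have XV: "X t w \<in> Some ` V \<longleftrightarrow> y t w \<in> V" for t w
  proof
    assume *: "y t w \<in> V"
    then have "X t w = Some (y t w)" using Some_y y_alive V by (metis subsetD)
    then show "X t w \<in> Some ` V" using * by simp
  qed (use V in \<open>auto simp: y_def G_def\<close>)
  \<comment> \<open>Irreducibility gives a visit to the open set \<open>V\<close> at a random time;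
    as visits show at rational times, countable additivity yields one deterministic time of positive
    probability.\<close>
  have "\<exists>\<tau>\<ge>0. 0 < emeasure ?P {w \<in> space M. y \<tau> w \<in> V}"
  proof (rule ccontr)
    assume neg: "\<not> ?thesis"
    have "{w \<in> space M. y q w \<in> V} \<in> null_sets ?P" if "q \<in> \<rat> \<inter> {0..}" for q
    proof
      have q: "0 \<le> q" using that by simp
      show "{w \<in> space M. y q w \<in> V} \<in> sets ?P"
        using measurable_sets_Collect[OF y_measurable_Some[OF q x], of "\<lambda>u. u \<in> V"] x V(1) by simp
      show "emeasure ?P {w \<in> space M. y q w \<in> V} = 0" using neg q by (auto simp: zero_less_iff_neq_zero)
    qed
    then have "(\<Union>q\<in>\<rat> \<inter> {0..}. {w \<in> space M. y q w \<in> V}) \<in> null_sets ?P"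
      by (intro null_sets_UN') (auto intro!: countable_Int1 countable_rat)
    moreover have "(\<Union>q\<in>\<rat> \<inter> {0..}. {w \<in> space M. y q w \<in> V}) = {w \<in> space M. \<exists>t\<ge>0. y t w \<in> V}"
      using hits_iff_rational[OF rc_y V(1)] by blast
    ultimately show False using hits_pos[OF x V] by (simp add: null_setsD1)
  qed
  then obtain \<tau> where \<tau>: "0 \<le> \<tau>" "0 < emeasure ?P {w \<in> space M. y \<tau> w \<in> V}" by blast
  define g where "g z = emeasure (P z) {w \<in> space M. X \<tau> w \<in> Some ` V}" for z
  have g: "g \<in> borel_measurable (E_borel S)" unfolding g_def[abs_def] by (rule measurable_P[OF \<tau>(1) SV])
  define f where "f u = (if u \<in> G then g (Some u) else 0)" for u
  have f[measurable]: "f \<in> borel_measurable borel"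
    unfolding f_def[abs_def] G_def using g by (rule measurable_on_alive)
  define L where "L w = (\<integral>\<^sup>+s. indicator {s. 0 \<le> s \<and> stays ?B (\<lambda>u. y u w) s} s * indicator V (y (s + \<tau>) w) \<partial>lborel)" for w
  have m: "(\<lambda>(w, s). indicator {s. 0 \<le> s \<and> stays ?B (\<lambda>u. y u w) s} s * indicator V (y (s + \<tau>) w) :: ennreal) \<in> borel_measurable (?P \<Otimes>\<^sub>M borel)"
  proof -
    have 1: "(\<lambda>(w, s). indicator {s. 0 \<le> s \<and> stays ?B (\<lambda>u. y u w) s} s * (1::ennreal)) \<in> borel_measurable (?P \<Otimes>\<^sub>M borel)"
      using y_measurable_Some rc_y x B by (intro stays_jointly_measurable) auto
    have 2: "(\<lambda>(w, t). if 0 \<le> t then y t w else 0) \<in> borel_measurable (?P \<Otimes>\<^sub>M borel)"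
      using y_measurable_Some rc_y x by (intro rc_process_jointly_measurable) auto
    have "(\<lambda>p. (fst p, snd p + \<tau>)) \<in> measurable (?P \<Otimes>\<^sub>M borel) (?P \<Otimes>\<^sub>M borel)" by measurable
    from measurable_compose[OF this 2]
    have [measurable]: "(\<lambda>p. if 0 \<le> snd p + \<tau> then y (snd p + \<tau>) (fst p) else 0) \<in> borel_measurable (?P \<Otimes>\<^sub>M borel)" by simp
    have [measurable]: "(\<lambda>p. indicator {s. 0 \<le> s \<and> stays ?B (\<lambda>u. y u (fst p)) s} (snd p) :: ennreal) \<in> borel_measurable (?P \<Otimes>\<^sub>M borel)"
      using 1 by (simp add: case_prod_beta)
    have "(\<lambda>p. indicator {s. 0 \<le> s \<and> stays ?B (\<lambda>u. y u (fst p)) s} (snd p) * indicator V (if 0 \<le> snd p + \<tau> then y (snd p + \<tau>) (fst p) else 0) :: ennreal) \<in> borel_measurable (?P \<Otimes>\<^sub>M borel)"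
      by measurable
    also have "(\<lambda>p. indicator {s. 0 \<le> s \<and> stays ?B (\<lambda>u. y u (fst p)) s} (snd p) * indicator V (if 0 \<le> snd p + \<tau> then y (snd p + \<tau>) (fst p) else 0) :: ennreal)
        = (\<lambda>(w, s). indicator {s. 0 \<le> s \<and> stays ?B (\<lambda>u. y u w) s} s * indicator V (y (s + \<tau>) w))"
      using \<tau>(1) by (auto simp: indicator_def fun_eq_iff)
    finally show ?thesis .
  qed
  \<comment> \<open>\<open>f (y s w)\<close> is the conditional probability of being in
    \<open>V\<close> at time \<open>s + \<tau>\<close>, and staying in the ball up to
    \<open>s\<close> is an event of the past at time \<open>s\<close>.\<close>
  have green_L: "green ?B f x = (\<integral>\<^sup>+w. L w \<partial>?P)"
  proof -
    interpret pair_sigma_finite ?P "lborel :: real measure" using sigma_finite_P[OF x] .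
    have "green ?B f x = (\<integral>\<^sup>+s. indicator {0..} s * (\<integral>\<^sup>+w. indicator {w. stays ?B (\<lambda>u. y u w) s} w * f (y s w) \<partial>?P) \<partial>lborel)"
      unfolding green_def using y_measurable_Some rc_y x B by (intro nn_integral_stays_swap) auto
    also have "\<dots> = (\<integral>\<^sup>+s. \<integral>\<^sup>+w. indicator {s. 0 \<le> s \<and> stays ?B (\<lambda>u. y u w) s} s * indicator V (y (s + \<tau>) w) \<partial>?P \<partial>lborel)"
    proof (rule nn_integral_cong)
      fix s :: real
      show "indicator {0..} s * (\<integral>\<^sup>+w. indicator {w. stays ?B (\<lambda>u. y u w) s} w * f (y s w) \<partial>?P) =
        (\<integral>\<^sup>+w. indicator {s. 0 \<le> s \<and> stays ?B (\<lambda>u. y u w) s} s * indicator V (y (s + \<tau>) w) \<partial>?P)"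
      proof (cases "0 \<le> s")
        case True
        define \<Lambda> where "\<Lambda> = {w \<in> space M. stays ?B (\<lambda>u. y u w) s}"
        have "\<Lambda> = {w \<in> space (F (ennreal s)). y s w \<in> ?B \<and> (\<forall>q\<in>\<rat> \<inter> {0..<s}. y q w \<in> ?B)}"
          using stays_iff_rational[OF rc_y _ B True] by (auto simp: \<Lambda>_def)
        also have "\<dots> \<in> sets (F (ennreal s))"
          using True by (intro sets.sets_Collect_conj sets.sets_Collect_countable_All' countable_Int1 countable_rat
              measurable_sets_Collect[OF y_measurable_F]) auto
        finally have \<Lambda>: "\<Lambda> \<in> sets (F (ennreal s))" .
        have ind: "indicator (Some ` V) \<in> borel_measurable (E_borel S)" using SV by simp
        have "(\<integral>\<^sup>+w. indicator {w. stays ?B (\<lambda>u. y u w) s} w * f (y s w) \<partial>?P) =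
            (\<integral>\<^sup>+w. indicator \<Lambda> w * (\<integral>\<^sup>+w'. indicator (Some ` V) (X \<tau> w') \<partial>P (X s w)) \<partial>?P)"
        proof (rule nn_integral_cong)
          fix w assume w: "w \<in> space ?P"
          show "indicator {w. stays ?B (\<lambda>u. y u w) s} w * f (y s w) =
              indicator \<Lambda> w * (\<integral>\<^sup>+w'. indicator (Some ` V) (X \<tau> w') \<partial>P (X s w))"
          proof (cases "stays ?B (\<lambda>u. y u w) s")
            case st: True
            then have ys: "y s w \<in> G" using True B by (auto simp: stays_def)
            then have Xs: "X s w \<in> E_int S" by (simp add: y_alive)
            have XE: "X s w \<in> E_space S" using Xs E_int_subset by blast
            have "(\<integral>\<^sup>+w'. indicator (Some ` V) (X \<tau> w') \<partial>P (X s w)) = (\<integral>\<^sup>+w'. indicator {w' \<in> space M. X \<tau> w' \<in> Some ` V} w' \<partial>P (X s w))"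
              using XE by (intro nn_integral_cong) (auto simp: indicator_def)
            also have "\<dots> = g (X s w)"
              unfolding g_def using measurable_sets[OF measurable_X_P[OF \<tau>(1) XE] SV] XE
              by (intro nn_integral_indicator) (simp add: vimage_def Int_def conj_commute)
            finally show ?thesis using st w x ys Some_y[OF Xs] by (simp add: f_def \<Lambda>_def)
          qed (simp add: \<Lambda>_def)
        qed
        also have "\<dots> = (\<integral>\<^sup>+w. indicator \<Lambda> w * indicator (Some ` V) (X (s + \<tau>) w) \<partial>?P)"
          using Markov[OF True \<tau>(1) xE \<Lambda> ind] by simp
        also have "\<dots> = (\<integral>\<^sup>+w. indicator {s. 0 \<le> s \<and> stays ?B (\<lambda>u. y u w) s} s * indicator V (y (s + \<tau>) w) \<partial>?P)"
          using True x XV by (intro nn_integral_cong) (simp add: \<Lambda>_def indicator_def)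
        finally show ?thesis using True by simp
      qed simp
    qed
    also have "\<dots> = (\<integral>\<^sup>+w. L w \<partial>?P)"
      unfolding L_def using Fubini'[of "\<lambda>w s. indicator {s. 0 \<le> s \<and> stays ?B (\<lambda>u. y u w) s} s * indicator V (y (s + \<tau>) w)"] m by simp
    finally show ?thesis .
  qed
  have L_le: "L w \<le> ennreal \<tau>" for w
  proof -
    define A where "A = {s. 0 \<le> s \<and> stays ?B (\<lambda>u. y u w) s \<and> y (s + \<tau>) w \<in> V}"
    have LA: "L w = (\<integral>\<^sup>+s. indicator A s \<partial>lborel)"
      unfolding L_def by (intro nn_integral_cong) (auto simp: A_def indicator_def)
    show ?thesis
    proof (cases "A = {}")
      case False
      have bdd: "bdd_below A" by (rule bdd_belowI[of _ 0]) (simp add: A_def)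
      \<comment> \<open>If \<open>s' + \<tau> < s\<close> for two elements, staying in the ball up
        to \<open>s\<close> contradicts being in \<open>V\<close> at
        \<open>s' + \<tau>\<close>.\<close>
      have "A \<subseteq> {Inf A..Inf A + \<tau>}"
      proof
        fix s assume s: "s \<in> A"
        have "s \<le> Inf A + \<tau>"
        proof (rule ccontr)
          assume "\<not> ?thesis"
          then have "Inf A < s - \<tau>" by simp
          then obtain s' where s': "s' \<in> A" "s' < s - \<tau>" using cInf_lessD[OF False] by blast
          then have "y (s' + \<tau>) w \<in> ?B" using s \<tau>(1) by (auto simp: A_def stays_def)
          then show False using s' by (simp add: A_def V_def)
        qed
        then show "s \<in> {Inf A..Inf A + \<tau>}" using cInf_lower[OF s bdd] by simp
      qed
      then have "L w \<le> (\<integral>\<^sup>+s. indicator {Inf A..Inf A + \<tau>} s \<partial>lborel)"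
        unfolding LA by (intro nn_integral_mono) (auto simp: indicator_def)
      also have "\<dots> = ennreal \<tau>" using \<tau>(1) by simp
      finally show ?thesis .
    qed (simp add: LA)
  qed
  have "green ?B f x \<le> (\<integral>\<^sup>+w. ennreal \<tau> \<partial>?P)" unfolding green_L by (intro nn_integral_mono L_le)
  also have "\<dots> < \<infinity>" by (simp add: Px.emeasure_space_1)
  finally have fin: "green ?B f x < \<infinity>" .
  \<comment> \<open>On the event of being in \<open>V\<close> at \<open>\<tau>\<close>,
    right-continuity at \<open>0\<close> and at \<open>\<tau>\<close> gives \<open>e > 0\<close>
    such that every \<open>s < e\<close> counts: the path has not yet left the ball at
    \<open>s\<close>, and at \<open>s + \<tau>\<close> it is still in \<open>V\<close>. A vanishing
    integral would make this event null.\<close>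
  have pos: "green ?B f x \<noteq> 0"
  proof
    assume "green ?B f x = 0"
    moreover have "L \<in> borel_measurable ?P"
      unfolding L_def[abs_def] using m by (intro lborel.borel_measurable_nn_integral) simp
    ultimately have "AE w in ?P. L w = 0" unfolding green_L by (simp add: nn_integral_0_iff_AE)
    with normal[OF xE] AE_space have "AE w in ?P. w \<notin> {w \<in> space M. y \<tau> w \<in> V}"
    proof eventually_elim
      case (elim w)
      show ?case
      proof
        assume w: "w \<in> {w \<in> space M. y \<tau> w \<in> V}"
        then have wM: "w \<in> space M" by simp
        interpret killed_path G c "\<lambda>t. y t w" using killed_path_y[OF wM] .
        have y0: "y 0 w = x" using elim x by (simp add: y_def G_def)
        obtain e1 where e1: "e1 > 0" "\<forall>s. 0 \<le> s \<and> s < 0 + e1 \<longrightarrow> y s w \<in> ball x r"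
          using right_nhd[of 0 "ball x r"] y0 r by auto
        obtain e2 where e2: "e2 > 0" "\<forall>s. \<tau> \<le> s \<and> s < \<tau> + e2 \<longrightarrow> y s w \<in> V"
          using right_nhd[OF \<tau>(1) _ V(1)] w by blast
        define e where "e = min e1 e2"
        have "(\<integral>\<^sup>+s. indicator {0..<e} s \<partial>lborel) \<le> L w"
          unfolding L_def
        proof (intro nn_integral_mono)
          fix s :: real
          have "stays ?B (\<lambda>u. y u w) s \<and> y (s + \<tau>) w \<in> V" if "s \<in> {0..<e}"
          proof
            show "stays ?B (\<lambda>u. y u w) s"
              unfolding stays_def
            proof
              fix u assume "u \<in> {0..s}"
              then have "y u w \<in> ball x r" using e1(2) that by (auto simp: e_def)
              then show "y u w \<in> ?B" by simp
            qed
            show "y (s + \<tau>) w \<in> V" using e2(2) that by (auto simp: e_def)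
          qed
          then show "indicator {0..<e} s \<le> indicator {s. 0 \<le> s \<and> stays ?B (\<lambda>u. y u w) s} s * (indicator V (y (s + \<tau>) w) :: ennreal)"
            by (auto simp: indicator_def)
        qed
        moreover have "(\<integral>\<^sup>+s. indicator {0..<e} s \<partial>lborel) = ennreal e" using e1 e2 by (simp add: e_def)
        ultimately have "ennreal e \<le> 0" using elim by simp
        then show False using e1 e2 by (simp add: e_def min_def split: if_splits)
      qed
    qed
    moreover have "{w \<in> space M. y \<tau> w \<in> V} \<in> sets ?P"
      using measurable_sets_Collect[OF y_measurable_Some[OF \<tau>(1) x], of "\<lambda>u. u \<in> V"] x V(1) by simp
    ultimately have "emeasure ?P {w \<in> space M. y \<tau> w \<in> V} = 0"
      by (simp add: AE_iff_null_sets null_setsD1)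
    then show False using \<tau>(2) by simp
  qed
  show ?thesis using f fin pos by (intro exI[of _ f]) (auto simp: zero_less_iff_neq_zero)
qed

lemma green_cmult:
  assumes x: "x \<in> G" and B: "closed B" "B \<subseteq> G" and f[measurable]: "f \<in> borel_measurable borel"
  shows "green B (\<lambda>u. a * f u) x = a * green B f x"
proof -
  have m: "(\<lambda>(w, s). indicator {s. 0 \<le> s \<and> stays B (\<lambda>u. y u w) s} s * f (y s w)) \<in> borel_measurable (P (Some x) \<Otimes>\<^sub>M borel)"
    using y_measurable_Some rc_y x B f by (intro stays_jointly_measurable) auto
  have "green B (\<lambda>u. a * f u) x = (\<integral>\<^sup>+w. a * (\<integral>\<^sup>+s. indicator {s. 0 \<le> s \<and> stays B (\<lambda>u. y u w) s} s * f (y s w) \<partial>lborel) \<partial>P (Some x))"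
    unfolding green_def
  proof (rule nn_integral_cong)
    fix w assume w: "w \<in> space (P (Some x))"
    have "(\<lambda>s. indicator {s. 0 \<le> s \<and> stays B (\<lambda>u. y u w) s} s * f (y s w)) \<in> borel_measurable borel"
      using borel_component[OF m w] .
    then have "(\<integral>\<^sup>+s. a * (indicator {s. 0 \<le> s \<and> stays B (\<lambda>u. y u w) s} s * f (y s w)) \<partial>lborel) = a * (\<integral>\<^sup>+s. indicator {s. 0 \<le> s \<and> stays B (\<lambda>u. y u w) s} s * f (y s w) \<partial>lborel)"
      by (intro nn_integral_cmult) simp
    then show "(\<integral>\<^sup>+s. indicator {s. 0 \<le> s \<and> stays B (\<lambda>u. y u w) s} s * (a * f (y s w)) \<partial>lborel) = a * (\<integral>\<^sup>+s. indicator {s. 0 \<le> s \<and> stays B (\<lambda>u. y u w) s} s * f (y s w) \<partial>lborel)"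
      by (simp add: mult_ac)
  qed
  also have "\<dots> = a * green B f x"
    unfolding green_def using m by (intro nn_integral_cmult lborel.borel_measurable_nn_integral) simp
  finally show ?thesis .
qed

lemma green_mono: "(\<And>u. u \<in> B \<Longrightarrow> f u \<le> g u) \<Longrightarrow> green B f x \<le> green B g x"
  unfolding green_def by (intro nn_integral_mono) (auto simp: indicator_def stays_def)

text \<open>\<open>\<beta> u / k\<close> is the weight that a double inversion puts on the
  integrand; at \<open>u = x\<close> it equals \<open>v (Some x) * v (Some (J x))\<close>. If that
  is not 1, then on a small ball the weight is bounded away from 1 on one side, contradicting
  \<open>green_double_inversion\<close> for a test function with positive finite Green
  integral.\<close>

lemma v_J:
  assumes x: "x \<in> G"
  shows "v (Some x) * v (Some (J x)) = 1"
proof (rule ccontr)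
  assume ne: "v (Some x) * v (Some (J x)) \<noteq> 1"
  define \<beta> where "\<beta> u = h_real u * h_real (J u) * (v (Some u) * v (Some (J u)))" for u
  define k where "k = h_real x * h_real (J x)"
  have k: "0 < k" using h_real_pos x J_in by (simp add: k_def)
  have \<beta>_cont: "continuous_on G \<beta>"
    unfolding \<beta>_def using J_in
    by (intro continuous_intros h_real_continuous v_Some_continuous continuous_on_compose2[OF h_real_continuous J_continuous]
        continuous_on_compose2[OF v_Some_continuous J_continuous]) auto
  have \<beta>_pos: "0 < \<beta> u" if "u \<in> G" for u
    using that J_in[OF that] by (simp add: \<beta>_def h_real_pos v_Some_pos)
  have \<beta>_eq: "H u * H (J u) / (c u * c (J u)) = ennreal (\<beta> u)" if "u \<in> G" for u
  proof -
    have "H u * H (J u) / (c u * c (J u)) = ennreal (h_real u * h_real (J u)) / ennreal (inverse (v (Some u)) * inverse (v (Some (J u))))"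
      using that J_in[OF that] h_real_pos[of u] h_real_pos[of "J u"] v_Some_pos[of u] v_Some_pos[of "J u"]
      by (simp add: H_eq c_eq ennreal_mult)
    also have "\<dots> = ennreal (h_real u * h_real (J u) / (inverse (v (Some u)) * inverse (v (Some (J u)))))"
      using that J_in[OF that] h_real_pos[of u] h_real_pos[of "J u"] v_Some_pos[of u] v_Some_pos[of "J u"]
      by (intro divide_ennreal) auto
    also have "\<dots> = ennreal (\<beta> u)" by (simp add: \<beta>_def divide_inverse)
    finally show ?thesis .
  qed
  have \<beta>x: "\<beta> x \<noteq> k" using ne h_real_pos[OF x] h_real_pos[OF J_in[OF x]] by (simp add: \<beta>_def k_def)
  \<comment> \<open>Half the gap: on the ball \<open>\<beta>\<close> stays within \<open>d\<close>
    of \<open>\<beta> x\<close>, hence on one side of \<open>k\<close> and at distance at least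
    \<open>d\<close> from it.\<close>
  define d where "d = \<bar>\<beta> x - k\<bar> / 2"
  have d: "0 < d" using \<beta>x by (simp add: d_def)
  have "isCont \<beta> x" using \<beta>_cont open_G x by (simp add: continuous_on_eq_continuous_at)
  then obtain r1 where r1: "0 < r1" "\<And>u. dist u x < r1 \<Longrightarrow> dist (\<beta> u) (\<beta> x) < d"
    using d unfolding continuous_at_eps_delta by (metis (no_types))
  obtain r2 where r2: "0 < r2" "cball x r2 \<subseteq> G" using open_contains_cball open_G x by blast
  define r where "r = min (r1 / 2) (r2 / 2)"
  have r: "0 < r" "r < r1" "r < r2" using r1 r2 by (auto simp: r_def)
  let ?B = "cball x r"
  have B: "?B \<subseteq> G" using r r2 by (meson less_imp_le subset_cball subset_trans)
  \<comment> \<open>Gives a point of \<open>cball x r2\<close> outside the smaller ball, so that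
    \<open>G\<close> is not exhausted by \<open>cball x r\<close> and there is somewhere to leave
    to.\<close>
  obtain b :: 'a where b: "norm b = 1" using vector_choose_size[of 1] by auto
  have "x + r2 *\<^sub>R b \<in> G - ?B" using r2 r b by (auto simp: dist_norm subset_iff)
  then obtain f where f[measurable]: "f \<in> borel_measurable borel" and pos: "0 < green ?B f x" and fin: "green ?B f x < \<infinity>"
    using green_finite_positive[OF x r(1) B] by blast
  have id: "ennreal k * green ?B f x = green ?B (\<lambda>u. f u * ennreal (\<beta> u)) x"
  proof -
    have "ennreal k * green ?B f x = H x * H (J x) * green ?B f x"
      using x J_in h_real_pos by (simp add: k_def H_eq ennreal_mult less_imp_le)
    also have "\<dots> = green ?B (\<lambda>u. f u * (H u * H (J u) / (c u * c (J u)))) x"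
      using x B by (intro green_double_inversion) auto
    also have "\<dots> = green ?B (\<lambda>u. f u * ennreal (\<beta> u)) x"
      using \<beta>_eq B by (intro green_cong) auto
    finally show ?thesis .
  qed
  have near: "\<bar>\<beta> u - \<beta> x\<bar> < d" if "u \<in> ?B" for u
    using r1(2)[of u] that r by (simp add: dist_real_def dist_commute)
  obtain g where g: "green ?B f x = ennreal g" "0 < g"
    using pos fin by (cases "green ?B f x") auto
  consider "\<beta> x > k" | "\<beta> x < k" using \<beta>x by linarith
  then show False
  proof cases
    case 1
    have "ennreal (k + d) * green ?B f x = green ?B (\<lambda>u. ennreal (k + d) * f u) x"
      using x B by (intro green_cmult[symmetric]) auto
    also have "\<dots> \<le> green ?B (\<lambda>u. f u * ennreal (\<beta> u)) x"
    proof (rule green_mono)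
      fix u assume u: "u \<in> ?B"
      have "- d < \<beta> u - \<beta> x" using near[OF u] by (simp add: abs_less_iff)
      moreover have "2 * d = \<beta> x - k" using 1 by (simp add: d_def)
      ultimately have "k + d \<le> \<beta> u" by linarith
      then show "ennreal (k + d) * f u \<le> f u * ennreal (\<beta> u)"
        by (subst mult.commute) (intro mult_left_mono ennreal_leI, auto)
    qed
    finally have "ennreal (k + d) * ennreal g \<le> ennreal k * ennreal g" using id g by simp
    moreover have "ennreal (k + d) * ennreal g = ennreal ((k + d) * g)" "ennreal k * ennreal g = ennreal (k * g)"
      using k d g by (simp_all only: ennreal_mult less_imp_le add_nonneg_nonneg)
    ultimately have "(k + d) * g \<le> k * g" using k g by (simp add: ennreal_le_iff)
    then show False using d g by simp
  next
    case 2
    have "green ?B (\<lambda>u. f u * ennreal (\<beta> u)) x \<le> green ?B (\<lambda>u. ennreal (k - d) * f u) x"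
    proof (rule green_mono)
      fix u assume u: "u \<in> ?B"
      have "\<beta> u - \<beta> x < d" using near[OF u] by (simp add: abs_less_iff)
      moreover have "2 * d = k - \<beta> x" using 2 by (simp add: d_def)
      ultimately have "\<beta> u \<le> k - d" by linarith
      then show "f u * ennreal (\<beta> u) \<le> ennreal (k - d) * f u"
        by (subst mult.commute) (intro mult_right_mono ennreal_leI, auto)
    qed
    also have "\<dots> = ennreal (k - d) * green ?B f x"
      using x B by (intro green_cmult) auto
    finally have "ennreal k * ennreal g \<le> ennreal (k - d) * ennreal g" using id g by simp
    moreover have "0 \<le> k - d" using \<beta>_pos[OF x] 2 k by (simp add: d_def)
    ultimately have "k * g \<le> (k - d) * g" using k g by (simp add: ennreal_mult[symmetric] ennreal_le_iff)
    then show False using d g by simp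
  qed
qed

lemma c_J: "x \<in> G \<Longrightarrow> c x * c (J x) = 1"
  using v_J[of x] v_Some_pos[of x] v_Some_pos[of "J x"] J_in[of x]
  by (simp add: c_eq ennreal_mult[symmetric] inverse_mult_distrib[symmetric])

end

section \<open>Hitting probabilities\<close>

context inversion_process
begin

text \<open>Decomposition according to the first visit of \<open>V\<close> along a finite set of times.\<close>

lemma hitting_inversion_finite:
  assumes x: "x \<in> G" and V: "open V" "V \<subseteq> G" and m: "\<And>u. u \<in> V \<Longrightarrow> H u \<le> m"
    and D: "finite D" "D \<subseteq> {0..}"
  shows "H (J x) * emeasure (P (Some x)) {w \<in> space M. \<exists>d\<in>D. W d w \<in> V} \<le>
    m * emeasure (P (Some (J x))) {w \<in> space M. \<exists>d\<in>D. y d w \<in> V}"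
proof -
  have Jx: "J x \<in> G" using J_in[OF x] .
  define K where "K d = {d' \<in> D. d' \<le> d}" for d
  \<comment> \<open>Before \<open>d\<close> the path is required to lie in \<open>G - V\<close>
    rather than merely outside \<open>V\<close>: \<open>W_cylinder\<close> takes subsets of
    \<open>G\<close>, and a path in \<open>V\<close> at time \<open>d\<close> was alive
    before.\<close>
  define A where "A d d' = (if d' = d then V else G - V)" for d d' :: real
  define E where "E z d = {w \<in> space M. \<forall>i\<in>K d. z i w \<in> A d i}" for z :: "real \<Rightarrow> 'w \<Rightarrow> 'a" and d
  have Ab: "A d i \<in> sets borel \<and> A d i \<subseteq> G" for d i using V open_G by (auto simp: A_def)
  have Kf: "finite (K d)" "K d \<subseteq> {0..}" for d using D by (auto simp: K_def)
  have union: "{w \<in> space M. \<exists>d\<in>D. z d w \<in> V} = (\<Union>d\<in>D. E z d)" if rc: "\<And>w. w \<in> space M \<Longrightarrow> rc_path G (\<lambda>t. z t w)" for z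
  proof (intro set_eqI iffI)
    fix w assume "w \<in> {w \<in> space M. \<exists>d\<in>D. z d w \<in> V}"
    then have w: "w \<in> space M" and ex: "{d \<in> D. z d w \<in> V} \<noteq> {}" by auto
    define d where "d = Min {d \<in> D. z d w \<in> V}"
    have fin: "finite {d \<in> D. z d w \<in> V}" using D by simp
    have d: "d \<in> D" "z d w \<in> V" using Min_in[OF fin ex] by (auto simp: d_def)
    have "z i w \<in> A d i" if i: "i \<in> K d" for i
    proof (cases "i = d")
      case False
      have "z i w \<notin> V"
      proof
        assume "z i w \<in> V"
        then have "d \<le> i" unfolding d_def using i fin by (intro Min_le) (auto simp: K_def)
        then show False using i False by (auto simp: K_def)
      qed
      moreover have "z i w \<in> G"
        using rc_path_alive_before[OF rc[OF w], of i d] i d V D by (auto simp: K_def)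
      ultimately show ?thesis using False by (simp add: A_def)
    qed (use d in \<open>simp add: A_def\<close>)
    then show "w \<in> (\<Union>d\<in>D. E z d)" using d w by (auto simp: E_def)
  next
    fix w assume "w \<in> (\<Union>d\<in>D. E z d)"
    then obtain d where d: "d \<in> D" "w \<in> E z d" by blast
    then have "z d w \<in> A d d" by (auto simp: E_def K_def)
    then show "w \<in> {w \<in> space M. \<exists>d\<in>D. z d w \<in> V}" using d by (auto simp: E_def A_def)
  qed
  have disj: "disjoint_family_on (E z) D" for z
    unfolding disjoint_family_on_def
  proof (intro ballI impI)
    fix d e assume de: "d \<in> D" "e \<in> D" "d \<noteq> e"
    have "False" if "w \<in> E z a" "w \<in> E z b" "a \<in> D" "b \<in> D" "a < b" for w a b
    proof -
      have "z a w \<in> A a a" "z a w \<in> A b a" using that by (auto simp: E_def K_def)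
      then show False using that by (simp add: A_def)
    qed
    then show "E z d \<inter> E z e = {}" using de by (metis disjoint_iff linorder_neqE)
  qed
  have meas: "E z d \<in> sets N" if "\<And>i. 0 \<le> i \<Longrightarrow> z i \<in> borel_measurable N" "space N = space M" for z N d
    unfolding E_def that(2)[symmetric] using Kf[of d] Ab that
    by (intro sets.sets_Collect_finite_All measurable_sets_Collect[OF that(1)]) auto
  have EW: "E W d \<in> sets (P (Some x))" for d using W_measurable_Some x by (intro meas) auto
  have Ey: "E y d \<in> sets (P (Some (J x)))" for d using y_measurable_Some Jx by (intro meas) auto
  have each: "H (J x) * emeasure (P (Some x)) (E W d) \<le> m * emeasure (P (Some (J x))) (E y d)" if d: "d \<in> D" for d
  proof -
    have dK: "d \<in> K d" using d by (simp add: K_def)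
    have Mx: "Max (K d) = d" using Kf[of d] dK by (intro Max_eqI) (auto simp: K_def)
    have "H (J x) * emeasure (P (Some x)) (E W d) =
        (\<integral>\<^sup>+w. indicator (E y d) w * h (X (Max (K d)) w) \<partial>P (Some (J x)))"
      unfolding E_def using dK by (intro W_cylinder Kf Ab x) auto
    \<comment> \<open>At its last time \<open>d\<close> the cylinder puts the path in
      \<open>V\<close>, where \<open>H\<close> is at most \<open>m\<close>.\<close>
    also have "\<dots> \<le> (\<integral>\<^sup>+w. m * indicator (E y d) w \<partial>P (Some (J x)))"
    proof (rule nn_integral_mono)
      fix w
      show "indicator (E y d) w * h (X (Max (K d)) w) \<le> m * indicator (E y d) w"
      proof (cases "w \<in> E y d")
        case True
        then have yV: "y d w \<in> V" using dK by (auto simp: E_def A_def)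
        then have "X d w \<in> E_int S" using V y_alive by blast
        then show ?thesis using m[OF yV] H_y[of d w] True Mx by simp
      qed simp
    qed
    also have "\<dots> = m * emeasure (P (Some (J x))) (E y d)" using Ey by (rule nn_integral_cmult_indicator)
    finally show ?thesis .
  qed
  have "H (J x) * emeasure (P (Some x)) {w \<in> space M. \<exists>d\<in>D. W d w \<in> V} = H (J x) * (\<Sum>d\<in>D. emeasure (P (Some x)) (E W d))"
    using EW disj D by (subst union[OF rc_W], simp, subst sum_emeasure) auto
  also have "\<dots> = (\<Sum>d\<in>D. H (J x) * emeasure (P (Some x)) (E W d))" by (rule sum_distrib_left)
  also have "\<dots> \<le> (\<Sum>d\<in>D. m * emeasure (P (Some (J x))) (E y d))" by (intro sum_mono each)
  also have "\<dots> = m * (\<Sum>d\<in>D. emeasure (P (Some (J x))) (E y d))" by (rule sum_distrib_left[symmetric])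
  also have "\<dots> = m * emeasure (P (Some (J x))) {w \<in> space M. \<exists>d\<in>D. y d w \<in> V}"
    using Ey disj D by (subst union[OF rc_y], simp, subst sum_emeasure) auto
  finally show ?thesis .
qed

lemma open_J_image:
  assumes "open V" "V \<subseteq> G"
  shows "open (J ` V)"
proof -
  have "J ` V = G \<inter> J -` V"
  proof (intro set_eqI iffI)
    fix u assume "u \<in> G \<inter> J -` V"
    then show "u \<in> J ` V" using J_J[of u] by (metis IntE image_eqI vimageE)
  qed (use assms J_in J_J in auto)
  then show ?thesis using continuous_open_preimage[OF J_continuous open_G assms(1)] by simp
qed

text \<open>A time change alters when points are visited, not which ones, so \<open>y\<close> hits
  the image of \<open>V\<close> under \<open>J\<close> exactly when \<open>W\<close> hits
  \<open>V\<close>, almost surely. Finite sets of rational times exhaust the event of hitting an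
  open set.\<close>

lemma hitting_inversion:
  assumes x: "x \<in> G" and V: "open V" "V \<subseteq> G" and m: "\<And>u. u \<in> V \<Longrightarrow> H u \<le> m"
  shows "H (J x) * emeasure (P (Some x)) {w \<in> space M. \<exists>t\<ge>0. y t w \<in> J ` V} \<le>
    m * emeasure (P (Some (J x))) {w \<in> space M. \<exists>t\<ge>0. y t w \<in> V}"
proof -
  have Jx: "J x \<in> G" using J_in[OF x] .
  have xE: "Some x \<in> E_space S" using Some_G_space[OF x] .
  have hW: "{w \<in> space M. \<exists>t\<ge>0. W t w \<in> V} \<in> sets (P (Some x))"
    using hits_sets[of W "P (Some x)" V] W_measurable_Some rc_W x V by simp
  have JV: "open (J ` V)" using V by (rule open_J_image)
  have hy: "{w \<in> space M. \<exists>t\<ge>0. y t w \<in> J ` V} \<in> sets (P (Some x))"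
    using hits_sets[of y "P (Some x)" "J ` V"] y_measurable_Some rc_y x JV by simp
  have "emeasure (P (Some x)) {w \<in> space M. \<exists>t\<ge>0. y t w \<in> J ` V} = emeasure (P (Some x)) {w \<in> space M. \<exists>t\<ge>0. W t w \<in> V}"
  proof (rule emeasure_eq_AE[OF _ hy hW])
    show "AE w in P (Some x). w \<in> {w \<in> space M. \<exists>t\<ge>0. y t w \<in> J ` V} \<longleftrightarrow> w \<in> {w \<in> space M. \<exists>t\<ge>0. W t w \<in> V}"
      using AE_finite_clock[OF xE]
    proof eventually_elim
      case (elim w)
      then interpret inverted_finite_path G c J "\<lambda>t. y t w" .
      show ?case using time_changed_hits[OF V(2)] by (simp add: W_def)
    qed
  qed
  moreover have "H (J x) * emeasure (P (Some x)) {w \<in> space M. \<exists>t\<ge>0. W t w \<in> V} \<le>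
    m * emeasure (P (Some (J x))) {w \<in> space M. \<exists>t\<ge>0. y t w \<in> V}"
  proof -
    define q where "q = from_nat_into (\<rat> \<inter> {0..} :: real set)"
    have "(\<rat> \<inter> {0..} :: real set) \<noteq> {}" by (auto intro: exI[of _ 0])
    then have q: "range q = \<rat> \<inter> {0..}"
      unfolding q_def using countable_rat by (intro range_from_nat_into countable_Int1) auto
    define A where "A z n = {w \<in> space M. \<exists>d\<in>q ` {..n}. z d w \<in> V}" for z :: "real \<Rightarrow> 'w \<Rightarrow> 'a" and n :: nat
    have U: "(\<Union>n. A z n) = {w \<in> space M. \<exists>t\<ge>0. z t w \<in> V}" if "\<And>w. w \<in> space M \<Longrightarrow> rc_path G (\<lambda>t. z t w)" for z
    proof -
      have "(\<Union>n. A z n) = {w \<in> space M. \<exists>d\<in>range q. z d w \<in> V}" by (auto simp: A_def)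
      also have "\<dots> = {w \<in> space M. \<exists>t\<ge>0. z t w \<in> V}"
        unfolding q by (intro Collect_cong conj_cong refl hits_iff_rational[OF that V(1), symmetric])
      finally show ?thesis .
    qed
    have A_sets: "A z n \<in> sets N" if "\<And>i. 0 \<le> i \<Longrightarrow> z i \<in> borel_measurable N" "space N = space M" for z N n
      unfolding A_def that(2)[symmetric] using V(1) q
      by (intro sets.sets_Collect_finite_Ex measurable_sets_Collect[OF that(1)]) auto
    have inc: "incseq (A z)" for z by (auto simp: incseq_def A_def)
    have "(\<Union>n. A y n) = {w \<in> space M. \<exists>t\<ge>0. y t w \<in> V}" by (rule U) (rule rc_y)
    then have sub: "A y n \<subseteq> {w \<in> space M. \<exists>t\<ge>0. y t w \<in> V}" for n by blast
    have "H (J x) * emeasure (P (Some x)) (A W n) \<le> m * emeasure (P (Some (J x))) {w \<in> space M. \<exists>t\<ge>0. y t w \<in> V}" for n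
    proof -
      have "H (J x) * emeasure (P (Some x)) (A W n) \<le> m * emeasure (P (Some (J x))) (A y n)"
        unfolding A_def using q by (intro hitting_inversion_finite x V m) auto
      also have "\<dots> \<le> m * emeasure (P (Some (J x))) {w \<in> space M. \<exists>t\<ge>0. y t w \<in> V}"
        using hits_sets[of y "P (Some (J x))" V] y_measurable_Some rc_y Jx V(1)
        by (intro mult_left_mono emeasure_mono sub) auto
      finally show ?thesis .
    qed
    then have "(SUP n. H (J x) * emeasure (P (Some x)) (A W n)) \<le> m * emeasure (P (Some (J x))) {w \<in> space M. \<exists>t\<ge>0. y t w \<in> V}"
      by (intro SUP_least)
    also have "(SUP n. H (J x) * emeasure (P (Some x)) (A W n)) = H (J x) * (SUP n. emeasure (P (Some x)) (A W n))"
      by (simp add: SUP_mult_left_ennreal)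
    also have "(SUP n. emeasure (P (Some x)) (A W n)) = emeasure (P (Some x)) (\<Union>n. A W n)"
      using A_sets[OF W_measurable_Some] x inc by (intro SUP_emeasure_incseq) auto
    also have "(\<Union>n. A W n) = {w \<in> space M. \<exists>t\<ge>0. W t w \<in> V}" by (rule U) (rule rc_W)
    finally show ?thesis .
  qed
  ultimately show ?thesis by simp
qed

text \<open>\<open>hitting_inversion\<close> from \<open>x\<close> and from \<open>J x\<close>
  bounds a hitting probability \<open>p\<close> by itself times
  \<open>(h z + \<epsilon>) (h (I z) + \<epsilon>) / (h x h (I x))\<close>. Irreducibility makes
  \<open>p\<close> positive, so it cancels, and \<open>\<epsilon>\<close> tends to \<open>0\<close>.
  Upper bounds on \<open>h\<close> suffice because the roles of \<open>x\<close> and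
  \<open>z\<close> can be exchanged afterwards.\<close>

lemma h_J_le:
  assumes x: "x \<in> G" and z: "z \<in> G"
  shows "h_real x * h_real (J x) \<le> h_real z * h_real (J z)"
proof -
  have Jx: "J x \<in> G" using J_in[OF x] .
  interpret Px: prob_space "P (Some x)" using prob_P Some_G_space x by blast
  have cJ: "continuous_on G (\<lambda>u. h_real (J u))"
    using J_in by (intro continuous_on_compose2[OF h_real_continuous J_continuous]) auto
  have "h_real x * h_real (J x) \<le> (h_real z + \<epsilon>) * (h_real (J z) + \<epsilon>)" if \<epsilon>: "0 < \<epsilon>" for \<epsilon>
  proof -
    \<comment> \<open>A neighbourhood of \<open>z\<close> on which both \<open>h_real\<close> and
      \<open>h_real\<close> after \<open>J\<close> are controlled, one bound for each of the two
      applications.\<close>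
    define V where "V = (G \<inter> h_real -` {..<h_real z + \<epsilon>}) \<inter> (G \<inter> (\<lambda>u. h_real (J u)) -` {..<h_real (J z) + \<epsilon>})"
    have V: "open V" "V \<subseteq> G" "z \<in> V"
      unfolding V_def using \<epsilon> z continuous_open_preimage[OF h_real_continuous open_G open_lessThan]
        continuous_open_preimage[OF cJ open_G open_lessThan] by (blast intro: open_Int, auto)
    have JV: "J ` V \<subseteq> G" "J ` V \<noteq> {}" "J ` J ` V = V" "open (J ` V)"
    proof -
      show "J ` V \<subseteq> G" "J ` V \<noteq> {}" "J ` J ` V = V" using V J_in J_J by (force simp: image_image)+
      show "open (J ` V)" using V(1,2) by (rule open_J_image)
    qed
    let ?p = "emeasure (P (Some x)) {w \<in> space M. \<exists>t\<ge>0. y t w \<in> J ` V}"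
    let ?p' = "emeasure (P (Some (J x))) {w \<in> space M. \<exists>t\<ge>0. y t w \<in> V}"
    have 1: "H (J x) * ?p \<le> ennreal (h_real z + \<epsilon>) * ?p'"
      using V by (intro hitting_inversion x) (auto simp: V_def H_eq intro!: ennreal_leI)
    have "H (J (J x)) * emeasure (P (Some (J x))) {w \<in> space M. \<exists>t\<ge>0. y t w \<in> J ` J ` V} \<le>
        ennreal (h_real (J z) + \<epsilon>) * emeasure (P (Some (J (J x)))) {w \<in> space M. \<exists>t\<ge>0. y t w \<in> J ` V}"
      using V JV Jx by (intro hitting_inversion) (auto simp: V_def H_eq J_in intro!: ennreal_leI)
    then have 2: "H x * ?p' \<le> ennreal (h_real (J z) + \<epsilon>) * ?p" unfolding JV J_J[OF x] .
    have "H x * (H (J x) * ?p) \<le> H x * (ennreal (h_real z + \<epsilon>) * ?p')" using 1 by (rule mult_left_mono) simp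
    also have "\<dots> = ennreal (h_real z + \<epsilon>) * (H x * ?p')" by (simp add: mult_ac)
    also have "\<dots> \<le> ennreal (h_real z + \<epsilon>) * (ennreal (h_real (J z) + \<epsilon>) * ?p)" using 2 by (rule mult_left_mono) simp
    finally have *: "H x * (H (J x) * ?p) \<le> ennreal (h_real z + \<epsilon>) * (ennreal (h_real (J z) + \<epsilon>) * ?p)" .
    have "0 < ?p" using hits_pos[OF x JV(4,1,2)] .
    moreover define p where "p = Px.prob {w \<in> space M. \<exists>t\<ge>0. y t w \<in> J ` V}"
    moreover have "?p = ennreal p" unfolding p_def by (rule Px.emeasure_eq_measure)
    ultimately have p: "?p = ennreal p" "0 < p" by simp_all
    have pos: "0 < h_real z" "0 < h_real (J z)" "0 < h_real x" "0 < h_real (J x)" using h_real_pos z x J_in by auto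
    have "H x * (H (J x) * ?p) = ennreal (h_real x * (h_real (J x) * p))"
      using pos p by (simp only: H_eq[OF x] H_eq[OF Jx] p(1) ennreal_mult less_imp_le mult_nonneg_nonneg)
    moreover have "ennreal (h_real z + \<epsilon>) * (ennreal (h_real (J z) + \<epsilon>) * ?p) = ennreal ((h_real z + \<epsilon>) * ((h_real (J z) + \<epsilon>) * p))"
      using pos p \<epsilon> by (simp only: p(1) ennreal_mult less_imp_le mult_nonneg_nonneg add_nonneg_nonneg)
    ultimately have "h_real x * (h_real (J x) * p) \<le> (h_real z + \<epsilon>) * ((h_real (J z) + \<epsilon>) * p)"
      using * pos p \<epsilon> by (simp add: ennreal_le_iff)
    then show ?thesis using p(2) by (simp add: mult.assoc[symmetric])
  qed
  then have "\<forall>\<^sub>F \<epsilon> in at_right 0. h_real x * h_real (J x) \<le> (h_real z + \<epsilon>) * (h_real (J z) + \<epsilon>)"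
    by (auto simp: eventually_at_filter)
  moreover have "((\<lambda>\<epsilon>. (h_real z + \<epsilon>) * (h_real (J z) + \<epsilon>)) \<longlongrightarrow> (h_real z + 0) * (h_real (J z) + 0)) (at_right 0)"
    by (intro tendsto_intros)
  ultimately show ?thesis
    using tendsto_lowerbound[of "\<lambda>\<epsilon>. (h_real z + \<epsilon>) * (h_real (J z) + \<epsilon>)" _ "at_right 0"] by simp
qed

text \<open>Any base point \<open>x\<close> supplies the constant, by \<open>h_J_le\<close> in both
  directions; for an empty interior every positive constant serves.\<close>

lemma h_J_constant: "\<exists>\<kappa>>0. \<forall>z\<in>E_int S. h z * h (I z) = ennreal \<kappa>"
proof (cases "G = {}")
  case True
  then show ?thesis by (intro exI[of _ 1]) (auto simp: G_def E_int_eq)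
next
  case False
  then obtain x where x: "x \<in> G" by blast
  show ?thesis
  proof (intro exI[of _ "h_real x * h_real (J x)"] conjI ballI)
    show "0 < h_real x * h_real (J x)" using h_real_pos x J_in by simp
    fix z assume "z \<in> E_int S"
    then obtain u where u: "u \<in> G" "z = Some u" by (auto simp: E_int_eq G_def)
    have "h_real u * h_real (J u) = h_real x * h_real (J x)" using h_J_le[OF u(1) x] h_J_le[OF x u(1)] by simp
    moreover have "h z * h (I z) = H u * H (J u)" using u J_in[OF u(1)] Some_J[OF u(1)] by (simp add: H_def)
    ultimately show "h z * h (I z) = ennreal (h_real x * h_real (J x))"
      using u J_in[OF u(1)] h_real_pos[of u] by (simp add: H_eq ennreal_mult[symmetric] less_imp_le h_real_pos)
  qed
qed

end

section \<open>The Doob transform\<close>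

lemma AE_killed_kernel:
  assumes rc: "\<And>w. w \<in> space (P x) \<Longrightarrow> killed_rc S (\<lambda>t. Z t w)" and t: "0 \<le> t"
    and A: "{w \<in> space (P x). Z t w \<in> E_int S} \<in> sets (P x)"
    and Z: "Z t \<in> measurable (restrict_space (P x) {w \<in> space (P x). Z t w \<in> E_int S}) (E_borel S)"
  shows "AE z in killed_kernel S P Z (E_int S) t x. z \<in> E_int S"
proof -
  have "(\<integral>\<^sup>+z. indicator (E_space S - E_int S) z \<partial>killed_kernel S P Z (E_int S) t x) =
      (\<integral>\<^sup>+w. indicator (E_space S - E_int S) (Z t w) * indicator (E_int S) (Z t w) \<partial>P x)"
    using sets.compl_sets[OF E_int_sets, of S] by (intro nn_integral_killed_kernel rc t A Z) auto
  also have "\<dots> = (\<integral>\<^sup>+w. 0 \<partial>P x)" by (intro nn_integral_cong) (auto simp: indicator_def)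
  finally have "emeasure (killed_kernel S P Z (E_int S) t x) (E_space S - E_int S) = 0"
    using sets.compl_sets[OF E_int_sets, of S] by simp
  then have "E_space S - E_int S \<in> null_sets (killed_kernel S P Z (E_int S) t x)"
    using sets.compl_sets[OF E_int_sets, of S] by (auto intro: null_setsI)
  then show ?thesis by (rule AE_I') auto
qed

lemma sets_list_event:
  assumes "\<And>t B. (t, B) \<in> set l \<Longrightarrow> z t \<in> borel_measurable N \<and> B \<in> sets borel"
  shows "{w \<in> space N. \<forall>(t, B)\<in>set l. z t w \<in> B} \<in> sets N"
proof -
  have "{w \<in> space N. z (fst p) w \<in> snd p} \<in> sets N" if "p \<in> set l" for p
    using measurable_sets[of "z (fst p)" N borel "snd p"] assms[of "fst p" "snd p"] that
    by (simp add: vimage_def Int_def conj_commute)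
  then have "{w \<in> space N. \<forall>p\<in>set l. z (fst p) w \<in> snd p} \<in> sets N"
    by (intro sets.sets_Collect_finite_All) auto
  then show ?thesis by (simp add: case_prod_beta)
qed

lemma fdd_cong:
  assumes "sorted_wrt (<) (map fst l)" "\<And>t B. (t, B) \<in> set l \<Longrightarrow> s \<le> t"
    and "\<And>t y. 0 \<le> t \<Longrightarrow> y \<in> E \<Longrightarrow> K t y = K' t y" "\<And>t y. 0 \<le> t \<Longrightarrow> y \<in> E \<Longrightarrow> space (K t y) = E" "x \<in> E"
  shows "fdd K x s l = fdd K' x s l"
  using assms(1,2,5)
proof (induction l arbitrary: s x)
  case (Cons p l)
  obtain t B where p: "p = (t, B)" by force
  have st: "0 \<le> t - s" using Cons.prems p by auto
  have "(\<integral>\<^sup>+z. indicator B z * fdd K z t l \<partial>K (t - s) x) = (\<integral>\<^sup>+z. indicator B z * fdd K' z t l \<partial>K (t - s) x)"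
  proof (rule nn_integral_cong)
    fix z assume "z \<in> space (K (t - s) x)"
    then have "z \<in> E" using assms(4)[OF st Cons.prems(3)] by simp
    then have "fdd K z t l = fdd K' z t l" using Cons.prems p by (intro Cons.IH) (auto intro: less_imp_le)
    then show "indicator B z * fdd K z t l = indicator B z * fdd K' z t l" by simp
  qed
  then show ?case using assms(3)[OF st Cons.prems(3)] by (simp add: p)
qed simp

context inversion_process
begin

lemma inverse_h_measurable [measurable]: "(\<lambda>x. inverse (h x)) \<in> borel_measurable (E_borel S)"
  by measurable

lemma inverse_h_pos: "x \<in> E_int S \<Longrightarrow> 0 < inverse (h x) \<and> inverse (h x) < \<infinity>"
  using h_pos[of x] by (auto simp: ennreal_inverse_positive less_top[symmetric] zero_less_iff_neq_zero)

lemma h_inverse: "x \<in> E_int S \<Longrightarrow> h x * inverse (h x) = 1"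
  using ennreal_divide_self[of "h x"] h_pos[of x] by (auto simp: divide_ennreal_def)

lemma inverse_inverse_h: "x \<in> E_int S \<Longrightarrow> inverse (inverse (h x)) = h x"
  using h_pos[of x] by (cases "h x") (auto simp: inverse_ennreal)

lemma inverse_h_cancel:
  assumes x: "x \<in> E_int S" and z: "z \<in> E_int S"
  shows "h z / h x * (inverse (h z) / inverse (h x) * a) = a"
proof -
  have "h z * inverse (h z) = 1" "h x * inverse (h x) = 1"
    using h_inverse x z by simp_all
  have "h z / h x * (inverse (h z) / inverse (h x) * a) = (h z * inverse (h z)) * (h x * inverse (h x)) * a"
    unfolding divide_ennreal_def inverse_inverse_h[OF x] by (simp only: mult_ac)
  also have "\<dots> = a" using \<open>h z * inverse (h z) = 1\<close> \<open>h x * inverse (h x) = 1\<close> by simp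
  finally show ?thesis .
qed

lemma E_intE:
  assumes "z \<in> E_int S"
  obtains u where "u \<in> G" "z = Some u"
  using assms by (auto simp: E_int_eq G_def)

text \<open>Absorption makes the events of being alive at time \<open>t\<close> increase as
  \<open>t\<close> decreases, and by right-continuity almost every path started in
  \<open>E_int S\<close> is alive for a short time. This is the convergence at \<open>0\<close>
  behind the excessiveness of \<open>1/h\<close>.\<close>

lemma tendsto_alive_probability:
  assumes x: "x \<in> E_int S"
  shows "((\<lambda>t. \<integral>\<^sup>+w. indicator (E_int S) (X t w) \<partial>P x) \<longlongrightarrow> 1) (at_right 0)"
proof (rule tendsto_at_right_sequentially[where b=1])
  fix s :: "nat \<Rightarrow> real" assume s: "\<And>n. 0 < s n" "decseq s" "s \<longlonglongrightarrow> 0"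
  have xE: "x \<in> E_space S" using x E_int_subset by blast
  interpret Px: prob_space "P x" using prob_P[OF xE] .
  define A where "A n = {w \<in> space M. X (s n) w \<in> E_int S}" for n
  have A: "A n \<in> sets (P x)" for n
    using measurable_sets[OF measurable_X_P[of "s n" x] E_int_sets] s(1)[of n] xE
    by (simp add: A_def vimage_def Int_def conj_commute)
  have inc: "incseq A"
  proof (rule monoI)
    fix m n :: nat assume "m \<le> n"
    then have "s n \<le> s m" using s(2) by (simp add: decseq_def)
    show "A m \<subseteq> A n"
    proof
      fix w assume w: "w \<in> A m"
      have "X (s n) w \<in> E_int S"
      proof (rule ccontr)
        assume *: "X (s n) w \<notin> E_int S"
        then have "X (s m) w = X (s n) w"
          using absorbed[of "s n" "s m" w] s(1)[of n] \<open>s n \<le> s m\<close> w by (simp add: A_def)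
        then show False using * w by (simp add: A_def)
      qed
      then show "w \<in> A n" using w by (simp add: A_def)
    qed
  qed
  have "(\<lambda>n. emeasure (P x) (A n)) \<longlonglongrightarrow> emeasure (P x) (\<Union>n. A n)"
    using A inc by (intro Lim_emeasure_incseq) auto
  also have "emeasure (P x) (\<Union>n. A n) = emeasure (P x) (space (P x))"
  proof (rule emeasure_eq_AE)
    show "AE w in P x. w \<in> (\<Union>n. A n) \<longleftrightarrow> w \<in> space (P x)"
      using normal[OF xE] AE_space
    proof eventually_elim
      case (elim w)
      then have wM: "w \<in> space M" using xE by simp
      interpret killed_path G c "\<lambda>t. y t w" using killed_path_y[OF wM] .
      have "y 0 w \<in> G" using elim x by (simp add: y_alive)
      then obtain e where e: "e > 0" "\<forall>r. 0 \<le> r \<and> r < 0 + e \<longrightarrow> y r w \<in> G" using right_nhd[of 0 G] open_G by blast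
      have "\<forall>\<^sub>F n in sequentially. s n < e" using s(3) e(1) by (rule order_tendstoD)
      then obtain n where "s n < e" by (auto simp: eventually_sequentially)
      then have "y (s n) w \<in> G" using e(2) s(1)[of n] by simp
      then have "w \<in> A n" using wM by (simp add: A_def y_alive)
      then show ?case using wM xE by auto
    qed
  qed (use A in auto)
  finally have "(\<lambda>n. emeasure (P x) (A n)) \<longlonglongrightarrow> 1" by (simp add: Px.emeasure_space_1)
  also have "(\<lambda>n. emeasure (P x) (A n)) = (\<lambda>n. \<integral>\<^sup>+w. indicator (E_int S) (X (s n) w) \<partial>P x)"
  proof
    fix n
    have "emeasure (P x) (A n) = (\<integral>\<^sup>+w. indicator (A n) w \<partial>P x)" using A by simp
    also have "\<dots> = (\<integral>\<^sup>+w. indicator (E_int S) (X (s n) w) \<partial>P x)"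
      using xE by (intro nn_integral_cong) (simp add: A_def indicator_def)
    finally show "emeasure (P x) (A n) = (\<integral>\<^sup>+w. indicator (E_int S) (X (s n) w) \<partial>P x)" .
  qed
  finally show "(\<lambda>n. \<integral>\<^sup>+w. indicator (E_int S) (X (s n) w) \<partial>P x) \<longlonglongrightarrow> 1" .
qed simp

section \<open>An arbitrary right-continuous version of the Doob transform\<close>

context
  fixes Q :: "'a option \<Rightarrow> 'v measure" and Y :: "real \<Rightarrow> 'v \<Rightarrow> 'a option"
  assumes Y: "doob_transform S P X h Q Y"
begin

lemma prob_Q: "x \<in> E_space S \<Longrightarrow> prob_space (Q x)"
  and Y_measurable: "x \<in> E_space S \<Longrightarrow> 0 \<le> t \<Longrightarrow> Y t \<in> measurable (Q x) (E_borel S)"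
  and killed_rc_Y: "x \<in> E_space S \<Longrightarrow> w \<in> space (Q x) \<Longrightarrow> killed_rc S (\<lambda>t. Y t w)"
  and Y_law: "x \<in> E_space S \<Longrightarrow> has_law S (Q x) Y (lifetime S Y) (doob_kernel S P X h) x"
  using Y unfolding doob_transform_def killed_rc_def by blast+

text \<open>The one-dimensional case of \<open>has_law\<close>: events at a single time determine
  the kernel.\<close>

lemma killed_kernel_Y:
  assumes x: "x \<in> E_space S" and t: "0 \<le> t"
  shows "killed_kernel S Q Y (E_int S) t x = doob_kernel S P X h t x"
proof (rule measure_eqI)
  fix B assume "B \<in> sets (killed_kernel S Q Y (E_int S) t x)"
  then have B: "B \<in> sets (E_borel S)" by simp
  have alive: "{w \<in> space (Q x). ennreal t < lifetime S Y w} = {w \<in> space (Q x). Y t w \<in> E_int S}"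
    using less_lifetime_iff[where Z=Y, OF killed_rc_Y[OF x] t] by blast
  have A: "{w \<in> space (Q x). Y t w \<in> E_int S} \<in> sets (Q x)"
    using measurable_sets[OF Y_measurable[OF x t] E_int_sets] by (simp add: vimage_def Int_def conj_commute)
  have m: "Y t \<in> measurable (restrict_space (Q x) {w \<in> space (Q x). Y t w \<in> E_int S}) (E_borel S)"
    using Y_measurable[OF x t] by (rule measurable_restrict_space1)
  have "emeasure (killed_kernel S Q Y (E_int S) t x) B =
      emeasure (restrict_space (Q x) {w \<in> space (Q x). Y t w \<in> E_int S}) (Y t -` B \<inter> {w \<in> space (Q x). Y t w \<in> E_int S})"
    unfolding killed_kernel_def alive using emeasure_distr[OF m B] A by (simp add: space_restrict_space Int_absorb1 Collect_restrict)
  also have "\<dots> = emeasure (Q x) (Y t -` B \<inter> {w \<in> space (Q x). Y t w \<in> E_int S})"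
    using A by (intro emeasure_restrict_space) auto
  also have "Y t -` B \<inter> {w \<in> space (Q x). Y t w \<in> E_int S} =
      {w \<in> space (Q x). \<forall>(t, B)\<in>set [(t, B)]. ennreal t < lifetime S Y w \<and> Y t w \<in> B}"
    using less_lifetime_iff[where Z=Y, OF killed_rc_Y[OF x] t] by auto
  also have "emeasure (Q x) \<dots> = fdd (doob_kernel S P X h) x 0 [(t, B)]"
    using Y_law[OF x] B t unfolding has_law_def by (elim allE[of _ "[(t, B)]"]) auto
  also have "\<dots> = emeasure (doob_kernel S P X h t x) B"
    using B by (simp add: nn_integral_indicator)
  finally show "emeasure (killed_kernel S Q Y (E_int S) t x) B = emeasure (doob_kernel S P X h t x) B" .
qed simp

text \<open>The weight \<open>h\<close> of the transform cancels \<open>1/h\<close> and leaves the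
  survival probability of \<open>X\<close>. Excessiveness of \<open>1/h\<close> follows, since
  survival probabilities are at most 1 and tend to 1 at alive points.\<close>

lemma nn_integral_killed_Y:
  assumes x: "x \<in> E_space S" and t: "0 \<le> t"
  shows "(\<integral>\<^sup>+z. inverse (h z) \<partial>killed_kernel S Q Y (E_int S) t x) =
    (if x \<in> doob_set S h then inverse (h x) * (\<integral>\<^sup>+w. indicator (E_int S) (X t w) \<partial>P x) else 0)"
proof -
  have [measurable]: "X t \<in> measurable (P x) (E_borel S)" using measurable_X_P[OF t x] .
  have "(\<integral>\<^sup>+w. h (X t w) / h x * inverse (h (X t w)) * indicator (E_int S) (X t w) \<partial>P x) =
      (\<integral>\<^sup>+w. inverse (h x) * indicator (E_int S) (X t w) \<partial>P x)"
  proof (rule nn_integral_cong)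
    fix w
    show "h (X t w) / h x * inverse (h (X t w)) * indicator (E_int S) (X t w) = inverse (h x) * indicator (E_int S) (X t w)"
    proof (cases "X t w \<in> E_int S")
      case True
      then have "h (X t w) * inverse (h (X t w)) = 1"
        by (rule h_inverse)
      then show ?thesis using True by (simp add: divide_ennreal_def mult_ac)
    qed simp
  qed
  also have "\<dots> = inverse (h x) * (\<integral>\<^sup>+w. indicator (E_int S) (X t w) \<partial>P x)"
    by (rule nn_integral_cmult) measurable
  finally show ?thesis
    unfolding killed_kernel_Y[OF x t] using nn_integral_doob_kernel[OF h_measurable h_pos t x inverse_h_measurable] by simp
qed

text \<open>Transforming back: the two weights cancel and the killed semigroup of \<open>X\<close>
  remains. A dead \<open>x\<close> may still belong to the Doob set, as \<open>h\<close> can be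
  positive and finite there; then \<open>X\<close> is dead from the start and both sides
  vanish.\<close>

lemma doob_kernel_Y:
  assumes x: "x \<in> E_space S" and t: "0 \<le> t"
  shows "doob_kernel S Q Y (\<lambda>z. inverse (h z)) t x = doob_kernel S P X (\<lambda>_. 1) t x"
proof (rule measure_eqI)
  fix B assume "B \<in> sets (doob_kernel S Q Y (\<lambda>z. inverse (h z)) t x)"
  then have B[measurable]: "B \<in> sets (E_borel S)" by simp
  have [measurable]: "X t \<in> measurable (P x) (E_borel S)" using measurable_X_P[OF t x] .
  have inv: "doob_set S (\<lambda>z. inverse (h z)) \<inter> E_int S = E_int S"
    using inverse_h_pos by (rule doob_set_Int_E_int)
  have one: "emeasure (doob_kernel S P X (\<lambda>_. 1) t x) B = (\<integral>\<^sup>+w. indicator B (X t w) * indicator (E_int S) (X t w) \<partial>P x)"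
  proof -
    have "emeasure (doob_kernel S P X (\<lambda>_. 1) t x) B = (\<integral>\<^sup>+z. indicator B z \<partial>doob_kernel S P X (\<lambda>_. 1) t x)"
      using B by simp
    also have "\<dots> = (\<integral>\<^sup>+w. indicator B (X t w) * indicator (E_int S) (X t w) \<partial>P x)"
      using x by (subst nn_integral_doob_kernel[OF _ _ t x]) (auto simp: doob_set_def)
    finally show ?thesis .
  qed
  show "emeasure (doob_kernel S Q Y (\<lambda>z. inverse (h z)) t x) B = emeasure (doob_kernel S P X (\<lambda>_. 1) t x) B"
  proof (cases "x \<in> doob_set S (\<lambda>z. inverse (h z))")
    case True
    then have dx: "x \<in> doob_set S h"
      by (auto simp: doob_set_def zero_less_iff_neq_zero less_top[symmetric])
    have "emeasure (doob_kernel S Q Y (\<lambda>z. inverse (h z)) t x) B =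
        (\<integral>\<^sup>+z. inverse (h z) / inverse (h x) * indicator B z \<partial>doob_kernel S P X h t x)"
      using True B unfolding doob_kernel_def[of S Q] inv killed_kernel_Y[OF x t]
      by (simp, subst emeasure_density) (simp_all add: measurable_cong_sets[OF sets_doob_kernel refl])
    also have "\<dots> = (\<integral>\<^sup>+w. h (X t w) / h x * (inverse (h (X t w)) / inverse (h x) * indicator B (X t w)) * indicator (E_int S) (X t w) \<partial>P x)"
      using dx by (subst nn_integral_doob_kernel[OF h_measurable h_pos t x]) auto
    also have "\<dots> = (\<integral>\<^sup>+w. indicator B (X t w) * indicator (E_int S) (X t w) \<partial>P x)"
    proof (cases "x \<in> E_int S")
      case xi: True
      show ?thesis
      proof (rule nn_integral_cong)
        fix w
        show "h (X t w) / h x * (inverse (h (X t w)) / inverse (h x) * indicator B (X t w)) * indicator (E_int S) (X t w) =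
            indicator B (X t w) * indicator (E_int S) (X t w)"
          using inverse_h_cancel[OF xi, of "X t w" "indicator B (X t w)"] by (cases "X t w \<in> E_int S") auto
      qed
    next
      case False
      show ?thesis
      proof (rule nn_integral_cong_AE)
        show "AE w in P x. h (X t w) / h x * (inverse (h (X t w)) / inverse (h x) * indicator B (X t w)) * indicator (E_int S) (X t w) =
            indicator B (X t w) * indicator (E_int S) (X t w)"
          using dead_from_start[OF x False t] by eventually_elim simp
      qed
    qed
    finally show ?thesis using one by simp
  next
    case False
    then have xi: "x \<notin> E_int S" using inv by blast
    have "(\<integral>\<^sup>+w. indicator B (X t w) * indicator (E_int S) (X t w) \<partial>P x) = (\<integral>\<^sup>+w. 0 \<partial>P x)"
    proof (rule nn_integral_cong_AE)
      show "AE w in P x. indicator B (X t w) * indicator (E_int S) (X t w) = (0::ennreal)"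
        using dead_from_start[OF x xi t] by eventually_elim simp
    qed
    then show ?thesis using False one by (simp add: doob_kernel_def)
  qed
qed simp

definition y_Y :: "real \<Rightarrow> 'v \<Rightarrow> 'a" where "y_Y t w = alive_point S (Y t w)"

text \<open>The inversion property read at \<open>J x\<close>: the inverted path from
  \<open>J x\<close> is a Doob transform started at \<open>J (J x) = x\<close>. Both laws are given
  on alive cylinders, which determine them.\<close>

lemma y_Y_law:
  assumes x: "x \<in> G"
  shows "distr (Q (Some x)) (PiM {0..} (\<lambda>_. borel)) (\<lambda>w. \<lambda>t\<in>{0..}. y_Y t w) =
    distr (P (Some (J x))) (PiM {0..} (\<lambda>_. borel)) (\<lambda>w. \<lambda>t\<in>{0..}. W t w)"
proof -
  have xE: "Some x \<in> E_space S" "Some (J x) \<in> E_space S" using Some_G_space x J_in by auto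
  interpret Qx: prob_space "Q (Some x)" using prob_Q[OF xE(1)] .
  interpret Px: prob_space "P (Some (J x))" using prob_P[OF xE(2)] .
  show ?thesis
  proof (rule distr_eq_of_alive_cylinders)
    show "finite_measure (Q (Some x))" "finite_measure (P (Some (J x)))" by unfold_locales
    show "G \<in> sets borel" "0 \<notin> G" using open_G zero_G by auto
    show "y_Y i \<in> borel_measurable (Q (Some x))" if "i \<in> {0..}" for i
    proof -
      have [measurable]: "Y i \<in> measurable (Q (Some x)) (E_borel S)" using Y_measurable[OF xE(1)] that by simp
      show ?thesis unfolding y_Y_def[abs_def] by measurable
    qed
    show "y_Y i w \<in> insert 0 G" for i w by (auto simp: y_Y_def G_def alive_point_def E_int_eq)
    show "W i \<in> borel_measurable (P (Some (J x)))" if "i \<in> {0..}" for i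
      using W_measurable_P xE(2) that by auto
    show "W i w \<in> insert 0 G" if "i \<in> {0..}" "w \<in> space (P (Some (J x)))" for i w
      using W_range that xE by auto
  next
    fix K :: "real set" and A :: "real \<Rightarrow> 'a set"
    assume K: "finite K" "K \<subseteq> {0..}" and A: "\<And>i. i \<in> K \<Longrightarrow> A i \<in> sets borel \<and> A i \<subseteq> G"
    have sc: "set (cylinder_list K A) = (\<lambda>i. (i, Some ` A i)) ` K"
      by (rule set_cylinder_list) (use K A in auto)
    have cl: "sorted_wrt (<) (map fst (cylinder_list K A))"
      by (rule cylinder_list) (use K A in auto)
    have cl': "0 \<le> t \<and> B \<in> sets (E_borel S)" if "(t, B) \<in> set (cylinder_list K A)" for t B
      by (rule cylinder_list(2)[OF _ _ _ that]) (use K A in auto)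
    have "emeasure (P (Some (J x))) {w \<in> space M. \<forall>i\<in>K. W i w \<in> A i} = fdd (doob_kernel S P X h) (Some (J (J x))) 0 (cylinder_list K A)"
      by (rule W_cylinder_fdd) (use K A J_in[OF x] in auto)
    also have "\<dots> = fdd (doob_kernel S P X h) (Some x) 0 (cylinder_list K A)" by (simp only: J_J[OF x])
    also have "\<dots> = emeasure (Q (Some x)) {w \<in> space (Q (Some x)). \<forall>(t, B)\<in>set (cylinder_list K A). ennreal t < lifetime S Y w \<and> Y t w \<in> B}"
      using Y_law[OF xE(1)] cl cl' unfolding has_law_def by auto
    also have "{w \<in> space (Q (Some x)). \<forall>(t, B)\<in>set (cylinder_list K A). ennreal t < lifetime S Y w \<and> Y t w \<in> B} =
        {w \<in> space (Q (Some x)). \<forall>i\<in>K. y_Y i w \<in> A i}"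
    proof -
      have E: "ennreal i < lifetime S Y w \<and> Y i w \<in> Some ` A i \<longleftrightarrow> y_Y i w \<in> A i"
        if w: "w \<in> space (Q (Some x))" and i: "i \<in> K" for w i
      proof -
        have "0 \<le> i" using K(2) i by (meson atLeast_iff subsetD)
        note lt = less_lifetime_iff[where Z=Y and w=w, OF killed_rc_Y[OF xE(1) w] this]
        show ?thesis
        proof
          assume "ennreal i < lifetime S Y w \<and> Y i w \<in> Some ` A i"
          then show "y_Y i w \<in> A i" using A[OF i] by (auto simp: y_Y_def G_def)
        next
          assume *: "y_Y i w \<in> A i"
          then have "y_Y i w \<in> alive_set S" using A[OF i] by (auto simp: G_def)
          then have "Y i w \<in> E_int S" by (simp add: y_Y_def)
          then show "ennreal i < lifetime S Y w \<and> Y i w \<in> Some ` A i"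
            using * lt Some_alive_point[of "Y i w" S] by (auto simp: y_Y_def intro: image_eqI[of _ _ "y_Y i w"])
        qed
      qed
      then show ?thesis unfolding sc by (intro Collect_cong conj_cong refl) (simp add: E cong: ball_cong)
    qed
    finally show "emeasure (Q (Some x)) {w \<in> space (Q (Some x)). \<forall>i\<in>K. y_Y i w \<in> A i} =
      emeasure (P (Some (J x))) {w \<in> space (P (Some (J x))). \<forall>i\<in>K. W i w \<in> A i}"
      using xE by simp
  qed
qed

text \<open>By \<open>y_Y_law\<close>, inverting \<open>Y\<close> amounts in law to inverting
  \<open>W\<close>, that is, to inverting \<open>X\<close> from \<open>I x\<close> twice, which
  gives back the path. So the law is that of \<open>X\<close> started at \<open>I x\<close> and
  killed at its lifetime, which is the transform of \<open>X^h\<close> by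
  \<open>1/h\<close>.\<close>

lemma Y_IP_law:
  assumes x: "x \<in> E_space S"
  shows "has_law S (Q x) (\<lambda>t w. I (Y (time_change S v Y t w) w)) (clock S v Y \<infinity>)
      (doob_kernel S Q Y (\<lambda>z. inverse (h z))) (I x)"
  unfolding has_law_def
proof (intro allI impI)
  fix l :: "(real \<times> 'a option set) list"
  assume l: "sorted_wrt (<) (map fst l) \<and> (\<forall>(t, B)\<in>set l. 0 \<le> t \<and> B \<in> sets (E_borel S))"
  have l0: "0 \<le> t" "B \<in> sets (E_borel S)" if "(t, B) \<in> set l" for t B using l that by auto
  interpret Qx: prob_space "Q x" using prob_Q[OF x] .
  have IxE: "I x \<in> E_space S" using I_space[OF x] .
  let ?A = "{w \<in> space (Q x). \<forall>(t, B)\<in>set l. ennreal t < clock S v Y \<infinity> w \<and> I (Y (time_change S v Y t w) w) \<in> B}"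
  have rhs: "fdd (doob_kernel S Q Y (\<lambda>z. inverse (h z))) (I x) 0 l = fdd (doob_kernel S P X (\<lambda>_. 1)) (I x) 0 l"
    using l l0 IxE doob_kernel_Y
    by (intro fdd_cong[where E="E_space S"]) auto
  show "emeasure (Q x) ?A = fdd (doob_kernel S Q Y (\<lambda>z. inverse (h z))) (I x) 0 l"
  proof (cases "l = []")
    case True
    then show ?thesis by (simp add: Qx.emeasure_space_1)
  next
    case ne: False
    have ev: "ennreal t < clock S v Y \<infinity> w \<and> I (Y (time_change S v Y t w) w) \<in> B \<longleftrightarrow>
        time_changed c J (\<lambda>s. y_Y s w) t \<in> {u \<in> G. Some u \<in> B}" if "w \<in> space (Q x)" "0 \<le> t" for t w B
      using time_changed_event[where Z=Y and w=w and I=I and J=J and B=B, OF v_continuous v_pos killed_rc_Y[OF x that(1)] I_E_int that(2)]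
      by (simp add: c_def G_def y_Y_def[abs_def] J_def)
    show ?thesis
    proof (cases "x \<in> E_int S")
      \<comment> \<open>At a dead start the clock of \<open>Y\<close> is almost surely zero, so the
        event is null; the right-hand side vanishes because \<open>I x\<close> is dead too.\<close>
      case False
      have "AE w in Q x. w \<notin> ?A"
      proof -
        have Y0: "{w \<in> space (Q x). Y 0 w \<in> E_int S} \<in> sets (Q x)"
          using measurable_sets[OF Y_measurable[OF x order_refl] E_int_sets] by (simp add: vimage_def Int_def conj_commute)
        have "emeasure (Q x) {w \<in> space (Q x). \<forall>(t, B)\<in>set [(0, E_int S)]. ennreal t < lifetime S Y w \<and> Y t w \<in> B} =
            fdd (doob_kernel S P X h) x 0 [(0, E_int S)]"
          using Y_law[OF x] E_int_sets[of S] unfolding has_law_def by (elim allE[of _ "[(0, E_int S)]"]) auto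
        also have "\<dots> = 0" using x False h_pos by (intro fdd_doob_dead) auto
        also have "{w \<in> space (Q x). \<forall>(t, B)\<in>set [(0, E_int S)]. ennreal t < lifetime S Y w \<and> Y t w \<in> B} = {w \<in> space (Q x). Y 0 w \<in> E_int S}"
          using less_lifetime_iff[where Z=Y, OF killed_rc_Y[OF x] order_refl] by auto
        finally have "AE w in Q x. w \<notin> {w \<in> space (Q x). Y 0 w \<in> E_int S}"
          using Y0 by (intro AE_not_in) (auto intro: null_setsI)
        with AE_space show ?thesis
        proof eventually_elim
          case (elim w)
          show ?case
          proof
            assume w: "w \<in> ?A"
            obtain t B where tB: "(t, B) \<in> set l" using ne by (cases l) auto
            interpret killed_path "alive_set S" c "\<lambda>t. y_Y t w"
              using killed_domain_axioms killed_rc_path[OF killed_rc_Y[OF x elim(1)]]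
              by (simp add: killed_path_def killed_path_axioms_def G_def y_Y_def)
            have "y_Y 0 w \<notin> alive_set S" using elim by (simp add: y_Y_def)
            then have "emeasure (occupation c (\<lambda>t. y_Y t w)) ({0..}) = 0" by (intro occupation_after_death) auto
            moreover have "emeasure (occupation c (\<lambda>t. y_Y t w)) UNIV = emeasure (occupation c (\<lambda>t. y_Y t w)) {0..}"
              using AE_occupation by (intro emeasure_eq_AE) auto
            ultimately have "total_clock c (\<lambda>t. y_Y t w) = 0" by (simp add: total_clock_def)
            then have "time_changed c J (\<lambda>s. y_Y s w) t = 0" by (simp add: time_changed_def)
            then have "\<not> (ennreal t < clock S v Y \<infinity> w \<and> I (Y (time_change S v Y t w) w) \<in> B)"
              using ev[OF elim(1) l0(1)[OF tB], of B] zero_G by auto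
            then show False using w tB by auto
          qed
        qed
      qed
      then obtain N where N: "{w \<in> space (Q x). \<not> w \<notin> ?A} \<subseteq> N" "emeasure (Q x) N = 0" "N \<in> sets (Q x)" by (rule AE_E)
      have "emeasure (Q x) ?A \<le> emeasure (Q x) N" using N by (intro emeasure_mono) auto
      then have "emeasure (Q x) ?A = 0" using N by simp
      moreover have "fdd (doob_kernel S P X (\<lambda>_. 1)) (I x) 0 l = 0"
        using l l0 ne IxE I_dead[OF x False] by (intro fdd_doob_dead) auto
      ultimately show ?thesis using rhs by simp
    next
      case True
      then obtain u where u: "u \<in> G" "x = Some u" by (rule E_intE)
      have Ju: "J u \<in> G" "I x = Some (J u)" using J_in[OF u(1)] Some_J[OF u(1)] u by auto
      define l' where "l' = map (\<lambda>(t, B). (t, {u \<in> G. Some u \<in> B})) l"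
      have l': "0 \<le> t \<and> B \<in> sets borel" if "(t, B) \<in> set l'" for t B
        using that l0 Some_vimage_sets[of _ S] by (auto simp: l'_def G_def)
      have "?A = {w \<in> space (Q x). \<forall>(t, B)\<in>set l'. time_changed c J (\<lambda>s. y_Y s w) t \<in> B}"
        using ev l0 by (fastforce simp: l'_def)
      then have "emeasure (Q x) ?A = emeasure (Q x) {w \<in> space (Q x). \<forall>(t, B)\<in>set l'. time_changed c J (\<lambda>s. y_Y s w) t \<in> B}"
        by simp
      \<comment> \<open>The time change is a measurable functional of the path, so equality of the
        path laws carries over to it.\<close>
      also have "\<dots> = emeasure (P (Some (J u))) {w \<in> space (P (Some (J u))). \<forall>(t, B)\<in>set l'. time_changed c J (\<lambda>s. W s w) t \<in> B}"
      proof (rule time_changed_law_eq)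
        show "y_Y t \<in> borel_measurable (Q x)" if "0 \<le> t" for t
          unfolding y_Y_def[abs_def] using Y_measurable[OF x that] by measurable
        show "rc_path G (\<lambda>t. y_Y t w)" if "w \<in> space (Q x)" for w
          unfolding y_Y_def G_def using killed_rc_path[OF killed_rc_Y[OF x that]] .
        show "W t \<in> borel_measurable (P (Some (J u)))" if "0 \<le> t" for t using W_measurable_Some[OF that Ju(1)] .
        show "rc_path G (\<lambda>t. W t w)" if "w \<in> space (P (Some (J u)))" for w using rc_W that Ju by simp
        show "distr (Q x) (PiM {0..} (\<lambda>_. borel)) (\<lambda>w. \<lambda>t\<in>{0..}. y_Y t w) =
            distr (P (Some (J u))) (PiM {0..} (\<lambda>_. borel)) (\<lambda>w. \<lambda>t\<in>{0..}. W t w)"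
          using y_Y_law[OF u(1)] u by simp
      qed (rule l')
      \<comment> \<open>Here \<open>v (v \<circ> I) = 1\<close> enters, through \<open>c_J\<close>:
        inverting twice gives back every path whose clock is finite before death, that is, almost
        every path.\<close>
      also have "\<dots> = emeasure (P (Some (J u))) {w \<in> space (P (Some (J u))). \<forall>(t, B)\<in>set l'. y t w \<in> B}"
      proof (rule emeasure_eq_AE)
        show "AE w in P (Some (J u)). (w \<in> {w \<in> space (P (Some (J u))). \<forall>(t, B)\<in>set l'. time_changed c J (\<lambda>s. W s w) t \<in> B}) =
            (w \<in> {w \<in> space (P (Some (J u))). \<forall>(t, B)\<in>set l'. y t w \<in> B})"
          using AE_finite_clock[OF Some_G_space[OF Ju(1)]]
        proof eventually_elim
          case (elim w)
          then interpret inverted_finite_path G c J "\<lambda>t. y t w" .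
          have "time_changed c J (\<lambda>s. W s w) t = y t w" if "0 \<le> t" for t
            using time_changed_time_changed[OF c_J that] by (simp add: W_def[abs_def])
          then show ?case using l' by fastforce
        qed
        have "(\<lambda>w. time_changed c J (\<lambda>s. W s w) t) \<in> borel_measurable (P (Some (J u)))" if "0 \<le> t" for t
          using W_measurable_Some rc_W Ju that by (intro time_changed_rc_measurable) auto
        then show "{w \<in> space (P (Some (J u))). \<forall>(t, B)\<in>set l'. time_changed c J (\<lambda>s. W s w) t \<in> B} \<in> sets (P (Some (J u)))"
          using l' by (intro sets_list_event) auto
        show "{w \<in> space (P (Some (J u))). \<forall>(t, B)\<in>set l'. y t w \<in> B} \<in> sets (P (Some (J u)))"
          using l' y_measurable_Some[OF _ Ju(1)] by (intro sets_list_event) auto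
      qed
      also have "\<dots> = (\<integral>\<^sup>+w. indicator {w \<in> space M. \<forall>(t, B)\<in>set l. X t w \<in> B \<inter> E_int S} w * 1 \<partial>P (I x))"
      proof -
        have "y t w \<in> {u \<in> G. Some u \<in> B} \<longleftrightarrow> X t w \<in> B \<inter> E_int S" for t w B
          using Some_y[of t w] y_alive[of t w] by auto
        moreover have "(\<forall>(t, B)\<in>set l'. y t w \<in> B) \<longleftrightarrow> (\<forall>(t, B)\<in>set l. y t w \<in> {u \<in> G. Some u \<in> B})" for w
          by (simp add: l'_def case_prod_beta')
        ultimately have eq: "{w \<in> space (P (Some (J u))). \<forall>(t, B)\<in>set l'. y t w \<in> B} = {w \<in> space M. \<forall>(t, B)\<in>set l. X t w \<in> B \<inter> E_int S}"
          using Ju by (simp only: space_Some)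
        have "{w \<in> space (P (Some (J u))). \<forall>(t, B)\<in>set l'. y t w \<in> B} \<in> sets (P (Some (J u)))"
          using l' y_measurable_Some[OF _ Ju(1)] by (intro sets_list_event) auto
        then show ?thesis unfolding eq Ju(2) by simp
      qed
      also have "\<dots> = 1 * fdd (doob_kernel S P X (\<lambda>_. 1)) (I x) 0 l"
        using l l0 ne I_E_int[OF True] by (intro fdd_doob[symmetric, where \<rho>="\<lambda>_. 1"]) auto
      finally show ?thesis using rhs by simp
    qed
  qed
qed

lemma has_IP_doob_transform: "has_IP S Q Y I (\<lambda>x. inverse (h x)) v"
  unfolding has_IP_def
proof (intro conjI)
  show "\<forall>x\<in>E_space S. I x \<in> E_space S \<and> I (I x) = x" using I_space I_I by blast
  show "\<exists>x\<in>E_space S. I x \<noteq> x" using IP unfolding has_IP_def by blast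
  show "\<forall>x\<in>E_int S. 0 < inverse (h x) \<and> inverse (h x) < \<infinity>" using inverse_h_pos by blast
  show "\<forall>x\<in>E_int S. 0 < v x" by (rule v_pos)
  show "continuous_map (subtopology (E_top S) (E_int S)) euclideanreal v" by (rule v_continuous)
  show "\<forall>x\<in>E_space S. has_law S (Q x) (\<lambda>t w. I (Y (time_change S v Y t w) w)) (clock S v Y \<infinity>)
      (doob_kernel S Q Y (\<lambda>x. inverse (h x))) (I x)" using Y_IP_law by blast
  show "excessive S Q Y (\<lambda>x. inverse (h x))"
    unfolding excessive_def
  proof (intro conjI ballI allI impI)
    show "(\<lambda>x. inverse (h x)) \<in> borel_measurable (E_borel S)" by measurable
    fix x t assume x: "x \<in> E_space S" and t: "0 \<le> (t::real)"
    interpret Px: prob_space "P x" using prob_P[OF x] .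
    have "(\<integral>\<^sup>+w. indicator (E_int S) (X t w) \<partial>P x) \<le> (\<integral>\<^sup>+w. 1 \<partial>P x)"
      by (intro nn_integral_mono) (auto simp: indicator_def)
    also have "\<dots> = 1" by (simp add: Px.emeasure_space_1)
    finally have "inverse (h x) * (\<integral>\<^sup>+w. indicator (E_int S) (X t w) \<partial>P x) \<le> inverse (h x) * 1"
      by (rule mult_left_mono) simp
    then show "(\<integral>\<^sup>+z. inverse (h z) \<partial>killed_kernel S Q Y (E_int S) t x) \<le> inverse (h x)"
      using nn_integral_killed_Y[OF x t] by simp
  next
    fix x assume x: "x \<in> E_int S"
    then have xE: "x \<in> E_space S" using E_int_subset by blast
    have dx: "x \<in> doob_set S h" using h_pos[OF x] xE by (simp add: doob_set_def)
    have "inverse (h x) < top" using inverse_h_pos[OF x] by simp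
    from ennreal_tendsto_cmult[OF this tendsto_alive_probability[OF x]]
    have "((\<lambda>t. inverse (h x) * (\<integral>\<^sup>+w. indicator (E_int S) (X t w) \<partial>P x)) \<longlongrightarrow> inverse (h x)) (at_right 0)" by simp
    moreover have "\<forall>\<^sub>F t in at_right 0. inverse (h x) * (\<integral>\<^sup>+w. indicator (E_int S) (X t w) \<partial>P x) =
        (\<integral>\<^sup>+z. inverse (h z) \<partial>killed_kernel S Q Y (E_int S) t x)"
      using nn_integral_killed_Y[OF xE] dx by (auto simp: eventually_at_filter)
    ultimately show "((\<lambda>t. \<integral>\<^sup>+z. inverse (h z) \<partial>killed_kernel S Q Y (E_int S) t x) \<longlongrightarrow> inverse (h x)) (at_right 0)"
      by (rule Lim_transform_eventually)
  qed
qed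

end

end

section \<open>The inverted process\<close>

context inversion_process
begin

lemma I_in_E_int_iff: "x \<in> E_space S \<Longrightarrow> I x \<in> E_int S \<longleftrightarrow> x \<in> E_int S"
  using I_E_int I_dead by blast

text \<open>For \<open>I(X)\<close> to start at \<open>x\<close>, the process \<open>X\<close> has
  to start at \<open>I x\<close>.\<close>

abbreviation "PI x \<equiv> P (I x)"
abbreviation "IX t w \<equiv> I (X t w)"

lemma IX_alive: "w \<in> space M \<Longrightarrow> 0 \<le> t \<Longrightarrow> IX t w \<in> E_int S \<longleftrightarrow> X t w \<in> E_int S"
  using I_in_E_int_iff X_in_E_space by blast

text \<open>Limits at alive points are taken inside the open set \<open>E_int S\<close>, where
  \<open>I\<close> is continuous; absorption carries over because \<open>I\<close> preserves being
  alive in both directions.\<close>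

lemma killed_rc_IX:
  assumes w: "w \<in> space M"
  shows "killed_rc S (\<lambda>t. IX t w)"
  unfolding killed_rc_def
proof (intro allI impI conjI)
  fix t :: real assume t: "0 \<le> t" and "IX t w \<in> E_int S"
  then have a: "X t w \<in> E_int S" using IX_alive[OF w t] by simp
  have lim: "limitin (E_top S) (\<lambda>s. X s w) (X t w) (at_right t)" using right_continuous[OF t w] .
  then have "\<forall>\<^sub>F s in at_right t. X s w \<in> E_int S" using openin_E_int[of S] a by (auto simp: limitin_def)
  then have "limitin (subtopology (E_top S) (E_int S)) (\<lambda>s. X s w) (X t w) (at_right t)"
    using lim a by (simp add: limitin_subtopology)
  moreover have "continuous_map (subtopology (E_top S) (E_int S)) (E_top S) I"
    using continuous by (simp add: continuous_characteristics_def)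
  ultimately have "limitin (E_top S) (I \<circ> (\<lambda>s. X s w)) (I (X t w)) (at_right t)"
    by (rule continuous_map_limit[rotated])
  then show "limitin (E_top S) (\<lambda>t. IX t w) (IX t w) (at_right t)" by (simp add: o_def)
next
  fix t s :: real assume t: "0 \<le> t" and "IX t w \<notin> E_int S" and s: "t \<le> s"
  then have "X t w \<notin> E_int S" using IX_alive[OF w t] by simp
  then have "X s w \<notin> E_int S" using absorbed[OF t s w] by simp
  then show "IX s w \<notin> E_int S" using IX_alive[OF w] t s by simp
qed

text \<open>Continuity of \<open>I\<close> is given on the open set \<open>E_int S\<close> only, so
  measurability is proved there, and functions composed with \<open>I\<close> are cut off to
  \<open>0\<close> elsewhere.\<close>

lemma measurable_I_E_int: "I \<in> measurable (restrict_space (E_borel S) (E_int S)) (E_borel S)"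
proof (rule measurable_into_E_borel)
  have sp: "space (restrict_space (E_borel S) (E_int S)) = E_int S"
    using E_int_subset[of S] by (auto simp: space_restrict_space)
  show "I \<in> space (restrict_space (E_borel S) (E_int S)) \<rightarrow> E_space S"
    using sp I_E_int E_int_subset[of S] by auto
  fix U assume U: "openin (E_top S) U"
  have "openin (subtopology (E_top S) (E_int S)) {x \<in> topspace (subtopology (E_top S) (E_int S)). I x \<in> U}"
    using continuous U by (intro openin_continuous_map_preimage) (auto simp: continuous_characteristics_def)
  then have "openin (E_top S) {x \<in> topspace (subtopology (E_top S) (E_int S)). I x \<in> U}"
    using openin_E_int[of S] by (simp add: openin_open_subtopology)
  also have "{x \<in> topspace (subtopology (E_top S) (E_int S)). I x \<in> U} = I -` U \<inter> E_int S"
    using E_int_subset[of S] by auto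
  finally show "I -` U \<inter> space (restrict_space (E_borel S) (E_int S)) \<in> sets (restrict_space (E_borel S) (E_int S))"
    unfolding sp using sets_restrict_space_iff[of "E_int S" "E_borel S"] by (auto dest: openin_sets_E_borel)
qed

lemma measurable_compose_I:
  assumes "f \<in> borel_measurable (E_borel S)"
  shows "(\<lambda>z. if z \<in> E_int S then f (I z) else 0 :: ennreal) \<in> borel_measurable (E_borel S)"
  using measurable_compose[OF measurable_I_E_int assms]
  by (subst (asm) measurable_restrict_space_iff) auto

lemma IX_event_sets:
  assumes "x \<in> E_space S" "0 \<le> t"
  shows "{w \<in> space (PI x). IX t w \<in> E_int S} \<in> sets (PI x)"
proof -
  have "{w \<in> space (PI x). IX t w \<in> E_int S} = X t -` E_int S \<inter> space (PI x)"
    using IX_alive I_space[OF assms(1)] assms(2) by auto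
  then show ?thesis using measurable_sets[OF measurable_X_P[OF assms(2) I_space[OF assms(1)]] E_int_sets] by simp
qed

lemma IX_measurable:
  assumes x: "x \<in> E_space S" and t: "0 \<le> t"
  shows "IX t \<in> measurable (restrict_space (PI x) {w \<in> space (PI x). IX t w \<in> E_int S}) (E_borel S)"
proof -
  have "X t \<in> measurable (restrict_space (PI x) {w \<in> space (PI x). IX t w \<in> E_int S}) (restrict_space (E_borel S) (E_int S))"
  proof (rule measurable_restrict_space2)
    show "X t \<in> space (restrict_space (PI x) {w \<in> space (PI x). IX t w \<in> E_int S}) \<rightarrow> E_int S"
      using IX_alive t I_space[OF x] by (auto simp: space_restrict_space)
    show "X t \<in> measurable (restrict_space (PI x) {w \<in> space (PI x). IX t w \<in> E_int S}) (E_borel S)"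
      using measurable_X_P[OF t I_space[OF x]] by (rule measurable_restrict_space1)
  qed
  from measurable_compose[OF this measurable_I_E_int] show ?thesis .
qed

lemma nn_integral_killed_IX:
  assumes x: "x \<in> E_space S" and t: "0 \<le> t" and f: "f \<in> borel_measurable (E_borel S)"
  shows "(\<integral>\<^sup>+z. f z \<partial>killed_kernel S PI IX (E_int S) t x) =
    (\<integral>\<^sup>+w. f (IX t w) * indicator (E_int S) (X t w) \<partial>PI x)"
proof -
  have "(\<integral>\<^sup>+z. f z \<partial>killed_kernel S PI IX (E_int S) t x) =
    (\<integral>\<^sup>+w. f (IX t w) * indicator (E_int S) (IX t w) \<partial>PI x)"
    using killed_rc_IX I_space[OF x] t IX_event_sets[OF x t] IX_measurable[OF x t] f
    by (intro nn_integral_killed_kernel) auto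
  also have "\<dots> = (\<integral>\<^sup>+w. f (IX t w) * indicator (E_int S) (X t w) \<partial>PI x)"
    using IX_alive t I_space[OF x] by (intro nn_integral_cong) (simp add: indicator_def)
  finally show ?thesis .
qed

lemma AE_killed_IX:
  assumes x: "x \<in> E_space S" and t: "0 \<le> t"
  shows "AE z in killed_kernel S PI IX (E_int S) t x. z \<in> E_int S"
  using killed_rc_IX I_space[OF x] t IX_event_sets[OF x t] IX_measurable[OF x t]
  by (intro AE_killed_kernel) auto

lemma killed_IX_dead:
  assumes x: "x \<in> E_space S" "x \<notin> E_int S" and t: "0 \<le> t"
  shows "AE z in killed_kernel S PI IX (E_int S) t x. False"
proof -
  let ?K = "killed_kernel S PI IX (E_int S) t x"
  have "emeasure ?K (E_space S) = (\<integral>\<^sup>+z. indicator (E_space S) z \<partial>?K)"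
    using sets.top[of "E_borel S"] by simp
  also have "\<dots> = (\<integral>\<^sup>+w. indicator (E_space S) (IX t w) * indicator (E_int S) (X t w) \<partial>PI x)"
    using sets.top[of "E_borel S"] by (intro nn_integral_killed_IX x t) simp
  also have "\<dots> = (\<integral>\<^sup>+w. 0 \<partial>PI x)"
  proof (rule nn_integral_cong_AE)
    show "AE w in PI x. indicator (E_space S) (IX t w) * indicator (E_int S) (X t w) = (0::ennreal)"
      using dead_from_start[OF I_space[OF x(1)] I_dead[OF x] t] by eventually_elim simp
  qed
  finally have "emeasure ?K (E_space S) = 0" by simp
  then have "E_space S \<in> null_sets ?K" using sets.top[of "E_borel S"] by (auto intro: null_setsI)
  then show ?thesis
    by (rule AE_I') simp
qed

lemma AE_doob_IX:
  assumes "AE z in killed_kernel S PI IX (E_int S) t x. Q z"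
  shows "AE z in doob_kernel S PI IX (\<lambda>z. inverse (h z)) t x. Q z"
proof (cases "x \<in> doob_set S (\<lambda>z. inverse (h z))")
  case True
  have inv: "doob_set S (\<lambda>z. inverse (h z)) \<inter> E_int S = E_int S"
    using inverse_h_pos by (rule doob_set_Int_E_int)
  have "(\<lambda>z. inverse (h z) / inverse (h x)) \<in> borel_measurable (killed_kernel S PI IX (E_int S) t x)"
    by (simp add: measurable_cong_sets[OF sets_killed_kernel refl])
  then show ?thesis
    using True assms unfolding doob_kernel_def inv by (simp add: AE_density) (auto elim: eventually_mono)
next
  case False
  have "E_space S \<in> null_sets (null_measure (E_borel S))"
    using sets.top[of "E_borel S"] by (intro null_setsI) simp_all
  then have "AE z in null_measure (E_borel S). Q z" by (rule AE_I') auto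
  then show ?thesis using False by (simp only: doob_kernel_def if_False)
qed

section \<open>Consequences of the two identities for the inverted process\<close>

context
  fixes \<kappa> :: real
  assumes \<kappa>: "0 < \<kappa>" "\<And>z. z \<in> E_int S \<Longrightarrow> h z * h (I z) = ennreal \<kappa>"
begin

text \<open>Constancy of \<open>h (h \<circ> I)\<close> makes \<open>1/h\<close> composed with
  \<open>I\<close> a multiple of \<open>h\<close>. Since constants drop out of a Doob transform,
  transforming \<open>I(X)\<close> by \<open>1/h\<close> gives the image under \<open>I\<close> of
  the transform of \<open>X\<close> by \<open>h\<close>.\<close>

lemma inverse_h_I: "z \<in> E_int S \<Longrightarrow> inverse (h (I z)) = inverse (ennreal \<kappa>) * h z"
proof -
  assume z: "z \<in> E_int S"
  then have Iz: "I z \<in> E_int S" by (rule I_E_int)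
  have "inverse (ennreal \<kappa>) * h z = inverse (h z) * inverse (h (I z)) * h z"
    unfolding \<kappa>(2)[OF z, symmetric] using h_pos[OF z] h_pos[OF Iz] by (simp add: ennreal_inverse_mult)
  also have "\<dots> = (h z * inverse (h z)) * inverse (h (I z))" by (simp only: mult_ac)
  finally show ?thesis using h_inverse[OF z] by simp
qed

lemma inverse_h_eq: "z \<in> E_int S \<Longrightarrow> inverse (h z) = inverse (ennreal \<kappa>) * h (I z)"
  using inverse_h_I[of "I z"] I_E_int[of z] I_I[of z] E_int_subset[of S] by auto

lemma excessive_IX: "excessive S PI IX (\<lambda>x. inverse (h x))"
proof -
  have ex: "excessive S P X h" using IP by (simp add: has_IP_def)
  have eq: "(\<integral>\<^sup>+z. inverse (h z) \<partial>killed_kernel S PI IX (E_int S) t x) =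
      inverse (ennreal \<kappa>) * (\<integral>\<^sup>+z. h z \<partial>killed_kernel S P X (E_int S) t (I x))"
    if x: "x \<in> E_space S" and t: "0 \<le> t" for x t
  proof -
    have [measurable]: "X t \<in> measurable (PI x) (E_borel S)" using measurable_X_P[OF t I_space[OF x]] .
    have "(\<integral>\<^sup>+z. inverse (h z) \<partial>killed_kernel S PI IX (E_int S) t x) =
        (\<integral>\<^sup>+w. inverse (h (IX t w)) * indicator (E_int S) (X t w) \<partial>PI x)"
      using x t by (rule nn_integral_killed_IX) measurable
    also have "\<dots> = (\<integral>\<^sup>+w. inverse (ennreal \<kappa>) * (h (X t w) * indicator (E_int S) (X t w)) \<partial>PI x)"
    proof (rule nn_integral_cong)
      fix w
      show "inverse (h (IX t w)) * indicator (E_int S) (X t w) = inverse (ennreal \<kappa>) * (h (X t w) * indicator (E_int S) (X t w))"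
        using inverse_h_I[of "X t w"] by (cases "X t w \<in> E_int S") auto
    qed
    also have "\<dots> = inverse (ennreal \<kappa>) * (\<integral>\<^sup>+w. h (X t w) * indicator (E_int S) (X t w) \<partial>PI x)"
      by (rule nn_integral_cmult) measurable
    finally show ?thesis using nn_integral_killed_X[OF t I_space[OF x] h_measurable] by simp
  qed
  show ?thesis
    unfolding excessive_def
  proof (intro conjI ballI allI impI)
    show "(\<lambda>x. inverse (h x)) \<in> borel_measurable (E_borel S)" by measurable
    fix x t assume x: "x \<in> E_space S" and t: "0 \<le> (t::real)"
    show "(\<integral>\<^sup>+z. inverse (h z) \<partial>killed_kernel S PI IX (E_int S) t x) \<le> inverse (h x)"
    proof (cases "x \<in> E_int S")
      case True
      have "(\<integral>\<^sup>+z. h z \<partial>killed_kernel S P X (E_int S) t (I x)) \<le> h (I x)"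
        using ex I_space[OF x] t unfolding excessive_def by blast
      then have "inverse (ennreal \<kappa>) * (\<integral>\<^sup>+z. h z \<partial>killed_kernel S P X (E_int S) t (I x)) \<le> inverse (ennreal \<kappa>) * h (I x)"
        by (rule mult_left_mono) simp
      then show ?thesis using eq[OF x t] inverse_h_eq[OF True] by simp
    next
      case False
      have "(\<integral>\<^sup>+z. inverse (h z) \<partial>killed_kernel S PI IX (E_int S) t x) = (\<integral>\<^sup>+z. 0 \<partial>killed_kernel S PI IX (E_int S) t x)"
        by (rule nn_integral_cong_AE) (use killed_IX_dead[OF x False t] in \<open>auto elim: eventually_mono\<close>)
      then show ?thesis by simp
    qed
  next
    fix x assume x: "x \<in> E_int S"
    then have xE: "x \<in> E_space S" using E_int_subset by blast
    have "((\<lambda>t. \<integral>\<^sup>+z. h z \<partial>killed_kernel S P X (E_int S) t (I x)) \<longlongrightarrow> h (I x)) (at_right 0)"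
      using ex I_E_int[OF x] unfolding excessive_def by blast
    moreover have "inverse (ennreal \<kappa>) < top" using \<kappa>(1) by (simp add: inverse_ennreal)
    ultimately have "((\<lambda>t. inverse (ennreal \<kappa>) * (\<integral>\<^sup>+z. h z \<partial>killed_kernel S P X (E_int S) t (I x))) \<longlongrightarrow> inverse (ennreal \<kappa>) * h (I x)) (at_right 0)"
      by (intro ennreal_tendsto_cmult)
    then have "((\<lambda>t. inverse (ennreal \<kappa>) * (\<integral>\<^sup>+z. h z \<partial>killed_kernel S P X (E_int S) t (I x))) \<longlongrightarrow> inverse (h x)) (at_right 0)"
      using inverse_h_eq[OF x] by simp
    moreover have "\<forall>\<^sub>F t in at_right 0. inverse (ennreal \<kappa>) * (\<integral>\<^sup>+z. h z \<partial>killed_kernel S P X (E_int S) t (I x)) =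
        (\<integral>\<^sup>+z. inverse (h z) \<partial>killed_kernel S PI IX (E_int S) t x)"
      using eq[OF xE] by (auto simp: eventually_at_filter)
    ultimately show "((\<lambda>t. \<integral>\<^sup>+z. inverse (h z) \<partial>killed_kernel S PI IX (E_int S) t x) \<longlongrightarrow> inverse (h x)) (at_right 0)"
      by (rule Lim_transform_eventually)
  qed
qed

text \<open>\<open>I(X)\<close> is in \<open>B\<close> when \<open>X\<close> is in the preimage of
  \<open>B\<close>; the preimage is taken in \<open>E_int S\<close>, where \<open>I\<close> is known
  to be measurable and where the killed process lives.\<close>

definition I_list :: "(real \<times> 'a option set) list \<Rightarrow> (real \<times> 'a option set) list" where
  "I_list l = map (\<lambda>(t, B). (t, {z \<in> E_int S. I z \<in> B})) l"

lemma I_preimage_sets: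
  assumes "B \<in> sets (E_borel S)"
  shows "{z \<in> E_int S. I z \<in> B} \<in> sets (E_borel S)"
proof -
  have "I -` B \<inter> E_int S \<in> sets (E_borel S)"
    using measurable_sets[OF measurable_I_E_int assms] sets_restrict_space_iff[of "E_int S" "E_borel S"]
    by (simp add: space_restrict_space)
  also have "I -` B \<inter> E_int S = {z \<in> E_int S. I z \<in> B}" by auto
  finally show ?thesis .
qed

lemma fst_I_list: "map fst (I_list l) = map fst l"
  by (simp add: I_list_def case_prod_beta)

lemma set_I_list:
  assumes "\<forall>(t, B)\<in>set l. s \<le> t \<and> B \<in> sets (E_borel S)"
  shows "\<forall>(t, B)\<in>set (I_list l). s \<le> t \<and> B \<in> sets (E_borel S)"
  using assms I_preimage_sets by (fastforce simp: I_list_def)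

text \<open>At each time the quotient of \<open>1/h\<close> along \<open>I(X)\<close> equals the
  quotient of \<open>h\<close> along \<open>X\<close>, because \<open>\<kappa>\<close> cancels. From
  dead points both kernels vanish.\<close>

lemma fdd_IX:
  assumes "sorted_wrt (<) (map fst l)" "\<And>t B. (t, B) \<in> set l \<Longrightarrow> s \<le> t \<and> B \<in> sets (E_borel S)" "x \<in> E_space S"
  shows "fdd (doob_kernel S PI IX (\<lambda>z. inverse (h z))) x s l = fdd (doob_kernel S P X h) (I x) s (I_list l)"
  using assms
proof (induction l arbitrary: s x)
  case (Cons p l)
  obtain t B where p: "p = (t, B)" by force
  let ?K' = "doob_kernel S PI IX (\<lambda>z. inverse (h z))"
  let ?K = "doob_kernel S P X h"
  let ?B = "{z \<in> E_int S. I z \<in> B}"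
  have st: "0 \<le> t - s" and B[measurable]: "B \<in> sets (E_borel S)" using Cons.prems(2)[of t B] p by auto
  have l: "sorted_wrt (<) (map fst l)" "\<And>u C. (u, C) \<in> set l \<Longrightarrow> t \<le> u \<and> C \<in> sets (E_borel S)"
    using Cons.prems(1,2) p by (auto intro: less_imp_le)
  have lI: "\<And>u C. (u, C) \<in> set (I_list l) \<Longrightarrow> t \<le> u \<and> C \<in> sets (E_borel S)"
    using set_I_list[of l t] l(2) by blast
  have xE: "x \<in> E_space S" using Cons.prems(3) .
  have Fm: "(\<lambda>z. fdd ?K z t (I_list l)) \<in> borel_measurable (E_borel S)"
    by (rule fdd_doob_measurable[OF h_measurable h_pos]) (use l(1) lI fst_I_list in \<open>simp_all\<close>)
  have [measurable]: "?B \<in> sets (E_borel S)" using I_preimage_sets[OF B] .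
  note [measurable] = Fm
  \<comment> \<open>The induction hypothesis in measurable form: \<open>I\<close> is controlled only
    on \<open>E_int S\<close>, and the kernel charges nothing else.\<close>
  define g where "g z = indicator B z * (if z \<in> E_int S then fdd ?K (I z) t (I_list l) else 0)" for z
  have g[measurable]: "g \<in> borel_measurable (E_borel S)"
    unfolding g_def[abs_def] using measurable_compose_I[OF Fm] by measurable
  have Km: "(\<lambda>z. indicator ?B z * fdd ?K z t (I_list l)) \<in> borel_measurable (E_borel S)" by measurable
  show ?case
  proof (cases "x \<in> E_int S")
    case True
    have Ix: "I x \<in> E_int S" "I x \<in> E_space S" using I_E_int[OF True] I_space[OF xE] by auto
    have dx: "x \<in> doob_set S (\<lambda>z. inverse (h z))" using inverse_h_pos[OF True] xE by (simp add: doob_set_def)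
    have dIx: "I x \<in> doob_set S h" using h_pos[OF Ix(1)] Ix by (simp add: doob_set_def)
    have inv: "doob_set S (\<lambda>z. inverse (h z)) \<inter> E_int S = E_int S"
      using inverse_h_pos by (rule doob_set_Int_E_int)
    have "fdd ?K' x s (p # l) = (\<integral>\<^sup>+z. indicator B z * fdd ?K' z t l \<partial>?K' (t - s) x)" by (simp add: p)
    also have "\<dots> = (\<integral>\<^sup>+z. g z \<partial>?K' (t - s) x)"
    proof (rule nn_integral_cong_AE)
      have "AE z in ?K' (t - s) x. z \<in> E_int S" using AE_doob_IX[OF AE_killed_IX[OF xE st]] .
      with AE_space show "AE z in ?K' (t - s) x. indicator B z * fdd ?K' z t l = g z"
      proof eventually_elim
        case (elim z)
        then have "z \<in> E_space S" by simp
        then show ?case using Cons.IH[OF l] elim by (simp add: g_def)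
      qed
    qed
    also have "\<dots> = (\<integral>\<^sup>+z. inverse (h z) / inverse (h x) * g z \<partial>killed_kernel S PI IX (E_int S) (t - s) x)"
      using dx unfolding doob_kernel_def[of S PI] inv
      by (simp, subst nn_integral_density) (simp_all add: measurable_cong_sets[OF sets_killed_kernel refl])
    also have "\<dots> = (\<integral>\<^sup>+w. inverse (h (IX (t - s) w)) / inverse (h x) * g (IX (t - s) w) * indicator (E_int S) (X (t - s) w) \<partial>PI x)"
      by (rule nn_integral_killed_IX[OF xE st]) measurable
    also have "\<dots> = (\<integral>\<^sup>+w. h (X (t - s) w) / h (I x) * (indicator ?B (X (t - s) w) * fdd ?K (X (t - s) w) t (I_list l)) * indicator (E_int S) (X (t - s) w) \<partial>PI x)"
    proof (rule nn_integral_cong)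
      fix w assume w: "w \<in> space (PI x)"
      let ?z = "X (t - s) w"
      show "inverse (h (I ?z)) / inverse (h x) * g (I ?z) * indicator (E_int S) ?z =
          h ?z / h (I x) * (indicator ?B ?z * fdd ?K ?z t (I_list l)) * indicator (E_int S) ?z"
      proof (cases "?z \<in> E_int S")
        case z: True
        have zE: "?z \<in> E_space S" using z E_int_subset by blast
        have \<kappa>i: "inverse (ennreal \<kappa>) \<noteq> 0" "inverse (ennreal \<kappa>) < top" using \<kappa>(1) by (auto simp: inverse_ennreal)
        have "inverse (h (I ?z)) / inverse (h x) = (inverse (ennreal \<kappa>) * h ?z) / (inverse (ennreal \<kappa>) * h (I x))"
          using inverse_h_I[OF z] inverse_h_eq[OF True] by simp
        also have "\<dots> = (inverse (ennreal \<kappa>) / inverse (ennreal \<kappa>)) * (h ?z / h (I x))"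
        proof -
          have "inverse (inverse (ennreal \<kappa>) * h (I x)) = inverse (inverse (ennreal \<kappa>)) * inverse (h (I x))"
            using \<kappa>i h_pos[OF Ix(1)] by (intro ennreal_inverse_mult) (auto simp: less_top[symmetric])
          then show ?thesis by (simp only: divide_ennreal_def mult_ac)
        qed
        also have "\<dots> = h ?z / h (I x)" unfolding ennreal_divide_self[OF \<kappa>i] by simp
        finally have "inverse (h (I ?z)) / inverse (h x) = h ?z / h (I x)" .
        moreover have "g (I ?z) = indicator ?B ?z * fdd ?K ?z t (I_list l)"
          using z I_E_int[OF z] I_I[OF zE] by (simp add: g_def indicator_def)
        ultimately show ?thesis by simp
      qed simp
    qed
    also have "\<dots> = (\<integral>\<^sup>+z. indicator ?B z * fdd ?K z t (I_list l) \<partial>?K (t - s) (I x))"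
      using nn_integral_doob_kernel[OF h_measurable h_pos st Ix(2) Km] dIx by simp
    also have "\<dots> = fdd ?K (I x) s (I_list (p # l))" by (simp add: I_list_def p)
    finally show ?thesis .
  next
    case False
    have "(\<integral>\<^sup>+z. indicator B z * fdd ?K' z t l \<partial>?K' (t - s) x) = (\<integral>\<^sup>+z. 0 \<partial>?K' (t - s) x)"
      by (rule nn_integral_cong_AE) (use AE_doob_IX[OF killed_IX_dead[OF xE False st]] in \<open>auto elim: eventually_mono\<close>)
    moreover have "(\<integral>\<^sup>+z. indicator ?B z * fdd ?K z t (I_list l) \<partial>?K (t - s) (I x)) = 0"
      using nn_integral_doob_kernel_dead[OF h_measurable h_pos st I_space[OF xE] I_dead[OF xE False] Km] .
    ultimately show ?thesis by (simp add: p I_list_def)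
  qed
qed (simp add: I_list_def)

lemma v_I: "z \<in> E_int S \<Longrightarrow> v z * v (I z) = 1"
proof -
  assume "z \<in> E_int S"
  then obtain u where u: "u \<in> G" "z = Some u" by (rule E_intE)
  then show ?thesis using v_J[OF u(1)] Some_J[OF u(1)] by simp
qed

text \<open>For the speed \<open>1/v\<close>, the clock of \<open>I(X)\<close> runs at rate
  \<open>v (I z)\<close> when \<open>X\<close> is at \<open>z\<close>, and this is
  \<open>1 / v z\<close> by \<open>v (v \<circ> I) = 1\<close>; the lifetimes agree because
  \<open>I\<close> preserves being alive.\<close>

lemma clock_IX:
  assumes w: "w \<in> space M"
  shows "clock S (\<lambda>x. inverse (v x)) IX t w = clock S v X t w"
  unfolding clock_def
proof (rule nn_integral_cong)
  fix s
  have "ennreal s < lifetime S IX w \<longleftrightarrow> ennreal s < lifetime S X w" if "0 \<le> s"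
    using less_lifetime_iff[where Z=IX and w=w, OF killed_rc_IX[OF w] that] less_lifetime_iff[where Z=X and w=w, OF killed_rc_X[OF w] that]
      IX_alive[OF w that] by simp
  moreover have "inverse (inverse (v (IX s w))) = inverse (v (X s w))" if "0 \<le> s" "ennreal s < lifetime S X w"
  proof -
    have "X s w \<in> E_int S" using less_lifetime_iff[where Z=X and w=w, OF killed_rc_X[OF w] that(1)] that(2) by simp
    then have "v (X s w) * v (IX s w) = 1" by (rule v_I)
    then have "inverse (v (X s w)) = v (IX s w)" by (rule inverse_unique)
    then show ?thesis by simp
  qed
  ultimately show "indicator {s. 0 \<le> s \<and> ennreal s < min t (lifetime S IX w)} s * ennreal (inverse (inverse (v (IX s w)))) =
      indicator {s. 0 \<le> s \<and> ennreal s < min t (lifetime S X w)} s * ennreal (inverse (v (X s w)))"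
    by (auto simp: indicator_def)
qed

text \<open>With a common clock, inverting \<open>I(X)\<close> means applying \<open>I\<close> to
  the inverted path of \<open>X\<close>. The events are therefore those of the inversion property of
  \<open>X\<close> at \<open>I x\<close> for preimage sets, and \<open>fdd_IX\<close> translates
  their probability back.\<close>

lemma IX_IP_law:
  assumes x: "x \<in> E_space S"
  shows "has_law S (PI x) (\<lambda>t w. I (IX (time_change S (\<lambda>x. inverse (v x)) IX t w) w)) (clock S (\<lambda>x. inverse (v x)) IX \<infinity>)
      (doob_kernel S PI IX (\<lambda>z. inverse (h z))) (I x)"
  unfolding has_law_def
proof (intro allI impI)
  fix l :: "(real \<times> 'a option set) list"
  assume l: "sorted_wrt (<) (map fst l) \<and> (\<forall>(t, B)\<in>set l. 0 \<le> t \<and> B \<in> sets (E_borel S))"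
  then have l0: "\<And>t B. (t, B) \<in> set l \<Longrightarrow> 0 \<le> t \<and> B \<in> sets (E_borel S)" by auto
  have lI: "sorted_wrt (<) (map fst (I_list l)) \<and> (\<forall>(t, B)\<in>set (I_list l). 0 \<le> t \<and> B \<in> sets (E_borel S))"
    using l set_I_list[of l 0] by (simp add: fst_I_list)
  have IxE: "I x \<in> E_space S" using I_space[OF x] .
  have sp: "space (PI x) = space M" using IxE by simp
  have ev: "(\<forall>(t, B)\<in>set l. ennreal t < clock S (\<lambda>x. inverse (v x)) IX \<infinity> w \<and> I (IX (time_change S (\<lambda>x. inverse (v x)) IX t w) w) \<in> B) \<longleftrightarrow>
      (\<forall>(t, B)\<in>set (I_list l). ennreal t < clock S v X \<infinity> w \<and> I (X (time_change S v X t w) w) \<in> B)" if w: "w \<in> space M" for w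
  proof -
    have tc: "time_change S (\<lambda>x. inverse (v x)) IX t w = time_change S v X t w" for t
      unfolding time_change_def clock_IX[OF w] ..
    have eq: "ennreal t < clock S v X \<infinity> w \<and> I (IX (time_change S v X t w) w) \<in> B \<longleftrightarrow>
        ennreal t < clock S v X \<infinity> w \<and> I (X (time_change S v X t w) w) \<in> {z \<in> E_int S. I z \<in> B}" if t: "0 \<le> t" for t B
    proof (cases "ennreal t < clock S v X \<infinity> w")
      case True
      have "X (time_change S v X t w) w \<in> E_int S"
        using time_change_alive[where Z=X and w=w, OF v_continuous v_pos killed_rc_X[OF w] t True] by simp
      then show ?thesis using True I_E_int by simp
    qed simp
    have "(\<forall>(t, B)\<in>set l. ennreal t < clock S v X \<infinity> w \<and> I (IX (time_change S v X t w) w) \<in> B) \<longleftrightarrow>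
      (\<forall>(t, B)\<in>set l. ennreal t < clock S v X \<infinity> w \<and> I (X (time_change S v X t w) w) \<in> {z \<in> E_int S. I z \<in> B})"
    proof (intro ball_cong refl)
      fix p assume p: "p \<in> set l"
      obtain t B where tB: "p = (t, B)" by force
      show "(case p of (t, B) \<Rightarrow> ennreal t < clock S v X \<infinity> w \<and> I (IX (time_change S v X t w) w) \<in> B) =
        (case p of (t, B) \<Rightarrow> ennreal t < clock S v X \<infinity> w \<and> I (X (time_change S v X t w) w) \<in> {z \<in> E_int S. I z \<in> B})"
        using eq[of t B] l0[of t B] p tB by simp
    qed
    then show ?thesis unfolding clock_IX[OF w] tc by (simp add: I_list_def case_prod_beta')
  qed
  have "emeasure (PI x) {w \<in> space (PI x). \<forall>(t, B)\<in>set l. ennreal t < clock S (\<lambda>x. inverse (v x)) IX \<infinity> w \<and> I (IX (time_change S (\<lambda>x. inverse (v x)) IX t w) w) \<in> B} =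
      emeasure (PI x) {w \<in> space (PI x). \<forall>(t, B)\<in>set (I_list l). ennreal t < clock S v X \<infinity> w \<and> I (X (time_change S v X t w) w) \<in> B}"
    using ev sp by (intro arg_cong[where f="emeasure (PI x)"]) blast
  also have "\<dots> = fdd (doob_kernel S P X h) (I (I x)) 0 (I_list l)"
    using IP_law[OF IxE] lI unfolding has_law_def by blast
  also have "\<dots> = fdd (doob_kernel S PI IX (\<lambda>z. inverse (h z))) (I x) 0 l"
    using l l0 IxE by (intro fdd_IX[symmetric]) auto
  finally show "emeasure (PI x) {w \<in> space (PI x). \<forall>(t, B)\<in>set l. ennreal t < clock S (\<lambda>x. inverse (v x)) IX \<infinity> w \<and> I (IX (time_change S (\<lambda>x. inverse (v x)) IX t w) w) \<in> B} =
      fdd (doob_kernel S PI IX (\<lambda>z. inverse (h z))) (I x) 0 l" .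
qed

end

lemma has_IP_inversion: "has_IP S PI IX I (\<lambda>x. inverse (h x)) (\<lambda>x. inverse (v x))"
proof -
  obtain \<kappa> where \<kappa>: "0 < \<kappa>" "\<And>z. z \<in> E_int S \<Longrightarrow> h z * h (I z) = ennreal \<kappa>" using h_J_constant by blast
  show ?thesis
    unfolding has_IP_def
  proof (intro conjI)
    show "\<forall>x\<in>E_space S. I x \<in> E_space S \<and> I (I x) = x" using I_space I_I by blast
    show "\<exists>x\<in>E_space S. I x \<noteq> x" using IP unfolding has_IP_def by blast
    show "excessive S PI IX (\<lambda>x. inverse (h x))" using excessive_IX[OF \<kappa>] .
    show "\<forall>x\<in>E_int S. 0 < inverse (h x) \<and> inverse (h x) < \<infinity>" using inverse_h_pos by blast
    show "\<forall>x\<in>E_int S. 0 < inverse (v x)" using v_pos by simp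
    show "continuous_map (subtopology (E_top S) (E_int S)) euclideanreal (\<lambda>x. inverse (v x))"
      using v_continuous v_pos E_int_subset[of S] by (intro continuous_map_real_inverse) force+
    show "\<forall>x\<in>E_space S. has_law S (PI x) (\<lambda>t w. I (IX (time_change S (\<lambda>x. inverse (v x)) IX t w) w))
        (clock S (\<lambda>x. inverse (v x)) IX \<infinity>) (doob_kernel S PI IX (\<lambda>x. inverse (h x))) (I x)"
      using IX_IP_law[OF \<kappa>] by blast
  qed
qed

end

theorem proposition5:
  fixes S :: "(real ^ 'n) set"
    and M :: "'w measure" and F :: "ennreal \<Rightarrow> 'w measure" and \<theta> :: "real \<Rightarrow> 'w \<Rightarrow> 'w"
    and P :: "(real ^ 'n) option \<Rightarrow> 'w measure" and X :: "real \<Rightarrow> 'w \<Rightarrow> (real ^ 'n) option"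
    and I :: "(real ^ 'n) option \<Rightarrow> (real ^ 'n) option"
    and h :: "(real ^ 'n) option \<Rightarrow> ennreal" and v :: "(real ^ 'n) option \<Rightarrow> real"
  assumes "standard_process S M F \<theta> P X"
    and "absolutely_continuous_process S P X"
    and "has_IP S P X I h v"
    and "continuous_characteristics S I h"
  shows "(\<forall>(Q :: (real ^ 'n) option \<Rightarrow> 'v measure) Y.
            doob_transform S P X h Q Y \<longrightarrow> has_IP S Q Y I (\<lambda>x. inverse (h x)) v) \<and>
         has_IP S (\<lambda>x. P (I x)) (\<lambda>t w. I (X t w)) I (\<lambda>x. inverse (h x)) (\<lambda>x. inverse (v x))"
proof -
  interpret inversion_process S M F \<theta> P X I h v
    using assms by (simp add: inversion_process_def inversion_process_axioms_def)
  show ?thesis using has_IP_doob_transform has_IP_inversion by blast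
qed

end
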